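(* Let $\{X_i\}_{i\ge1}$ and $\{Y_i\}_{i\ge1}$ be strictly stationary $m$-dependent sequences of random vectors in $\mathbb{R}^d$, where $X_1$ and $Y_1$ have densities $p_X$ and $p_Y$, and let $(k,l)\in\{(2,0),(1,1)\}$. Assume that $p_X,p_Y\in L_3(\mathbb{R}^d)$ and that the sequence $\{(X_i,Y_i)\}_{i\ge1}$ of random vectors in $\mathbb{R}^{2d}$ is strictly stationary and $m$-dependent. Let $\{m_n\}_{n\ge1}$ be a non-random sequence of positive integers such that $m_n\ge m$ for all $n$ large enough and $m_n/n\to0$ as $n\to\infty$. Let $\epsilon=\epsilon(n)>0$ with $\epsilon(n)\to0$ as $n\to\infty$, and let $\tilde Q^*_{k,l,n}$ (the incomplete $U$-statistic estimator built with $m_n$), $q_{k,l}$ and $\sigma^2_{k,l}$ be as defined in the context. Then: (i) If $n^2\epsilon^d\to\infty$, then $\tilde Q^*_{k,l,n}\to q_{k,l}$ in mean square as $n\to\infty$, i.e. $\mathrm{E}(\tilde Q^*_{k,l,n}-q_{k,l})^2\to0$. (ii) If $p_X,p_Y\in H_2^{(\alpha)}(K)$ with $0<\alpha\le d/4$, and $\epsilon\sim c\,n^{-2/(4\alpha+d)}$ for some $c>0$, then $$\mathrm{E}(\tilde Q^*_{k,l,n}-q_{k,l})^2=O\big(n^{-8\alpha/(4\alpha+d)}\big)\quad\text{as } n\to\infty.$$ (iii) If $p_X,p_Y\in H_2^{(\alpha)}(K)$ with $\alpha>d/4$, and $\epsilon\sim L(n)n^{-1/d}$, where $L(n)$, $n\ge1$,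 is a slowly varying function with $L(n)\to\infty$ as $n\to\infty$, then $$\mathrm{E}(\tilde Q^*_{k,l,n}-q_{k,l})^2=4\sigma^2_{k,l}\,n^{-1}+o(n^{-1})\quad\text{as } n\to\infty.$$
   Context: A sequence $\{W_i\}_{i\ge1}$ of random vectors is $m$-dependent ($m\ge0$ an integer) if $\{W_1,\ldots,W_b\}$ and $\{W_{b+k},\ldots,W_{b+k+l}\}$, $b,k,l=1,2,\ldots$, are independent sets whenever $k>m$. Dependence between the sequences $\{X_i\}$ and $\{Y_i\}$ is allowed. The functionals are $q_{2,0}=\int_{\mathbb{R}^d}p_X(x)^2\,dx$ and $q_{1,1}=\int_{\mathbb{R}^d}p_X(x)p_Y(x)\,dx$. Let $d(x,y)=|x-y|$ be the Euclidean distance in $\mathbb{R}^d$, $I(A)$ the indicator of the event $A$, $B_\epsilon(x)=\{y\in\mathbb{R}^d: d(x,y)\le\epsilon\}$, and let $b_\epsilon(d)=b_1(d)\epsilon^d$ be the volume (Lebesgue measure) of an $\epsilon$-ball in $\mathbb{R}^d$. Define the index sets $$\mathcal{I}_{2,0,n}=\{(i,j):1\le i<j\le n,\ j-i>m_n\},\qquad \mathcal{I}_{1,1,n}=\{(i,j):1\le i,j\le n,\ |j-i|>m_n\},$$ which have cardinalities $\binom{n-m_n}{2}$ and $2\binom{n-m_n}{2}$, respectively. The incomplete estimators based on $\{X_1,\ldots,X_n\}$ and $\{Y_1,\ldots,Y_n\}$ are (for $n$ large enough that the index sets are nonempty) $\tilde Q^*_{k,l,n}=Q^*_{k,l,n}/b_\epsilon(d)$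 with $$Q^*_{2,0,n}=\frac{1}{\binom{n-m_n}{2}}\sum_{(i,j)\in\mathcal{I}_{2,0,n}}I(d(X_i,X_j)\le\epsilon),\qquad Q^*_{1,1,n}=\frac{1}{2\binom{n-m_n}{2}}\sum_{(i,j)\in\mathcal{I}_{1,1,n}}I(d(X_i,Y_j)\le\epsilon),$$ where $\epsilon=\epsilon(n)$. With $g(X_i,Y_i)=\frac12\big(p_Y(X_i)+p_X(Y_i)\big)$, define $$\sigma_{2,0}^2=\mathrm{Var}(p_X(X_1))+2\sum_{h=1}^m\mathrm{Cov}\big(p_X(X_1),p_X(X_{1+h})\big),$$ $$\sigma_{1,1}^2=\mathrm{Var}(g(X_1,Y_1))+2\sum_{h=1}^m\mathrm{Cov}\big(g(X_1,Y_1),g(X_{1+h},Y_{1+h})\big).$$ For $0<\alpha\le1$ and $K>0$, $H_2^{(\alpha)}(K)$ is the class of functions $p\in L_2(\mathbb{R}^d)$ such that $\left(\int_{\mathbb{R}^d}(p(x-h)-p(x))^2dx\right)^{1/2}\le K|h|^\alpha$ for all $h\in B_1(0)$. $a_n\sim b_n$ means $a_n/b_n\to1$ as $n\to\infty$. *)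

theory Defs
  imports "HOL-Probability.Probability" "HOL-Library.Landau_Symbols"
begin

text \<open>
  Sequences of random vectors \<open>W :: nat \<Rightarrow> 'w \<Rightarrow> 'b\<close> on a probability space \<open>M\<close> are indexed
  by the integers \<open>i \<ge> 1\<close>; the value \<open>W 0\<close> is never used.
\<close>

definition random_sequence :: "'w measure \<Rightarrow> (nat \<Rightarrow> 'w \<Rightarrow> 'b::topological_space) \<Rightarrow> bool" where
  "random_sequence M W \<longleftrightarrow> (\<forall>i\<ge>1. W i \<in> borel_measurable M)"

definition strictly_stationary ::
  "'w measure \<Rightarrow> (nat \<Rightarrow> 'w \<Rightarrow> 'b::topological_space) \<Rightarrow> bool" where
  "strictly_stationary M W \<longleftrightarrow>
     (\<forall>J h. finite J \<and> J \<subseteq> {1..} \<longrightarrow>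
        distr M (PiM J (\<lambda>_. borel)) (\<lambda>\<omega>. \<lambda>j\<in>J. W (j + h) \<omega>) =
        distr M (PiM J (\<lambda>_. borel)) (\<lambda>\<omega>. \<lambda>j\<in>J. W j \<omega>))"

definition m_dependent ::
  "'w measure \<Rightarrow> nat \<Rightarrow> (nat \<Rightarrow> 'w \<Rightarrow> 'b::topological_space) \<Rightarrow> bool" where
  "m_dependent M m W \<longleftrightarrow>
     (\<forall>b k l. 1 \<le> b \<and> 1 \<le> k \<and> 1 \<le> l \<and> m < k \<longrightarrow>
        prob_space.indep_var M
          (PiM {1..b} (\<lambda>_. borel)) (\<lambda>\<omega>. \<lambda>i\<in>{1..b}. W i \<omega>)
          (PiM {b+k..b+k+l} (\<lambda>_. borel)) (\<lambda>\<omega>. \<lambda>i\<in>{b+k..b+k+l}. W i \<omega>))"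

text \<open>Real-valued \<open>L\<^sub>r\<close> functions on \<open>\<real>\<^sup>d\<close>, for integer exponents \<open>r \<ge> 1\<close>.\<close>

definition Lp_fun :: "nat \<Rightarrow> ('a::euclidean_space \<Rightarrow> real) set" where
  "Lp_fun r = {p. p \<in> borel_measurable lborel \<and> integrable lborel (\<lambda>x. \<bar>p x\<bar> ^ r)}"

definition is_density ::
  "'w measure \<Rightarrow> ('w \<Rightarrow> 'a::euclidean_space) \<Rightarrow> ('a \<Rightarrow> real) \<Rightarrow> bool" where
  "is_density M W p \<longleftrightarrow>
     (\<forall>x. 0 \<le> p x) \<and> distributed M lborel W (\<lambda>x. ennreal (p x))"

definition H2 :: "real \<Rightarrow> real \<Rightarrow> ('a::euclidean_space \<Rightarrow> real) set" where
  "H2 \<alpha> K = {p. p \<in> Lp_fun 2 \<and>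
     (\<forall>h\<in>cball 0 1. sqrt (\<integral>x. (p (x - h) - p x)\<^sup>2 \<partial>lborel) \<le> K * norm h powr \<alpha>)}"

text \<open>Slow variation at infinity in the sense of Karamata, for functions that are measurable
  and positive near infinity.\<close>

definition slowly_varying :: "(real \<Rightarrow> real) \<Rightarrow> bool" where
  "slowly_varying L \<longleftrightarrow>
     (\<exists>a>0. L \<in> borel_measurable (restrict_space borel {a..}) \<and> (\<forall>x\<ge>a. 0 < L x)) \<and>
     (\<forall>s>0. ((\<lambda>x. L (s * x) / L x) \<longlongrightarrow> 1) at_top)"

definition covariance :: "'w measure \<Rightarrow> ('w \<Rightarrow> real) \<Rightarrow> ('w \<Rightarrow> real) \<Rightarrow> real" where
  "covariance M U V =
     (\<integral>\<omega>. (U \<omega> - (\<integral>\<eta>. U \<eta> \<partial>M)) * (V \<omega> - (\<integral>\<eta>. V \<eta> \<partial>M)) \<partial>M)"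

definition q20 :: "('a::euclidean_space \<Rightarrow> real) \<Rightarrow> real" where
  "q20 pX = (\<integral>x. (pX x)\<^sup>2 \<partial>lborel)"

definition q11 :: "('a::euclidean_space \<Rightarrow> real) \<Rightarrow> ('a \<Rightarrow> real) \<Rightarrow> real" where
  "q11 pX pY = (\<integral>x. pX x * pY x \<partial>lborel)"

definition idx20 :: "nat \<Rightarrow> nat \<Rightarrow> (nat \<times> nat) set" where
  "idx20 mn n = {(i, j). 1 \<le> i \<and> i < j \<and> j \<le> n \<and> j - i > mn}"

definition idx11 :: "nat \<Rightarrow> nat \<Rightarrow> (nat \<times> nat) set" where
  "idx11 mn n = {(i, j). 1 \<le> i \<and> i \<le> n \<and> 1 \<le> j \<and> j \<le> n \<and> \<bar>int j - int i\<bar> > int mn}"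

definition Q20 :: "(nat \<Rightarrow> 'w \<Rightarrow> 'a::euclidean_space) \<Rightarrow> nat \<Rightarrow> real \<Rightarrow> nat \<Rightarrow> 'w \<Rightarrow> real" where
  "Q20 X mn e n \<omega> =
     1 / real ((n - mn) choose 2) *
     (\<Sum>(i, j)\<in>idx20 mn n. of_bool (dist (X i \<omega>) (X j \<omega>) \<le> e))"

definition Q11 :: "(nat \<Rightarrow> 'w \<Rightarrow> 'a::euclidean_space) \<Rightarrow> (nat \<Rightarrow> 'w \<Rightarrow> 'a) \<Rightarrow>
    nat \<Rightarrow> real \<Rightarrow> nat \<Rightarrow> 'w \<Rightarrow> real" where
  "Q11 X Y mn e n \<omega> =
     1 / (2 * real ((n - mn) choose 2)) *
     (\<Sum>(i, j)\<in>idx11 mn n. of_bool (dist (X i \<omega>) (Y j \<omega>) \<le> e))"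

definition ball_volume :: "'a::euclidean_space itself \<Rightarrow> real \<Rightarrow> real" where
  "ball_volume _ e = measure lborel (cball (0::'a) e)"

definition sigma20_sq ::
  "'w measure \<Rightarrow> nat \<Rightarrow> (nat \<Rightarrow> 'w \<Rightarrow> 'a::euclidean_space) \<Rightarrow> ('a \<Rightarrow> real) \<Rightarrow> real" where
  "sigma20_sq M m X pX =
     prob_space.variance M (\<lambda>\<omega>. pX (X 1 \<omega>)) +
     2 * (\<Sum>h=1..m. covariance M (\<lambda>\<omega>. pX (X 1 \<omega>)) (\<lambda>\<omega>. pX (X (1 + h) \<omega>)))"

definition g_fun ::
  "('a::euclidean_space \<Rightarrow> real) \<Rightarrow> ('a \<Rightarrow> real) \<Rightarrow> 'a \<Rightarrow> 'a \<Rightarrow> real" where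
  "g_fun pX pY x y = 1 / 2 * (pY x + pX y)"

definition sigma11_sq :: "'w measure \<Rightarrow> nat \<Rightarrow> (nat \<Rightarrow> 'w \<Rightarrow> 'a::euclidean_space) \<Rightarrow>
    (nat \<Rightarrow> 'w \<Rightarrow> 'a) \<Rightarrow> ('a \<Rightarrow> real) \<Rightarrow> ('a \<Rightarrow> real) \<Rightarrow> real" where
  "sigma11_sq M m X Y pX pY =
     prob_space.variance M (\<lambda>\<omega>. g_fun pX pY (X 1 \<omega>) (Y 1 \<omega>)) +
     2 * (\<Sum>h=1..m. covariance M (\<lambda>\<omega>. g_fun pX pY (X 1 \<omega>) (Y 1 \<omega>))
                               (\<lambda>\<omega>. g_fun pX pY (X (1 + h) \<omega>) (Y (1 + h) \<omega>)))"

text \<open>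
  The three quantities below are meant for \<open>(k, l) \<in> {(2, 0), (1, 1)}\<close> only; the final
  \<open>else\<close> branch is a dummy value.
\<close>

definition q_functional ::
  "nat \<Rightarrow> nat \<Rightarrow> ('a::euclidean_space \<Rightarrow> real) \<Rightarrow> ('a \<Rightarrow> real) \<Rightarrow> real" where
  "q_functional k l pX pY =
     (if (k, l) = (2, 0) then q20 pX
      else if (k, l) = (1, 1) then q11 pX pY
      else 0)"

definition Q_tilde :: "nat \<Rightarrow> nat \<Rightarrow> (nat \<Rightarrow> 'w \<Rightarrow> 'a::euclidean_space) \<Rightarrow> (nat \<Rightarrow> 'w \<Rightarrow> 'a) \<Rightarrow>
    nat \<Rightarrow> real \<Rightarrow> nat \<Rightarrow> 'w \<Rightarrow> real" where
  "Q_tilde k l X Y mn e n \<omega> =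
     (if (k, l) = (2, 0) then Q20 X mn e n \<omega> / ball_volume TYPE('a) e
      else if (k, l) = (1, 1) then Q11 X Y mn e n \<omega> / ball_volume TYPE('a) e
      else 0)"

definition sigma_sq :: "nat \<Rightarrow> nat \<Rightarrow> 'w measure \<Rightarrow> nat \<Rightarrow> (nat \<Rightarrow> 'w \<Rightarrow> 'a::euclidean_space) \<Rightarrow>
    (nat \<Rightarrow> 'w \<Rightarrow> 'a) \<Rightarrow> ('a \<Rightarrow> real) \<Rightarrow> ('a \<Rightarrow> real) \<Rightarrow> real" where
  "sigma_sq k l M m X Y pX pY =
     (if (k, l) = (2, 0) then sigma20_sq M m X pX
      else if (k, l) = (1, 1) then sigma11_sq M m X Y pX pY
      else 0)"

definition mean_square_error :: "'w measure \<Rightarrow> ('w \<Rightarrow> real) \<Rightarrow> real \<Rightarrow> real" where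
  "mean_square_error M T q = (\<integral>\<omega>. (T \<omega> - q)\<^sup>2 \<partial>M)"

end

theory Submission
  imports Defs
begin

text \<open>
  The case \<open>(k, l) = (2, 0)\<close> is the case \<open>(1, 1)\<close> with \<open>Y = X\<close>: the kernel is symmetric, so the
  sum over pairs \<open>i < j\<close> is half the sum over all pairs. Both cases are instances of one
  setting (locale \<open>density_pair\<close>): a stationary m-dependent sequence \<open>Z\<close> and two measurable
  maps \<open>u\<close>, \<open>v\<close> with \<open>X = u \<circ> Z\<close> and \<open>Y = v \<circ> Z\<close>, namely the projections of \<open>Z = (X, Y)\<close>, or
  the identity twice for \<open>Z = X\<close>.

  Write \<open>H(z, z')\<close> for the normalised indicator of \<open>dist (u z) (v z') \<le> \<epsilon>\<close>. Its projections are
  the densities averaged over balls, \<open>z \<mapsto> pY\<^sub>\<epsilon> (u z)\<close> and \<open>z' \<mapsto> pX\<^sub>\<epsilon> (v z')\<close>, and its mean is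
  \<open>\<theta>\<^sub>\<epsilon> = \<integral> pX pY\<^sub>\<epsilon>\<close>. Hoeffding's decomposition writes the estimator minus \<open>q\<close> as the linear part
  \<open>2/n \<Sum>\<^sub>i (g(Z\<^sub>i) - q)\<close>, with \<open>g(z) = (pY (u z) + pX (v z)) / 2\<close>, plus a remainder made of four
  pieces:

  \<^item> the bias \<open>\<theta>\<^sub>\<epsilon> - q\<close>. It tends to \<open>0\<close>, and under the smoothness condition it is of order
    \<open>\<epsilon>\<^sup>2\<^sup>\<alpha>\<close>, twice the smoothness of each density: averaging over \<open>h\<close> and \<open>-h\<close> turns it into
    the integral of a product of increments of \<open>pX\<close> and of \<open>pY\<close> (\<open>smoothing_bias_H2\<close>).
  \<^item> the error of replacing \<open>pX\<close> and \<open>pY\<close> by their averages in the linear part. Its variance is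
    \<open>o(1/n)\<close>, because translations are continuous in \<open>L\<^sub>3\<close> and the third moment of the density
    controls the weight (\<open>smoothing_mse_tendsto_0\<close>).
  \<^item> the error caused by the pairs that the index set omits near the diagonal, which make the
    weights of the linear part differ from \<open>2/n\<close>. It is \<open>o(1/n)\<close> because \<open>m\<^sub>n = o(n)\<close>.
  \<^item> a completely degenerate sum. In its second moment a pair of pairs contributes nothing as
    soon as one of the four indices is further than \<open>m\<close> from the other three; only \<open>O(n\<^sup>2)\<close>
    of the \<open>n\<^sup>4\<close> terms remain, each at most \<open>\<integral>\<integral> H\<^sup>2 = \<theta>\<^sub>\<epsilon> / b\<^sub>\<epsilon>\<close>. This gives
    \<open>O(1 / (n\<^sup>2 \<epsilon>\<^sup>d))\<close> (\<open>second_moment_degenerate_sum\<close>).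

  The linear part has second moment asymptotic to \<open>4\<sigma>\<^sup>2/n\<close>, since adding one summand to a sum
  of an m-dependent stationary sequence increases its variance by exactly \<open>\<sigma>\<^sup>2\<close> once \<open>n \<ge> m\<close>.
  The mean square error is therefore \<open>4\<sigma>\<^sup>2/n\<close> up to bias squared, \<open>o(1/n)\<close> and
  \<open>O(1 / (n\<^sup>2 \<epsilon>\<^sup>d))\<close>. The three claims follow by inserting the bandwidths; in the last one
  \<open>n \<epsilon>\<^sup>d\<close> behaves like \<open>L(n)\<^sup>d\<close>, which tends to infinity, and the bias is negligible because a
  slowly varying function grows more slowly than every power (\<open>slowly_varying_powr_bound\<close>).
\<close>

section \<open>Slowly varying functions grow more slowly than every power\<close>

text \<open>
  Karamata's uniform convergence theorem in additive form. Pointwise convergence of the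
  increments is integrated over \<open>s \<in> [0, 2]\<close> by dominated convergence, which is where
  measurability enters; a large increment from \<open>t\<close> to \<open>t + u\<close> would be seen by one of the two
  integrals based at \<open>t\<close> and at \<open>t + u\<close>, whose windows share an interval of length one.
\<close>
lemma slow_variation_uniform:
  fixes f :: "real \<Rightarrow> real"
  assumes f [measurable]: "f \<in> borel_measurable borel"
    and lim: "\<And>u. 0 \<le> u \<Longrightarrow> ((\<lambda>t. f (t + u) - f t) \<longlongrightarrow> 0) at_top"
    and e: "0 < e"
  shows "\<forall>\<^sub>F t in at_top. \<forall>u\<in>{0..1}. \<bar>f (t + u) - f t\<bar> < e"
proof -
  define e' where "e' = min e 1"
  have e': "0 < e'" "e' \<le> e" "e' \<le> 1" using e by (auto simp: e'_def)
  define \<psi> where "\<psi> t s = indicat_real {0..2} s * min 1 \<bar>f (t + s) - f t\<bar>" for t s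
  define \<phi> where "\<phi> t = (\<integral>s. \<psi> t s \<partial>lborel)" for t
  have \<psi>_meas [measurable]: "\<psi> t \<in> borel_measurable lborel" for t
    unfolding \<psi>_def by measurable
  have \<psi>_int: "integrable lborel (\<psi> t)" for t
  proof (rule Bochner_Integration.integrable_bound)
    show "integrable lborel (indicat_real {0..2::real})" by simp
    show "AE s in lborel. norm (\<psi> t s) \<le> norm (indicat_real {0..2} s)"
      by (auto simp: \<psi>_def indicator_def)
  qed simp
  have \<psi>_nonneg: "0 \<le> \<psi> t s" for t s by (simp add: \<psi>_def)
  have "((\<lambda>t. integral\<^sup>L lborel (\<psi> t)) \<longlongrightarrow> integral\<^sup>L lborel (\<lambda>s::real. 0 :: real)) at_top"
  proof (rule integral_dominated_convergence_at_top[where w = "indicat_real {0..2::real}"])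
    show "\<forall>\<^sub>F t in at_top. AE s in lborel. norm (\<psi> t s) \<le> indicat_real {0..2} s"
      by (auto simp: \<psi>_def indicator_def intro!: always_eventually)
    show "AE s in lborel. ((\<lambda>t. \<psi> t s) \<longlongrightarrow> 0) at_top"
    proof (intro AE_I2)
      fix s :: real
      show "((\<lambda>t. \<psi> t s) \<longlongrightarrow> 0) at_top"
      proof (cases "s \<in> {0..2}")
        case True
        hence "((\<lambda>t. min 1 \<bar>f (t + s) - f t\<bar>) \<longlongrightarrow> min 1 \<bar>0\<bar>) at_top"
          by (intro tendsto_intros lim) auto
        thus ?thesis using True by (simp add: \<psi>_def)
      qed (simp add: \<psi>_def)
    qed
  qed auto
  hence "(\<phi> \<longlongrightarrow> 0) at_top" by (simp add: \<phi>_def[abs_def])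
  hence "\<forall>\<^sub>F t in at_top. \<phi> t < e' / 2"
    using e' by (intro order_tendstoD(2)) auto
  then obtain T where T: "\<And>t. T \<le> t \<Longrightarrow> \<phi> t < e' / 2"
    unfolding eventually_at_top_linorder by blast
  have "\<bar>f (t + u) - f t\<bar> < e" if t: "T \<le> t" and u: "u \<in> {0..1}" for t u
  proof -
    let ?c = "min 1 \<bar>f (t + u) - f t\<bar>"
    have shift: "(\<integral>s. \<psi> (t + u) (s - u) \<partial>lborel) = \<phi> (t + u)"
      using lborel_integral_real_affine[of 1 "\<psi> (t + u)" "- u"] by (simp add: \<phi>_def)
    have shift_int: "integrable lborel (\<lambda>s. \<psi> (t + u) (s - u))"
      using lborel_integrable_real_affine[OF \<psi>_int[of "t + u"], of 1 "- u"] by simp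
    \<comment> \<open>For \<open>s\<close> in \<open>[1, 2]\<close> both \<open>s\<close> and \<open>s - u\<close> lie in \<open>[0, 2]\<close>, and the increments from \<open>t\<close> and
      from \<open>t + u\<close> to the common point \<open>t + s\<close> differ by the increment from \<open>t\<close> to \<open>t + u\<close>.\<close>
    have "(\<integral>s. indicat_real {1..2::real} s * ?c \<partial>lborel) \<le> (\<integral>s. \<psi> t s + \<psi> (t + u) (s - u) \<partial>lborel)"
    proof (rule integral_mono)
      show "indicat_real {1..2::real} s * ?c \<le> \<psi> t s + \<psi> (t + u) (s - u)" for s
      proof (cases "s \<in> {1..2}")
        case True
        hence "s \<in> {0..2}" "s - u \<in> {0..2}" using u by auto
        thus ?thesis using True by (simp add: \<psi>_def)
      qed (simp add: \<psi>_nonneg)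
    qed (use \<psi>_int shift_int in auto)
    also have "\<dots> = \<phi> t + \<phi> (t + u)"
      using \<psi>_int shift_int shift by (simp add: \<phi>_def)
    also have "\<dots> < e'" using T[of t] T[of "t + u"] t u by auto
    finally have "?c < e'" by simp
    thus ?thesis using e' by linarith
  qed
  thus ?thesis unfolding eventually_at_top_linorder by blast
qed

text \<open>
  On the logarithmic scale the increments over unit steps are eventually below \<open>\<delta>\<close>, so
  \<open>ln L(exp t)\<close> grows at most linearly with slope \<open>\<delta>\<close>. Uniformity in the step is needed because
  the logarithms of the integers do not lie on a lattice.
\<close>
lemma slowly_varying_powr_bound:
  assumes L: "slowly_varying L" and \<delta>: "0 < \<delta>"
  shows "\<exists>C>0. \<forall>\<^sub>F n in sequentially. \<bar>L (real n)\<bar> \<le> C * real n powr \<delta>"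
proof -
  obtain a where a: "0 < a" "L \<in> borel_measurable (restrict_space borel {a..})" "\<And>x. a \<le> x \<Longrightarrow> 0 < L x"
    and lim: "\<And>s. 0 < s \<Longrightarrow> ((\<lambda>x. L (s * x) / L x) \<longlongrightarrow> 1) at_top"
    using L unfolding slowly_varying_def by blast
  \<comment> \<open>The value \<open>1\<close> below \<open>a\<close> only serves to make the function measurable and positive everywhere.\<close>
  define L' where "L' x = (if x \<in> {a..} then L x else 1)" for x
  have L'_meas [measurable]: "L' \<in> borel_measurable borel"
  proof -
    have "(\<lambda>x. if x \<in> {a..} then L x else 1) \<in> borel_measurable borel"
      by (subst measurable_If_restrict_space_iff) (use a(2) in \<open>simp_all del: atLeast_iff\<close>)
    thus ?thesis unfolding L'_def .
  qed
  have L'_pos: "0 < L' x" for x using a(3) by (auto simp: L'_def)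
  define f where "f t = ln (L' (exp t))" for t
  have f_meas: "f \<in> borel_measurable borel" unfolding f_def by measurable
  have f_lim: "((\<lambda>t. f (t + u) - f t) \<longlongrightarrow> 0) at_top" if "0 \<le> u" for u
  proof -
    have "((\<lambda>t. L (exp u * exp t) / L (exp t)) \<longlongrightarrow> 1) at_top"
      using lim[of "exp u"] exp_at_top by (auto intro: filterlim_compose)
    hence "((\<lambda>t. ln (L (exp u * exp t) / L (exp t))) \<longlongrightarrow> ln 1) at_top"
      by (rule tendsto_ln) simp
    moreover have "\<forall>\<^sub>F t in at_top. ln (L (exp u * exp t) / L (exp t)) = f (t + u) - f t"
      using eventually_ge_at_top[of "ln a"]
    proof eventually_elim
      fix t assume "ln a \<le> t"
      hence "a \<le> exp t" using a(1) by (metis exp_le_cancel_iff exp_ln)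
      moreover from this have "a \<le> exp u * exp t"
        using that mult_mono[of 1 "exp u" a "exp t"] a(1) by simp
      ultimately have "0 < L (exp t)" "0 < L (exp u * exp t)" "a \<le> exp t" "a \<le> exp u * exp t"
        using a(3) by auto
      thus "ln (L (exp u * exp t) / L (exp t)) = f (t + u) - f t"
        by (simp add: f_def L'_def exp_add ln_div mult.commute)
    qed
    ultimately show ?thesis by (simp add: tendsto_cong)
  qed
  obtain T where T: "\<And>t u. T \<le> t \<Longrightarrow> u \<in> {0..1} \<Longrightarrow> \<bar>f (t + u) - f t\<bar> < \<delta>"
    using slow_variation_uniform[OF f_meas f_lim \<delta>] unfolding eventually_at_top_linorder by blast
  have step: "f (T + real k) \<le> f T + real k * \<delta>" for k
  proof (induction k)
    case (Suc k)
    show ?case using T[of "T + real k" 1] Suc.IH by (simp add: algebra_simps)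
  qed simp
  have linear: "f t \<le> f T + (t - T + 1) * \<delta>" if "T \<le> t" for t
  proof -
    define k where "k = nat \<lfloor>t - T\<rfloor>"
    have k: "real k \<le> t - T" "t - T < real k + 1"
      using that by (simp_all add: k_def)
    have "f t = f ((T + real k) + (t - T - real k))" by simp
    also have "\<dots> \<le> f (T + real k) + \<delta>"
      using T[of "T + real k" "t - T - real k"] k by simp
    also have "\<dots> \<le> f T + real k * \<delta> + \<delta>" using step[of k] by simp
    also have "\<dots> \<le> f T + (t - T + 1) * \<delta>" using mult_right_mono[OF k(1), of \<delta>] \<delta> by (simp add: algebra_simps)
    finally show ?thesis .
  qed
  define C where "C = exp (f T + (1 - T) * \<delta>)"
  have "\<forall>\<^sub>F n in sequentially. max (exp T) a \<le> real n"
    using filterlim_real_sequentially unfolding filterlim_at_top by blast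
  hence "\<forall>\<^sub>F n in sequentially. \<bar>L (real n)\<bar> \<le> C * real n powr \<delta>"
  proof eventually_elim
    case (elim n)
    hence n: "0 < real n" "a \<le> real n" "T \<le> ln (real n)"
      using a(1) by (auto simp: ln_ge_iff)
    have "\<bar>L (real n)\<bar> = exp (f (ln (real n)))"
      using n a(3)[OF n(2)] by (simp add: f_def L'_def)
    also have "\<dots> \<le> exp (f T + (ln (real n) - T + 1) * \<delta>)"
      using linear[OF n(3)] by simp
    also have "\<dots> = C * real n powr \<delta>"
      using n(1) by (simp add: C_def powr_def exp_add[symmetric] algebra_simps)
    finally show ?case .
  qed
  moreover have "0 < C" by (simp add: C_def)
  ultimately show ?thesis by blast
qed

section \<open>The index sets of the estimators\<close>

lemma idx11_altdef:
  "idx11 mn n = {(i, j). i \<in> {1..n} \<and> j \<in> {1..n} \<and> (i + mn < j \<or> j + mn < i)}"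
  by (auto simp: idx11_def)

lemma finite_idx11 [simp]: "finite (idx11 mn n)"
  by (rule finite_subset[of _ "{1..n} \<times> {1..n}"]) (auto simp: idx11_altdef)

lemma finite_idx20 [simp]: "finite (idx20 mn n)"
  by (rule finite_subset[of _ "{1..n} \<times> {1..n}"]) (auto simp: idx20_def)

lemma idx11_idx20: "idx11 mn n = idx20 mn n \<union> prod.swap ` idx20 mn n"
proof (intro set_eqI)
  fix p :: "nat \<times> nat"
  obtain i j where p: "p = (i, j)" by fastforce
  have "(i, j) \<in> prod.swap ` idx20 mn n \<longleftrightarrow> (j, i) \<in> idx20 mn n" by force
  moreover have "(i, j) \<in> idx11 mn n \<longleftrightarrow> (i, j) \<in> idx20 mn n \<or> (j, i) \<in> idx20 mn n"
    unfolding idx11_altdef idx20_def by auto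
  ultimately show "p \<in> idx11 mn n \<longleftrightarrow> p \<in> idx20 mn n \<union> prod.swap ` idx20 mn n"
    unfolding p by blast
qed

lemma idx20_disjoint: "idx20 mn n \<inter> prod.swap ` idx20 mn n = {}"
  by (auto simp: idx20_def)

lemma card_idx20: "card (idx20 mn n) = (n - mn) choose 2"
proof -
  have "idx20 mn n = prod.swap ` (SIGMA j:{1..n}. {1..<j - mn})"
  proof (intro set_eqI)
    fix p :: "nat \<times> nat"
    obtain i j where p: "p = (i, j)" by fastforce
    have "(i, j) \<in> prod.swap ` (SIGMA j:{1..n}. {1..<j - mn}) \<longleftrightarrow> (j, i) \<in> (SIGMA j:{1..n}. {1..<j - mn})" by force
    thus "p \<in> idx20 mn n \<longleftrightarrow> p \<in> prod.swap ` (SIGMA j:{1..n}. {1..<j - mn})"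
      unfolding p idx20_def by auto
  qed
  hence "card (idx20 mn n) = card (SIGMA j:{1..n}. {1..<j - mn})"
    by (simp add: card_image)
  also have "\<dots> = (\<Sum>j=1..n. j - mn - 1)"
    by simp
  also have "\<dots> = (n - mn) choose 2"
  proof (induction n)
    case (Suc n)
    show ?case
    proof (cases "mn \<le> n")
      case True
      hence "Suc n - mn = Suc (n - mn)" by simp
      thus ?thesis using Suc.IH by (simp add: numeral_2_eq_2)
    next
      case False
      thus ?thesis using Suc.IH by (simp add: numeral_2_eq_2)
    qed
  qed simp
  finally show ?thesis .
qed

lemma card_idx11: "card (idx11 mn n) = 2 * ((n - mn) choose 2)"
  unfolding idx11_idx20
  by (subst card_Un_disjoint) (simp_all add: idx20_disjoint card_image card_idx20)

text \<open>
  The number of partners of the index \<open>i\<close>, that is, up to normalisation, the weight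
  of the observation \<open>i\<close> in the linear part of the estimator.
\<close>
definition row_count :: "nat \<Rightarrow> nat \<Rightarrow> nat \<Rightarrow> nat" where
  "row_count mn n i = card {j\<in>{1..n}. i + mn < j \<or> j + mn < i}"

lemma row_count_bounds:
  "row_count mn n i \<le> n" "n \<le> row_count mn n i + (2 * mn + 1)"
proof -
  let ?A = "{j\<in>{1..n}. i + mn < j \<or> j + mn < i}"
  have "card ?A \<le> card {1..n}" by (intro card_mono) auto
  thus "row_count mn n i \<le> n" by (simp add: row_count_def)
  have "card {1..n} \<le> card (?A \<union> {i - mn..i + mn})" by (intro card_mono) auto
  also have "\<dots> \<le> card ?A + card {i - mn..i + mn}" by (rule card_Un_le)
  also have "\<dots> \<le> card ?A + (2 * mn + 1)" by simp
  finally show "n \<le> row_count mn n i + (2 * mn + 1)" by (simp add: row_count_def)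
qed

text \<open>
  The index set is symmetric, so rows and columns carry the same weights.
\<close>
lemma sum_idx11_additive:
  fixes a b :: "nat \<Rightarrow> real"
  shows "(\<Sum>(i, j)\<in>idx11 mn n. a i + b j) = (\<Sum>i=1..n. real (row_count mn n i) * (a i + b i))"
proof -
  let ?A = "\<lambda>i. {j\<in>{1..n}. i + mn < j \<or> j + mn < i}"
  have rows: "idx11 mn n = (SIGMA i:{1..n}. ?A i)"
    by (auto simp: idx11_altdef)
  have swap: "prod.swap ` idx11 mn n = idx11 mn n"
    unfolding idx11_idx20 image_Un image_image by auto
  have first: "(\<Sum>(i, j)\<in>idx11 mn n. c i) = (\<Sum>i=1..n. real (row_count mn n i) * c i)" for c :: "nat \<Rightarrow> real"
    unfolding rows by (subst sum.Sigma[symmetric]) (simp_all add: row_count_def)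
  have "(\<Sum>(i, j)\<in>idx11 mn n. b j) = (\<Sum>(i, j)\<in>prod.swap ` idx11 mn n. b j)"
    by (simp only: swap)
  also have "\<dots> = (\<Sum>(i, j)\<in>idx11 mn n. b i)"
    by (subst sum.reindex) (simp_all add: split_beta)
  finally have "(\<Sum>(i, j)\<in>idx11 mn n. b j) = (\<Sum>i=1..n. real (row_count mn n i) * b i)"
    by (simp only: first)
  thus ?thesis
    using first[of a] by (simp add: split_beta sum.distrib distrib_left)
qed

lemma row_count_sum: "(\<Sum>i=1..n. real (row_count mn n i)) = real (card (idx11 mn n))"
  using sum_idx11_additive[of "\<lambda>_. 1" "\<lambda>_. 0" mn n] by simp

text \<open>
  The weights \<open>2 w\<^sub>i / N\<close> of the linear part differ from \<open>2/n\<close> by \<open>o(1/n)\<close> uniformly in \<open>i\<close>,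
  because \<open>n - 2 m\<^sub>n - 1 \<le> w\<^sub>i \<le> n\<close> and \<open>N\<close> is asymptotic to \<open>n\<^sup>2\<close>.
\<close>
lemma row_count_deviation:
  fixes N :: real
  assumes "0 < N" "0 < n"
  shows "\<bar>2 * real (row_count mn n i) / N - 2 / real n\<bar>
    \<le> 2 / real n * (\<bar>(real n)\<^sup>2 / N - 1\<bar> + real n * real (2 * mn + 1) / N)"
proof -
  define w where "w = real (row_count mn n i)"
  have w: "w \<le> real n" "real n \<le> w + real (2 * mn + 1)"
    using row_count_bounds(1)[of mn n i] row_count_bounds(2)[of n mn i]
    unfolding w_def by (simp_all only: of_nat_add[symmetric] of_nat_le_iff)
  have pos: "0 \<le> real n * real (2 * mn + 1) / N" using assms by simp
  have "real n * w / N \<le> (real n)\<^sup>2 / N"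
    using w(1) assms by (intro divide_right_mono) (auto simp: power2_eq_square)
  moreover have "(real n)\<^sup>2 / N \<le> (real n * w + real n * real (2 * mn + 1)) / N"
    using mult_left_mono[OF w(2), of "real n"] assms
    by (intro divide_right_mono) (auto simp: power2_eq_square distrib_left)
  ultimately have "\<bar>real n * w / N - 1\<bar> \<le> \<bar>(real n)\<^sup>2 / N - 1\<bar> + real n * real (2 * mn + 1) / N"
    using abs_ge_self[of "(real n)\<^sup>2 / N - 1"] abs_ge_minus_self[of "(real n)\<^sup>2 / N - 1"] pos
    unfolding add_divide_distrib by (intro abs_leI) linarith+
  hence "2 / real n * \<bar>real n * w / N - 1\<bar> \<le> 2 / real n * (\<bar>(real n)\<^sup>2 / N - 1\<bar> + real n * real (2 * mn + 1) / N)"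
    by (intro mult_left_mono) auto
  moreover have eq: "2 * w / N - 2 / real n = 2 / real n * (real n * w / N - 1)"
    using assms by (simp add: field_simps)
  have "\<bar>2 * w / N - 2 / real n\<bar> = 2 / real n * \<bar>real n * w / N - 1\<bar>"
    unfolding eq abs_mult by simp
  ultimately show ?thesis unfolding w_def by simp
qed

lemma card_idx11_asymp:
  assumes "(\<lambda>n. real (mn n) / real n) \<longlonglongrightarrow> 0"
  shows "(\<lambda>n. (real n)\<^sup>2 / real (card (idx11 (mn n) n))) \<longlonglongrightarrow> 1"
    and "(\<lambda>n. real n * real (2 * mn n + 1) / real (card (idx11 (mn n) n))) \<longlonglongrightarrow> 0"
    and "\<forall>\<^sub>F n in sequentially. 0 < card (idx11 (mn n) n)"
proof -
  let ?N = "\<lambda>n. real (card (idx11 (mn n) n))" and ?t = "\<lambda>n. real (mn n) / real n"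
  have "\<forall>\<^sub>F n in sequentially. ?t n < 1 / 2"
    using assms by (rule order_tendstoD) simp
  hence large: "\<forall>\<^sub>F n in sequentially. mn n + 2 \<le> n"
    using eventually_ge_at_top[of 5] by eventually_elim (simp add: field_simps)
  have card: "real (card (idx11 k n)) = (real n - real k) * (real n - real k - 1)" if "k + 2 \<le> n" for k n
  proof -
    have "2 * ((n - k) choose 2) = (n - k) * (n - k - 1)"
      unfolding choose_two by (rule dvd_mult_div_cancel) (cases "n - k"; simp)
    thus ?thesis using that by (simp only: card_idx11) (simp add: of_nat_diff)
  qed
  have inv: "\<forall>\<^sub>F n in sequentially. 1 / ((1 - ?t n) * (1 - ?t n - 1 / real n))
      = (real n)\<^sup>2 / ?N n"
    using large
  proof eventually_elim
    case (elim n)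
    have "real n \<noteq> 0" "real n - real (mn n) \<noteq> 0" "real n - real (mn n) - 1 \<noteq> 0" using elim by auto
    hence eqs: "1 - ?t n = (real n - real (mn n)) / real n"
      "(real n - real (mn n)) / real n - 1 / real n = (real n - real (mn n) - 1) / real n"
      by (simp_all add: diff_divide_distrib)
    show ?case unfolding card[OF elim] eqs by (simp add: power2_eq_square)
  qed
  have "(\<lambda>n. 1 / ((1 - ?t n) * (1 - ?t n - 1 / real n))) \<longlonglongrightarrow> 1 / ((1 - 0) * (1 - 0 - 0))"
    by (intro tendsto_intros assms lim_1_over_n) simp
  from Lim_transform_eventually[OF this inv]
  show ratio: "(\<lambda>n. (real n)\<^sup>2 / ?N n) \<longlonglongrightarrow> 1" by simp
  have "(\<lambda>n. (real n)\<^sup>2 / ?N n * (2 * (?t n) + 1 / real n)) \<longlonglongrightarrow> 1 * (2 * 0 + 0)"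
    by (intro tendsto_intros ratio assms lim_1_over_n)
  moreover have "\<forall>\<^sub>F n in sequentially. (real n)\<^sup>2 / ?N n * (2 * (?t n) + 1 / real n)
      = real n * real (2 * mn n + 1) / ?N n"
    using eventually_gt_at_top[of 0]
  proof eventually_elim
    case (elim n)
    have "2 * (?t n) + 1 / real n = real (2 * mn n + 1) / real n"
      by (simp add: add_divide_distrib)
    thus ?case using elim by (simp add: power2_eq_square)
  qed
  ultimately show "(\<lambda>n. real n * real (2 * mn n + 1) / ?N n) \<longlonglongrightarrow> 0"
    using Lim_transform_eventually by fastforce
  show "\<forall>\<^sub>F n in sequentially. 0 < card (idx11 (mn n) n)"
    using large
  proof eventually_elim
    case (elim n)
    hence "0 < (real n - real (mn n)) * (real n - real (mn n) - 1)" by (intro mult_pos_pos) auto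
    thus ?case unfolding card[OF elim, symmetric] by simp
  qed
qed

lemma sum_idx20_symmetric:
  fixes f :: "nat \<Rightarrow> nat \<Rightarrow> real"
  assumes "\<And>i j. f i j = f j i"
  shows "(\<Sum>(i, j)\<in>idx11 mn n. f i j) = 2 * (\<Sum>(i, j)\<in>idx20 mn n. f i j)"
proof -
  have "(\<Sum>(i, j)\<in>prod.swap ` idx20 mn n. f i j) = (\<Sum>(i, j)\<in>idx20 mn n. f j i)"
    by (subst sum.reindex) (simp_all add: split_beta)
  also have "(\<lambda>(i, j). f j i) = (\<lambda>(i, j). f i j)"
    unfolding split_beta by (intro ext assms)
  finally have "(\<Sum>(i, j)\<in>prod.swap ` idx20 mn n. f i j) = (\<Sum>(i, j)\<in>idx20 mn n. f i j)" .
  thus ?thesis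
    unfolding idx11_idx20 by (subst sum.union_disjoint) (simp_all add: idx20_disjoint)
qed

lemma Q20_eq_Q11: "Q20 X mn e n \<omega> = Q11 X X mn e n \<omega>"
  unfolding Q20_def Q11_def
  by (subst sum_idx20_symmetric) (simp_all add: dist_commute)

section \<open>Continuity of translations\<close>

lemma cube_sum_le:
  fixes a b c :: real
  shows "\<bar>a + b + c\<bar> ^ 3 \<le> 27 * (\<bar>a\<bar> ^ 3 + \<bar>b\<bar> ^ 3 + \<bar>c\<bar> ^ 3)"
proof -
  define t where "t = max \<bar>a\<bar> (max \<bar>b\<bar> \<bar>c\<bar>)"
  have "\<bar>a + b + c\<bar> \<le> 3 * t" by (auto simp: t_def)
  hence "\<bar>a + b + c\<bar> ^ 3 \<le> (3 * t) ^ 3" by (intro power_mono) auto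
  also have "\<dots> = 27 * t ^ 3" by (simp add: power_mult_distrib)
  also have "t ^ 3 \<le> \<bar>a\<bar> ^ 3 + \<bar>b\<bar> ^ 3 + \<bar>c\<bar> ^ 3"
    unfolding t_def max_def by auto
  finally show ?thesis by simp
qed

text \<open>
  The product is at most the cube of the larger factor. It replaces Hoelder's inequality with
  exponents \<open>3\<close> and \<open>3/2\<close>: rescaling \<open>a\<close> and \<open>b\<close> makes either cube as small as desired.
\<close>
lemma mult_square_le_cubes:
  fixes a b :: real
  assumes "0 \<le> a" "0 \<le> b"
  shows "a * b\<^sup>2 \<le> a ^ 3 + b ^ 3"
proof (cases "a \<le> b")
  case True
  hence "a * b\<^sup>2 \<le> b * b\<^sup>2" by (intro mult_right_mono) auto
  also have "\<dots> = b ^ 3" by (simp add: power2_eq_square power3_eq_cube)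
  finally show ?thesis using assms by (simp add: add_increasing)
next
  case False
  hence "a * b\<^sup>2 \<le> a * a\<^sup>2" using assms by (intro mult_left_mono power_mono) auto
  also have "\<dots> = a ^ 3" by (simp add: power2_eq_square power3_eq_cube)
  finally show ?thesis using assms by (simp add: add_increasing2)
qed

lemma integrable_mult_of_square_integrable:
  fixes f g :: "'a \<Rightarrow> real"
  assumes [measurable]: "f \<in> borel_measurable M" "g \<in> borel_measurable M"
    and "integrable M (\<lambda>x. (f x)\<^sup>2)" "integrable M (\<lambda>x. (g x)\<^sup>2)"
  shows "integrable M (\<lambda>x. f x * g x)"
proof (rule Bochner_Integration.integrable_bound)
  show "integrable M (\<lambda>x. (f x)\<^sup>2 + (g x)\<^sup>2)" using assms by simp
  have "\<bar>a * b\<bar> \<le> \<bar>a\<^sup>2 + b\<^sup>2\<bar>" for a b :: real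
  proof -
    have "2 * \<bar>a * b\<bar> \<le> a\<^sup>2 + b\<^sup>2" using sum_squares_bound[of "\<bar>a\<bar>" "\<bar>b\<bar>"] by (simp add: abs_mult)
    thus ?thesis by linarith
  qed
  thus "AE x in M. norm (f x * g x) \<le> norm ((f x)\<^sup>2 + (g x)\<^sup>2)" by simp
qed simp

lemma integrable_lborel_shift:
  fixes f :: "'a::euclidean_space \<Rightarrow> real"
  assumes "integrable lborel f"
  shows "integrable lborel (\<lambda>x. f (x + y))"
proof -
  have [measurable]: "f \<in> borel_measurable borel" using assms by auto
  have "integrable (distr lborel borel ((+) y)) f" using assms by (simp only: lborel_distr_plus)
  hence "integrable lborel (\<lambda>x. f (y + x))" by (subst (asm) integrable_distr_eq) auto
  thus ?thesis by (simp only: add.commute)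
qed

lemma integral_lborel_shift:
  fixes f :: "'a::euclidean_space \<Rightarrow> real"
  assumes [measurable]: "f \<in> borel_measurable borel"
  shows "(\<integral>x. f (x + y) \<partial>lborel) = (\<integral>x. f x \<partial>lborel)"
proof -
  have "(\<integral>x. f x \<partial>lborel) = (\<integral>x. f x \<partial>distr lborel borel ((+) y))" by (simp only: lborel_distr_plus)
  also have "\<dots> = (\<integral>x. f (y + x) \<partial>lborel)" by (rule integral_distr) auto
  finally show ?thesis by (simp only: add.commute)
qed

lemma integral_lborel_uminus:
  fixes f :: "'a::euclidean_space \<Rightarrow> real"
  assumes [measurable]: "f \<in> borel_measurable borel"
  shows "(\<integral>x. f (- x) \<partial>lborel) = (\<integral>x. f x \<partial>lborel)"
proof -
  have "lborel = distr lborel borel (uminus :: 'a \<Rightarrow> 'a)"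
    using lborel_affine[of "-1" "0::'a"] by (simp add: density_1)
  hence "(\<integral>x. f x \<partial>lborel) = (\<integral>x. f x \<partial>distr lborel borel uminus)" by simp
  also have "\<dots> = (\<integral>x. f (- x) \<partial>lborel)" by (rule integral_distr) auto
  finally show ?thesis by simp
qed

lemma Lp_fun_3_D:
  assumes "p \<in> Lp_fun 3"
  shows "p \<in> borel_measurable borel" "integrable lborel (\<lambda>x. \<bar>p x\<bar> ^ 3)"
  using assms by (auto simp: Lp_fun_def)

text \<open>
  Cutting off values and argument replaces \<open>p\<close> by a bounded function supported in a ball. A
  measurable function is an almost everywhere limit of continuous functions; cutting these off
  in the same way gives convergence that is dominated by a constant on a ball.
\<close>
lemma continuous_approximation_L3:
  fixes p :: "'a::euclidean_space \<Rightarrow> real"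
  assumes p: "p \<in> Lp_fun 3" and \<eta>: "0 < \<eta>"
  obtains g R C where "continuous_on UNIV g" "\<And>x. \<bar>g x\<bar> \<le> C" "\<And>x. R \<le> norm x \<Longrightarrow> g x = 0"
    "integrable lborel (\<lambda>x. \<bar>p x - g x\<bar> ^ 3)" "(\<integral>x. \<bar>p x - g x\<bar> ^ 3 \<partial>lborel) < \<eta>"
proof -
  note p_meas [measurable] = Lp_fun_3_D(1)[OF p]
  define clip :: "real \<Rightarrow> real \<Rightarrow> real" where "clip K t = max (- K) (min K t)" for K t
  define cut :: "real \<Rightarrow> 'a \<Rightarrow> real" where "cut K x = max 0 (min 1 (K + 1 - norm x))" for K x
  define T where "T K f x = cut K x * clip K (f x)" for K and f :: "'a \<Rightarrow> real" and x
  have cut: "0 \<le> cut K x" "cut K x \<le> 1" for K x by (auto simp: cut_def)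
  have clip: "\<bar>clip K t\<bar> \<le> \<bar>K\<bar>" for K t by (auto simp: clip_def)
  have T_bound: "\<bar>T K f x\<bar> \<le> \<bar>K\<bar>" for K f x
    unfolding T_def abs_mult using mult_mono[of "\<bar>cut K x\<bar>" 1 "\<bar>clip K (f x)\<bar>" "\<bar>K\<bar>"] cut[of K x] clip by simp
  have T_supp: "T K f x = 0" if "K + 1 \<le> norm x" for K f x
    using that by (simp add: T_def cut_def)
  have cut_cont: "continuous_on UNIV (cut K)" for K unfolding cut_def by (intro continuous_intros)
  have clip_cont: "continuous_on UNIV (clip K)" for K unfolding clip_def by (intro continuous_intros)
  have T_cont: "continuous_on UNIV (T K f)" if "continuous_on UNIV f" for K f
    unfolding T_def
    by (intro continuous_on_mult cut_cont continuous_on_compose2[OF clip_cont that]) auto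
  have [measurable]: "clip K \<in> borel_measurable borel" "cut K \<in> borel_measurable borel" for K
    using clip_cont cut_cont by (auto intro: borel_measurable_continuous_onI)
  have T_meas [measurable]: "T K f \<in> borel_measurable borel" if [measurable]: "f \<in> borel_measurable borel" for K f
    unfolding T_def by measurable
  \<comment> \<open>Cutting off moves a value towards \<open>0\<close>, so the error is dominated by the value itself.\<close>
  have clip_part: "\<bar>t - c * clip K t\<bar> \<le> \<bar>t\<bar>" if "0 \<le> c" "c \<le> 1" "0 \<le> K" for c K t
  proof (cases "0 \<le> t")
    case True
    hence "0 \<le> clip K t" "clip K t \<le> t" using that by (auto simp: clip_def)
    moreover from this have "0 \<le> c * clip K t" "c * clip K t \<le> 1 * t"
      using that mult_mono[of c 1 "clip K t" t] by simp_all
    ultimately show ?thesis using True by simp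
  next
    case False
    hence "0 \<le> - clip K t" "- clip K t \<le> - t" using that by (auto simp: clip_def)
    moreover from this have "0 \<le> c * (- clip K t)" "c * (- clip K t) \<le> 1 * (- t)"
      using that mult_mono[of c 1 "- clip K t" "- t"] mult_nonneg_nonneg[of c "- clip K t"] by simp_all
    ultimately show ?thesis using False by simp
  qed
  have "(\<lambda>k. \<integral>x. \<bar>p x - T (real k) p x\<bar> ^ 3 \<partial>lborel) \<longlonglongrightarrow> integral\<^sup>L lborel (\<lambda>x::'a. 0)"
  proof (rule integral_dominated_convergence[where w = "\<lambda>x. \<bar>p x\<bar> ^ 3"])
    show "AE x in lborel. (\<lambda>k. \<bar>p x - T (real k) p x\<bar> ^ 3) \<longlonglongrightarrow> 0"
    proof (intro AE_I2 tendsto_eventually)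
      fix x :: 'a
      have "\<forall>\<^sub>F k in sequentially. max (norm x) \<bar>p x\<bar> \<le> real k"
        using filterlim_real_sequentially unfolding filterlim_at_top by blast
      thus "\<forall>\<^sub>F k in sequentially. \<bar>p x - T (real k) p x\<bar> ^ 3 = 0"
        by eventually_elim (auto simp: T_def cut_def clip_def)
    qed
    show "AE x in lborel. norm (\<bar>p x - T (real k) p x\<bar> ^ 3) \<le> \<bar>p x\<bar> ^ 3" for k
      using clip_part cut by (intro AE_I2) (auto simp: T_def intro!: power_mono)
  qed (use Lp_fun_3_D[OF p] in auto)
  hence "\<forall>\<^sub>F k in sequentially. (\<integral>x. \<bar>p x - T (real k) p x\<bar> ^ 3 \<partial>lborel) < \<eta> / 54"
    using \<eta> by (intro order_tendstoD(2)) auto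
  then obtain k where k: "(\<integral>x. \<bar>p x - T (real k) p x\<bar> ^ 3 \<partial>lborel) < \<eta> / 54"
    by (auto simp: eventually_sequentially)
  have k_int: "integrable lborel (\<lambda>x. \<bar>p x - T (real k) p x\<bar> ^ 3)"
    by (rule Bochner_Integration.integrable_bound[OF Lp_fun_3_D(2)[OF p]])
       (use clip_part cut in \<open>auto simp: T_def intro!: power_mono\<close>)
  have "p measurable_on UNIV"
    by (rule lebesgue_measurable_imp_measurable_on) (auto intro: measurable_completion)
  then obtain N g where N: "negligible N" and g: "\<And>n. continuous_on UNIV (g n)"
    and g_lim: "\<And>x. x \<notin> N \<Longrightarrow> (\<lambda>n. g n x) \<longlonglongrightarrow> p x"
    unfolding measurable_on_def by auto
  have [measurable]: "g n \<in> borel_measurable borel" for n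
    using g by (rule borel_measurable_continuous_onI)
  let ?c = "\<lambda>x. \<bar>p x - T (real k) p x\<bar> ^ 3" and ?e = "\<lambda>n x. \<bar>T (real k) p x - T (real k) (g n) x\<bar> ^ 3"
  have AE_lim: "AE x in lborel. (\<lambda>n. g n x) \<longlonglongrightarrow> p x"
  proof -
    have "AE x in lebesgue. (\<lambda>n. g n x) \<longlonglongrightarrow> p x"
      using N g_lim by (intro AE_I'[of N]) (auto simp: negligible_iff_null_sets)
    thus ?thesis by (simp add: AE_completion_iff)
  qed
  define w where "w x = (2 * real k) ^ 3 * indicat_real (cball 0 (real k + 1)) x" for x :: 'a
  have w_int: "integrable lborel w"
    unfolding w_def by (intro integrable_mult_right integrable_real_indicator) (use emeasure_lborel_cball_finite in \<open>auto simp: less_top\<close>)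
  have T_diff: "\<bar>T (real k) p x - T (real k) f x\<bar> ^ 3 \<le> w x" for f x
  proof (cases "x \<in> cball 0 (real k + 1)")
    case True
    have "\<bar>T (real k) p x - T (real k) f x\<bar> \<le> 2 * real k"
      using T_bound[of "real k" p x] T_bound[of "real k" f x] by linarith
    hence "\<bar>T (real k) p x - T (real k) f x\<bar> ^ 3 \<le> (2 * real k) ^ 3" by (intro power_mono) auto
    thus ?thesis using True by (simp add: w_def)
  next
    case False
    thus ?thesis using T_supp[of "real k" x p] T_supp[of "real k" x f] by (simp add: w_def)
  qed
  have "(\<lambda>n. \<integral>x. ?e n x \<partial>lborel) \<longlonglongrightarrow> integral\<^sup>L lborel (\<lambda>x::'a. 0)"
  proof (rule integral_dominated_convergence[OF _ _ w_int])
    show "AE x in lborel. (\<lambda>n. ?e n x) \<longlonglongrightarrow> 0"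
      using AE_lim
    proof eventually_elim
      fix x assume "(\<lambda>n. g n x) \<longlonglongrightarrow> p x"
      hence "(\<lambda>n. ?e n x) \<longlonglongrightarrow> \<bar>T (real k) p x - T (real k) p x\<bar> ^ 3"
        unfolding T_def clip_def by (intro tendsto_intros)
      thus "(\<lambda>n. ?e n x) \<longlonglongrightarrow> 0" by simp
    qed
  qed (use T_diff in auto)
  hence "\<forall>\<^sub>F n in sequentially. (\<integral>x. ?e n x \<partial>lborel) < \<eta> / 54"
    using \<eta> by (intro order_tendstoD(2)) auto
  then obtain n where n: "(\<integral>x. ?e n x \<partial>lborel) < \<eta> / 54"
    by (auto simp: eventually_sequentially)
  have n_int: "integrable lborel (\<lambda>x. ?e n x)"
    by (rule Bochner_Integration.integrable_bound[OF w_int]) (use T_diff in \<open>auto intro: order.trans[OF _ abs_ge_self]\<close>)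
  have cubes: "\<bar>p x - T (real k) (g n) x\<bar> ^ 3 \<le>
      27 * (?c x + ?e n x)" for x
    using cube_sum_le[of "p x - T (real k) p x" "T (real k) p x - T (real k) (g n) x" 0] by simp
  have sum_int: "integrable lborel (\<lambda>x. 27 * (?c x + ?e n x))"
    using k_int n_int by simp
  have int: "integrable lborel (\<lambda>x. \<bar>p x - T (real k) (g n) x\<bar> ^ 3)"
    by (rule Bochner_Integration.integrable_bound[OF sum_int]) (use cubes in \<open>auto intro: order.trans[OF _ abs_ge_self]\<close>)
  have "(\<integral>x. \<bar>p x - T (real k) (g n) x\<bar> ^ 3 \<partial>lborel) \<le>
      (\<integral>x. 27 * (?c x + ?e n x) \<partial>lborel)"
    by (rule integral_mono[OF int sum_int cubes])
  also have "\<dots> < \<eta>" using k n k_int n_int by simp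
  finally show ?thesis
    using int T_bound[of "real k" "g n"] T_supp[of "real k" _ "g n"] T_cont[OF g, of "real k" n]
    by (intro that[of "T (real k) (g n)" "\<bar>real k\<bar>" "real k + 1"]) simp_all
qed

definition L3_modulus :: "('a::euclidean_space \<Rightarrow> real) \<Rightarrow> 'a \<Rightarrow> real" where
  "L3_modulus p y = (\<integral>x. \<bar>p (x + y) - p x\<bar> ^ 3 \<partial>lborel)"

lemma integrable_L3_modulus:
  fixes p :: "'a::euclidean_space \<Rightarrow> real"
  assumes p: "p \<in> Lp_fun 3"
  shows "integrable lborel (\<lambda>x. \<bar>p (x + y) - p x\<bar> ^ 3)"
proof (rule Bochner_Integration.integrable_bound)
  note [measurable] = Lp_fun_3_D(1)[OF p]
  show "integrable lborel (\<lambda>x. 27 * (\<bar>p (x + y)\<bar> ^ 3 + \<bar>p x\<bar> ^ 3))"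
    using integrable_lborel_shift[OF Lp_fun_3_D(2)[OF p]] Lp_fun_3_D(2)[OF p] by simp
  show "AE x in lborel. norm (\<bar>p (x + y) - p x\<bar> ^ 3) \<le> norm (27 * (\<bar>p (x + y)\<bar> ^ 3 + \<bar>p x\<bar> ^ 3))"
    using cube_sum_le[of "p (_ + y)" "- p _" 0] by (intro AE_I2) simp
  show "(\<lambda>x. \<bar>p (x + y) - p x\<bar> ^ 3) \<in> borel_measurable lborel" by measurable
qed

text \<open>
  Continuity of translations in \<open>L\<^sub>3\<close>: dominated convergence gives it for continuous functions of
  compact support, and replacing \<open>p\<close> by such a function changes \<open>p\<close> and its translate by the
  same small \<open>L\<^sub>3\<close> distance.
\<close>
lemma L3_modulus_tendsto_0:
  fixes p :: "'a::euclidean_space \<Rightarrow> real"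
  assumes p: "p \<in> Lp_fun 3" and \<eta>: "0 < \<eta>"
  shows "\<exists>\<delta>>0. \<forall>y. norm y < \<delta> \<longrightarrow> L3_modulus p y < \<eta>"
proof -
  note [measurable] = Lp_fun_3_D(1)[OF p]
  \<comment> \<open>The constants satisfy \<open>27 * (2 * \<eta> / 108 + \<eta> / 54) = \<eta>\<close>, with \<open>27\<close> from \<open>cube_sum_le\<close>.\<close>
  obtain g R C where g: "continuous_on UNIV g" "\<And>x. \<bar>g x\<bar> \<le> C" "\<And>x. R \<le> norm x \<Longrightarrow> g x = 0"
    and pg_int: "integrable lborel (\<lambda>x. \<bar>p x - g x\<bar> ^ 3)"
    and pg: "(\<integral>x. \<bar>p x - g x\<bar> ^ 3 \<partial>lborel) < \<eta> / 108"
    by (rule continuous_approximation_L3[OF p, of "\<eta> / 108"]) (use \<eta> in simp, rule that)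
  have g_meas [measurable]: "g \<in> borel_measurable borel"
    using g(1) by (rule borel_measurable_continuous_onI)
  define w where "w x = (2 * C) ^ 3 * indicat_real (cball 0 (R + 1)) x" for x :: 'a
  have w_int: "integrable lborel w"
    unfolding w_def by (intro integrable_mult_right integrable_real_indicator) (use emeasure_lborel_cball_finite in \<open>auto simp: less_top\<close>)
  have g_diff: "\<bar>g (x + y) - g x\<bar> ^ 3 \<le> w x" if "norm y \<le> 1" for x y
  proof (cases "x \<in> cball 0 (R + 1)")
    case True
    have "\<bar>g (x + y) - g x\<bar> \<le> 2 * C" using g(2)[of x] g(2)[of "x + y"] by linarith
    hence "\<bar>g (x + y) - g x\<bar> ^ 3 \<le> (2 * C) ^ 3" by (intro power_mono) auto
    thus ?thesis using True by (simp add: w_def)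
  next
    case False
    hence "R \<le> norm x" "R \<le> norm (x + y)" using that norm_triangle_ineq4[of "x + y" y] by auto
    thus ?thesis using g(3) False by (simp add: w_def)
  qed
  have g_int: "integrable lborel (\<lambda>x. \<bar>g (x + y) - g x\<bar> ^ 3)" if "norm y \<le> 1" for y
    by (rule Bochner_Integration.integrable_bound[OF w_int])
       (use g_diff[OF that] in \<open>auto intro: order.trans[OF _ abs_ge_self]\<close>)
  have g_mod: "\<exists>\<delta>>0. \<forall>y. norm y < \<delta> \<longrightarrow> (\<integral>x. \<bar>g (x + y) - g x\<bar> ^ 3 \<partial>lborel) < \<eta> / 54"
  proof (rule ccontr)
    assume "\<not> ?thesis"
    hence "\<forall>k. \<exists>y. norm y < inverse (real (Suc k)) \<and> \<eta> / 54 \<le> (\<integral>x. \<bar>g (x + y) - g x\<bar> ^ 3 \<partial>lborel)"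
      by (metis inverse_positive_iff_positive not_less of_nat_0_less_iff zero_less_Suc)
    then obtain y where y: "\<And>k. norm (y k) < inverse (real (Suc k))"
      and y_ge: "\<And>k. \<eta> / 54 \<le> (\<integral>x. \<bar>g (x + y k) - g x\<bar> ^ 3 \<partial>lborel)" by metis
    have y_lim: "y \<longlonglongrightarrow> 0"
      by (rule Lim_null_comparison[OF _ LIMSEQ_inverse_real_of_nat]) (use y in \<open>auto intro: less_imp_le always_eventually\<close>)
    have y1: "norm (y k) \<le> 1" for k
      using y[of k] by (rule less_imp_le[OF less_le_trans]) (simp add: field_simps)
    have "(\<lambda>k. \<integral>x. \<bar>g (x + y k) - g x\<bar> ^ 3 \<partial>lborel) \<longlonglongrightarrow> integral\<^sup>L lborel (\<lambda>x::'a. 0)"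
    proof (rule integral_dominated_convergence[OF _ _ w_int])
      show "AE x in lborel. (\<lambda>k. \<bar>g (x + y k) - g x\<bar> ^ 3) \<longlonglongrightarrow> 0"
      proof (intro AE_I2)
        fix x
        have "isCont g x" using g(1) by (simp add: continuous_on_eq_continuous_at)
        moreover have "(\<lambda>k. x + y k) \<longlonglongrightarrow> x + 0" by (intro tendsto_intros y_lim)
        ultimately have "(\<lambda>k. g (x + y k)) \<longlonglongrightarrow> g x" by (intro isCont_tendsto_compose[of x g]) auto
        hence "(\<lambda>k. \<bar>g (x + y k) - g x\<bar> ^ 3) \<longlonglongrightarrow> \<bar>g x - g x\<bar> ^ 3" by (intro tendsto_intros)
        thus "(\<lambda>k. \<bar>g (x + y k) - g x\<bar> ^ 3) \<longlonglongrightarrow> 0" by simp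
      qed
    qed (use g_diff y1 in auto)
    hence "\<eta> / 54 \<le> 0" using y_ge by (intro LIMSEQ_le_const[of _ 0 "\<eta> / 54"]) auto
    thus False using \<eta> by simp
  qed
  then obtain \<delta> where \<delta>: "0 < \<delta>" "\<And>y. norm y < \<delta> \<Longrightarrow> (\<integral>x. \<bar>g (x + y) - g x\<bar> ^ 3 \<partial>lborel) < \<eta> / 54"
    by blast
  have "L3_modulus p y < \<eta>" if y: "norm y < min \<delta> 1" for y
  proof -
    have cubes: "\<bar>p (x + y) - p x\<bar> ^ 3 \<le>
        27 * (\<bar>p (x + y) - g (x + y)\<bar> ^ 3 + \<bar>g (x + y) - g x\<bar> ^ 3 + \<bar>p x - g x\<bar> ^ 3)" for x
      using cube_sum_le[of "p (x + y) - g (x + y)" "g (x + y) - g x" "g x - p x"] by (simp add: abs_minus_commute)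
    note ints = pg_int g_int[of y] integrable_lborel_shift[OF pg_int, of y]
    have "L3_modulus p y \<le>
        (\<integral>x. 27 * (\<bar>p (x + y) - g (x + y)\<bar> ^ 3 + \<bar>g (x + y) - g x\<bar> ^ 3 + \<bar>p x - g x\<bar> ^ 3) \<partial>lborel)"
      unfolding L3_modulus_def using y
      by (intro integral_mono integrable_L3_modulus p cubes integrable_mult_right Bochner_Integration.integrable_add ints) auto
    also have "\<dots> = 27 * (2 * (\<integral>x. \<bar>p x - g x\<bar> ^ 3 \<partial>lborel) + (\<integral>x. \<bar>g (x + y) - g x\<bar> ^ 3 \<partial>lborel))"
      using ints y integral_lborel_shift[of "\<lambda>x. \<bar>p x - g x\<bar> ^ 3" y] by simp
    also have "\<dots> < \<eta>" using pg \<delta>(2)[of y] y by simp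
    finally show ?thesis .
  qed
  thus ?thesis using \<delta>(1) by (intro exI[of _ "min \<delta> 1"]) auto
qed

definition weighted_L2_modulus :: "('a::euclidean_space \<Rightarrow> real) \<Rightarrow> ('a \<Rightarrow> real) \<Rightarrow> 'a \<Rightarrow> real" where
  "weighted_L2_modulus p q y = (\<integral>x. p x * (q (x + y) - q x)\<^sup>2 \<partial>lborel)"

lemma integrable_mult_square:
  fixes p f :: "'a \<Rightarrow> real"
  assumes [measurable]: "p \<in> borel_measurable M" "f \<in> borel_measurable M"
    and "integrable M (\<lambda>x. \<bar>p x\<bar> ^ 3)" "integrable M (\<lambda>x. \<bar>f x\<bar> ^ 3)"
  shows "integrable M (\<lambda>x. p x * (f x)\<^sup>2)"
proof (rule Bochner_Integration.integrable_bound)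
  show "integrable M (\<lambda>x. \<bar>p x\<bar> ^ 3 + \<bar>f x\<bar> ^ 3)" using assms by simp
  show "AE x in M. norm (p x * (f x)\<^sup>2) \<le> norm (\<bar>p x\<bar> ^ 3 + \<bar>f x\<bar> ^ 3)"
    using mult_square_le_cubes[of "\<bar>p _\<bar>" "\<bar>f _\<bar>"] by (intro AE_I2) (simp add: abs_mult)
qed measurable

text \<open>
  The weight \<open>p\<close> and the squared increments of \<open>q\<close> are separated by \<open>mult_square_le_cubes\<close>;
  this is what third moments of the densities are for.
\<close>
lemma weighted_L2_modulus_tendsto_0:
  fixes p q :: "'a::euclidean_space \<Rightarrow> real"
  assumes p: "p \<in> Lp_fun 3" "\<And>x. 0 \<le> p x" and q: "q \<in> Lp_fun 3" and \<eta>: "0 < \<eta>"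
  shows "\<exists>\<delta>>0. \<forall>y. norm y < \<delta> \<longrightarrow> weighted_L2_modulus p q y < \<eta>"
proof -
  note [measurable] = Lp_fun_3_D(1)[OF p(1)] Lp_fun_3_D(1)[OF q]
  define A where "A = (\<integral>x. \<bar>p x\<bar> ^ 3 \<partial>lborel)"
  have A: "0 \<le> A" by (simp add: A_def)
  \<comment> \<open>Scaling by \<open>s\<close> makes the contribution of \<open>p\<close> smaller than \<open>\<eta> / 2\<close>, whatever \<open>q\<close> is; the
    increments of \<open>q\<close> then compensate the factor \<open>1 / s\<^sup>3\<close>.\<close>
  define s where "s = root 6 (\<eta> / (2 * (A + 1)))"
  have s: "0 < s" "s ^ 6 * A < \<eta> / 2"
  proof -
    show "0 < s" using \<eta> A by (simp add: s_def)
    have "s ^ 6 = \<eta> / (2 * (A + 1))" using \<eta> A by (simp add: s_def)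
    hence "s ^ 6 * A + s ^ 6 = \<eta> / 2" using A by (simp add: field_simps)
    moreover have "0 < s ^ 6" using \<open>0 < s\<close> by simp
    ultimately show "s ^ 6 * A < \<eta> / 2" by linarith
  qed
  obtain \<delta> where \<delta>: "0 < \<delta>" "\<And>y. norm y < \<delta> \<Longrightarrow> L3_modulus q y < s ^ 3 * (\<eta> / 2)"
    using L3_modulus_tendsto_0[OF q, of "s ^ 3 * (\<eta> / 2)"] s \<eta> by auto
  have "weighted_L2_modulus p q y < \<eta>" if "norm y < \<delta>" for y
  proof -
    note ints = Lp_fun_3_D(2)[OF p(1)] integrable_L3_modulus[OF q, of y]
    have pointwise: "p x * (q (x + y) - q x)\<^sup>2 \<le> s ^ 6 * \<bar>p x\<bar> ^ 3 + \<bar>q (x + y) - q x\<bar> ^ 3 / s ^ 3" for x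
    proof -
      let ?d = "\<bar>q (x + y) - q x\<bar>"
      have "p x * (q (x + y) - q x)\<^sup>2 = (s\<^sup>2 * p x) * (?d / s)\<^sup>2"
        using s(1) by (simp add: power_divide)
      also have "\<dots> \<le> (s\<^sup>2 * p x) ^ 3 + (?d / s) ^ 3"
        using s(1) p(2) by (intro mult_square_le_cubes) auto
      also have "\<dots> = s ^ 6 * \<bar>p x\<bar> ^ 3 + ?d ^ 3 / s ^ 3"
        using p(2)[of x] by (simp add: power_mult_distrib power_divide flip: power_mult)
      finally show ?thesis .
    qed
    have "weighted_L2_modulus p q y \<le> (\<integral>x. s ^ 6 * \<bar>p x\<bar> ^ 3 + \<bar>q (x + y) - q x\<bar> ^ 3 / s ^ 3 \<partial>lborel)"
      unfolding weighted_L2_modulus_def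
      by (rule integral_mono[OF integrable_mult_square _ pointwise]) (use ints in auto)
    also have "\<dots> = s ^ 6 * A + L3_modulus q y / s ^ 3"
      using ints by (simp add: A_def L3_modulus_def)
    also have "\<dots> < \<eta>"
    proof -
      have "L3_modulus q y / s ^ 3 < \<eta> / 2" using \<delta>(2)[OF that] s(1) by (simp add: field_simps)
      thus ?thesis using s(2) by linarith
    qed
    finally show ?thesis .
  qed
  thus ?thesis using \<delta>(1) by blast
qed

section \<open>Averages over balls\<close>

text \<open>
  With this, Jensen's inequality below holds for every measurable function: a function whose
  square is not integrable makes the right-hand side infinite.
\<close>
lemma nn_integral_square_eq_infinity:
  fixes f :: "'a \<Rightarrow> real"
  assumes [measurable]: "f \<in> borel_measurable M" and "\<not> integrable M (\<lambda>x. (f x)\<^sup>2)"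
  shows "(\<integral>\<^sup>+x. ennreal ((f x)\<^sup>2) \<partial>M) = \<infinity>"
proof (rule ccontr)
  assume "(\<integral>\<^sup>+x. ennreal ((f x)\<^sup>2) \<partial>M) \<noteq> \<infinity>"
  hence "integrable M (\<lambda>x. (f x)\<^sup>2)"
    by (intro integrableI_nonneg) (auto simp: less_top)
  with assms(2) show False ..
qed

lemma (in prob_space) ennreal_square_expectation_le:
  fixes f :: "'a \<Rightarrow> real"
  assumes [measurable]: "f \<in> borel_measurable M"
  shows "ennreal ((expectation f)\<^sup>2) \<le> (\<integral>\<^sup>+x. ennreal ((f x)\<^sup>2) \<partial>M)"
proof (cases "integrable M (\<lambda>x. (f x)\<^sup>2)")
  case True
  hence "integrable M f" by (rule square_integrable_imp_integrable[rotated]) auto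
  from variance_eq[OF this True] variance_positive[of f]
  have "(expectation f)\<^sup>2 \<le> expectation (\<lambda>x. (f x)\<^sup>2)" by linarith
  hence "ennreal ((expectation f)\<^sup>2) \<le> ennreal (expectation (\<lambda>x. (f x)\<^sup>2))" by (rule ennreal_leI)
  also have "\<dots> = (\<integral>\<^sup>+x. ennreal ((f x)\<^sup>2) \<partial>M)"
    using True by (intro nn_integral_eq_integral[symmetric]) auto
  finally show ?thesis .
next
  case False
  hence "(\<integral>\<^sup>+x. ennreal ((f x)\<^sup>2) \<partial>M) = \<infinity>"
    by (rule nn_integral_square_eq_infinity[OF assms])
  thus ?thesis by simp
qed

lemma ball_volume_pos: "0 < e \<Longrightarrow> 0 < ball_volume TYPE('a::euclidean_space) e"
  by (simp add: ball_volume_def)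

lemma ball_volume_eq: "0 < e \<Longrightarrow> ball_volume TYPE('a::euclidean_space) e = ball_volume TYPE('a) 1 * e ^ DIM('a)"
  by (simp add: ball_volume_def content_cball)

definition ball_density :: "real \<Rightarrow> 'a::euclidean_space \<Rightarrow> real" where
  "ball_density e u = of_bool (norm u \<le> e) / ball_volume TYPE('a) e"

definition ball_measure :: "real \<Rightarrow> 'a::euclidean_space measure" where
  "ball_measure e = density lborel (\<lambda>u. ennreal (ball_density e u))"

lemma ball_density_measurable [measurable]: "ball_density e \<in> borel_measurable borel"
  unfolding ball_density_def by measurable

lemma ball_density_nonneg: "0 \<le> ball_density e u"
  by (simp add: ball_density_def ball_volume_def)

lemma ball_density_uminus: "ball_density e (- u) = ball_density e u"
  by (simp add: ball_density_def)

lemma sets_ball_measure [simp, measurable_cong]: "sets (ball_measure e) = sets borel"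
  and space_ball_measure [simp]: "space (ball_measure e) = UNIV"
  by (simp_all add: ball_measure_def)

lemma prob_space_ball_measure:
  assumes "0 < e"
  shows "prob_space (ball_measure e :: 'a::euclidean_space measure)"
proof
  let ?b = "ball_volume TYPE('a) e"
  have b: "0 < ?b" using assms by (rule ball_volume_pos)
  have "emeasure (ball_measure e :: 'a measure) UNIV = (\<integral>\<^sup>+u. ennreal (1 / ?b) * indicator (cball (0::'a) e) u \<partial>lborel)"
    unfolding ball_measure_def by (subst emeasure_density)
      (auto intro!: nn_integral_cong simp: ball_density_def indicator_def)
  also have "\<dots> = ennreal (1 / ?b) * emeasure lborel (cball (0::'a) e)"
    by (rule nn_integral_cmult_indicator) simp
  also have "\<dots> = ennreal (1 / ?b) * ennreal ?b"
    using emeasure_lborel_cball_finite[of "0::'a" e] by (simp add: ball_volume_def emeasure_eq_ennreal_measure less_top)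
  also have "\<dots> = 1" using b by (simp add: ennreal_mult[symmetric])
  finally show "emeasure (ball_measure e :: 'a measure) (space (ball_measure e)) = 1" by simp
qed

lemma AE_ball_measure: "AE u in ball_measure e. norm u \<le> e"
  unfolding ball_measure_def by (subst AE_density) (auto simp: ball_density_def)

lemma integral_ball_measure:
  fixes f :: "'a::euclidean_space \<Rightarrow> real"
  assumes "f \<in> borel_measurable borel"
  shows "(\<integral>u. f u \<partial>ball_measure e) = (\<integral>u. ball_density e u * f u \<partial>lborel)"
  unfolding ball_measure_def using assms
  by (subst integral_density) (auto simp: ball_density_nonneg)

lemma integral_ball_measure_uminus:
  fixes f :: "'a::euclidean_space \<Rightarrow> real"
  assumes [measurable]: "f \<in> borel_measurable borel"
  shows "(\<integral>u. f (- u) \<partial>ball_measure e) = (\<integral>u. f u \<partial>ball_measure e)"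
  using integral_lborel_uminus[of "\<lambda>u. ball_density e u * f u"]
  by (simp add: integral_ball_measure ball_density_uminus)

definition smoothing :: "real \<Rightarrow> ('a::euclidean_space \<Rightarrow> real) \<Rightarrow> 'a \<Rightarrow> real" where
  "smoothing e p x = (\<integral>y. p y * (of_bool (dist x y \<le> e) / ball_volume TYPE('a) e) \<partial>lborel)"

lemma smoothing_measurable [measurable]:
  fixes p :: "'a::euclidean_space \<Rightarrow> real"
  assumes [measurable]: "p \<in> borel_measurable borel"
  shows "smoothing e p \<in> borel_measurable borel"
  unfolding smoothing_def by measurable

lemma smoothing_eq_ball_average:
  fixes p :: "'a::euclidean_space \<Rightarrow> real"
  assumes [measurable]: "p \<in> borel_measurable borel"
  shows "smoothing e p x = (\<integral>u. p (x + u) \<partial>ball_measure e)"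
proof -
  have "smoothing e p x = (\<integral>y. ball_density e (y - x) * p y \<partial>lborel)"
    unfolding smoothing_def ball_density_def dist_norm
    by (rule Bochner_Integration.integral_cong) (auto simp: norm_minus_commute)
  also have "\<dots> = (\<integral>u. ball_density e u * p (x + u) \<partial>lborel)"
    using integral_lborel_shift[of "\<lambda>y. ball_density e (y - x) * p y" x] by (simp add: add.commute)
  also have "\<dots> = (\<integral>u. p (x + u) \<partial>ball_measure e)"
    by (rule integral_ball_measure[symmetric]) measurable
  finally show ?thesis .
qed

text \<open>
  Jensen's inequality bounds the squared smoothing error by the average of squared increments
  over the ball, and Tonelli's theorem moves the weighted integral inside that average.
\<close>
lemma smoothing_error_le:
  fixes p q :: "'a::euclidean_space \<Rightarrow> real"
  assumes p: "p \<in> Lp_fun 3" "\<And>x. 0 \<le> p x" and q: "q \<in> Lp_fun 3" and e: "0 < e"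
    and modulus: "\<And>u. norm u \<le> e \<Longrightarrow> weighted_L2_modulus p q u \<le> \<eta>"
  shows "(\<integral>\<^sup>+x. ennreal (p x) * ennreal ((smoothing e q x - q x)\<^sup>2) \<partial>lborel) \<le> ennreal \<eta>"
proof -
  note [measurable] = Lp_fun_3_D(1)[OF p(1)] Lp_fun_3_D(1)[OF q]
  interpret U: prob_space "ball_measure e :: 'a measure" using e by (rule prob_space_ball_measure)
  interpret P: pair_sigma_finite "lborel :: 'a measure" "ball_measure e :: 'a measure" ..
  have pointwise: "ennreal ((smoothing e q x - q x)\<^sup>2) \<le> (\<integral>\<^sup>+u. ennreal ((q (x + u) - q x)\<^sup>2) \<partial>ball_measure e)" for x
  proof (cases "integrable (ball_measure e) (\<lambda>u. q (x + u))")
    case True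
    hence "smoothing e q x - q x = U.expectation (\<lambda>u. q (x + u) - q x)"
      using U.prob_space by (simp add: smoothing_eq_ball_average)
    thus ?thesis using U.ennreal_square_expectation_le[of "\<lambda>u. q (x + u) - q x"] by simp
  next
    case False
    have "\<not> integrable (ball_measure e) (\<lambda>u. (q (x + u) - q x)\<^sup>2)"
    proof
      assume "integrable (ball_measure e) (\<lambda>u. (q (x + u) - q x)\<^sup>2)"
      hence "integrable (ball_measure e) (\<lambda>u. q (x + u) - q x)"
        by (rule U.square_integrable_imp_integrable[rotated]) auto
      hence "integrable (ball_measure e) (\<lambda>u. q (x + u) - q x + q x)"
        by (intro Bochner_Integration.integrable_add) auto
      with False show False by simp
    qed
    hence "(\<integral>\<^sup>+u. ennreal ((q (x + u) - q x)\<^sup>2) \<partial>ball_measure e) = \<infinity>"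
      by (rule nn_integral_square_eq_infinity[rotated]) measurable
    thus ?thesis by simp
  qed
  have "(\<integral>\<^sup>+x. ennreal (p x) * ennreal ((smoothing e q x - q x)\<^sup>2) \<partial>lborel)
      \<le> (\<integral>\<^sup>+x. ennreal (p x) * (\<integral>\<^sup>+u. ennreal ((q (x + u) - q x)\<^sup>2) \<partial>ball_measure e) \<partial>lborel)"
    by (intro nn_integral_mono mult_left_mono pointwise) auto
  also have "\<dots> = (\<integral>\<^sup>+x. (\<integral>\<^sup>+u. ennreal (p x * (q (x + u) - q x)\<^sup>2) \<partial>ball_measure e) \<partial>lborel)"
    by (intro nn_integral_cong) (simp add: nn_integral_cmult[symmetric] ennreal_mult p(2))
  also have "\<dots> = (\<integral>\<^sup>+u. (\<integral>\<^sup>+x. ennreal (p x * (q (x + u) - q x)\<^sup>2) \<partial>lborel) \<partial>ball_measure e)"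
    by (rule P.Fubini'[symmetric]) measurable
  also have "\<dots> \<le> (\<integral>\<^sup>+u. ennreal \<eta> \<partial>(ball_measure e :: 'a measure))"
  proof (rule nn_integral_mono_AE)
    show "AE u in ball_measure e. (\<integral>\<^sup>+x. ennreal (p x * (q (x + u) - q x)\<^sup>2) \<partial>lborel) \<le> ennreal \<eta>"
      using AE_ball_measure
    proof eventually_elim
      fix u :: 'a assume "norm u \<le> e"
      have "(\<integral>\<^sup>+x. ennreal (p x * (q (x + u) - q x)\<^sup>2) \<partial>lborel) = ennreal (weighted_L2_modulus p q u)"
        unfolding weighted_L2_modulus_def
        by (rule nn_integral_eq_integral)
           (use Lp_fun_3_D(2)[OF p(1)] integrable_L3_modulus[OF q, of u] p(2) in \<open>auto intro!: integrable_mult_square\<close>)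
      also have "\<dots> \<le> ennreal \<eta>" by (intro ennreal_leI modulus) fact
      finally show "(\<integral>\<^sup>+x. ennreal (p x * (q (x + u) - q x)\<^sup>2) \<partial>lborel) \<le> ennreal \<eta>" .
    qed
  qed
  also have "\<dots> = ennreal \<eta>" using U.emeasure_space_1 by simp
  finally show ?thesis .
qed

lemma smoothing_error_tendsto_0:
  fixes p q :: "'a::euclidean_space \<Rightarrow> real"
  assumes "p \<in> Lp_fun 3" "\<And>x. 0 \<le> p x" "q \<in> Lp_fun 3" "0 < \<eta>"
  shows "\<exists>\<delta>>0. \<forall>e. 0 < e \<and> e < \<delta> \<longrightarrow>
    (\<integral>\<^sup>+x. ennreal (p x) * ennreal ((smoothing e q x - q x)\<^sup>2) \<partial>lborel) \<le> ennreal \<eta>"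
proof -
  obtain \<delta> where \<delta>: "0 < \<delta>" "\<And>y. norm y < \<delta> \<Longrightarrow> weighted_L2_modulus p q y < \<eta>"
    using weighted_L2_modulus_tendsto_0[OF assms] by blast
  have "(\<integral>\<^sup>+x. ennreal (p x) * ennreal ((smoothing e q x - q x)\<^sup>2) \<partial>lborel) \<le> ennreal \<eta>"
    if "0 < e" "e < \<delta>" for e
    using that by (intro smoothing_error_le assms less_imp_le[OF \<delta>(2)]) auto
  thus ?thesis using \<delta>(1) by blast
qed

lemma integrable_square_diff:
  fixes f g :: "'a \<Rightarrow> real"
  assumes [measurable]: "f \<in> borel_measurable M" "g \<in> borel_measurable M"
    and "integrable M (\<lambda>x. (f x)\<^sup>2)" "integrable M (\<lambda>x. (g x)\<^sup>2)"
  shows "integrable M (\<lambda>x. (f x - g x)\<^sup>2)"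
  unfolding power2_diff mult.assoc
  by (intro Bochner_Integration.integrable_diff Bochner_Integration.integrable_add
      integrable_mult_right integrable_mult_of_square_integrable assms)

lemma H2_D:
  fixes p :: "'a::euclidean_space \<Rightarrow> real"
  assumes "p \<in> H2 \<alpha> K"
  shows "p \<in> borel_measurable borel" "integrable lborel (\<lambda>x. (p x)\<^sup>2)"
    "\<And>h. norm h \<le> 1 \<Longrightarrow> (\<integral>x. (p (x - h) - p x)\<^sup>2 \<partial>lborel) \<le> (K * norm h powr \<alpha>)\<^sup>2"
proof -
  show "p \<in> borel_measurable borel" "integrable lborel (\<lambda>x. (p x)\<^sup>2)"
    using assms by (auto simp: H2_def Lp_fun_def)
  fix h :: 'a assume "norm h \<le> 1"
  hence "sqrt (\<integral>x. (p (x - h) - p x)\<^sup>2 \<partial>lborel) \<le> K * norm h powr \<alpha>"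
    using assms by (auto simp: H2_def)
  thus "(\<integral>x. (p (x - h) - p x)\<^sup>2 \<partial>lborel) \<le> (K * norm h powr \<alpha>)\<^sup>2"
    by (rule sqrt_le_D)
qed

text \<open>
  Let \<open>C(h) = \<integral> p(x) q(x + h) dx\<close>. Expanding the product of increments gives
  \<open>\<integral> (p(x - h) - p(x)) (q(x - h) - q(x)) dx = 2 C(0) - C(h) - C(-h)\<close>, which the smoothness
  condition bounds by \<open>K\<^sup>2 |h|\<^sup>2\<^sup>\<alpha>\<close>. Since the ball is symmetric, averaging over \<open>h\<close> turns the
  right-hand side into twice the bias, up to sign. This is why the bias has the order of the product of the
  two moduli rather than of a single one.
\<close>
lemma smoothing_bias_H2:
  fixes p q :: "'a::euclidean_space \<Rightarrow> real"
  assumes p: "p \<in> H2 \<alpha> K" and q: "q \<in> H2 \<alpha> K" and K: "0 < K" and \<alpha>: "0 < \<alpha>" and e: "0 < e" "e \<le> 1"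
  shows "\<bar>(\<integral>x. p x * smoothing e q x \<partial>lborel) - (\<integral>x. p x * q x \<partial>lborel)\<bar> \<le> (K * e powr \<alpha>)\<^sup>2"
proof -
  note [measurable] = H2_D(1)[OF p] H2_D(1)[OF q]
  interpret U: prob_space "ball_measure e :: 'a measure" using e(1) by (rule prob_space_ball_measure)
  interpret P: pair_sigma_finite "ball_measure e :: 'a measure" "lborel :: 'a measure" ..
  define C where "C u = (\<integral>x. p x * q (x + u) \<partial>lborel)" for u
  define B where "B = (\<integral>x. (p x)\<^sup>2 + (q x)\<^sup>2 \<partial>lborel)"
  have sq_shift: "integrable lborel (\<lambda>x. (p (x + u))\<^sup>2)" "integrable lborel (\<lambda>x. (q (x + u))\<^sup>2)" for u
    using integrable_lborel_shift[OF H2_D(2)[OF p]] integrable_lborel_shift[OF H2_D(2)[OF q]] by auto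
  have prod_int: "integrable lborel (\<lambda>x. p (x + u) * q (x + v))" for u v
    by (intro integrable_mult_of_square_integrable sq_shift) measurable
  have prod_int0: "integrable lborel (\<lambda>x. p x * q (x + u))" "integrable lborel (\<lambda>x. p x * q x)"
      "integrable lborel (\<lambda>x. p (x + u) * q x)" for u
    using prod_int[of 0 u] prod_int[of 0 0] prod_int[of u 0] by simp_all
  have prod_bound: "(\<integral>x. \<bar>p x * q (x + u)\<bar> \<partial>lborel) \<le> B" for u
  proof -
    have "(\<integral>x. \<bar>p x * q (x + u)\<bar> \<partial>lborel) \<le> (\<integral>x. (p x)\<^sup>2 + (q (x + u))\<^sup>2 \<partial>lborel)"
    proof (rule integral_mono)
      show "\<bar>p x * q (x + u)\<bar> \<le> (p x)\<^sup>2 + (q (x + u))\<^sup>2" for x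
        using sum_squares_bound[of "\<bar>p x\<bar>" "\<bar>q (x + u)\<bar>"] abs_ge_zero[of "p x * q (x + u)"]
        unfolding abs_mult power2_abs by linarith
    qed (use prod_int0 H2_D(2)[OF p] sq_shift in auto)
    also have "\<dots> = B"
      using H2_D(2)[OF p] H2_D(2)[OF q] sq_shift integral_lborel_shift[of "\<lambda>x. (q x)\<^sup>2" u] by (simp add: B_def)
    finally show ?thesis .
  qed
  have C_meas [measurable]: "C \<in> borel_measurable borel"
    unfolding C_def by measurable
  have C_bound: "\<bar>C u\<bar> \<le> B" for u
    unfolding C_def by (rule order.trans[OF integral_abs_bound prod_bound])
  have C_int: "integrable (ball_measure e) C" "integrable (ball_measure e) (\<lambda>u. C (- u))"
    by (rule U.integrable_const_bound[where B = B]; use C_bound in simp)+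
  have smooth: "(\<integral>x. p x * smoothing e q x \<partial>lborel) = (\<integral>u. C u \<partial>ball_measure e)"
  proof -
    have "integrable (ball_measure e \<Otimes>\<^sub>M lborel) (\<lambda>(u, x). p x * q (x + u))"
    proof (rule P.Fubini_integrable)
      show "integrable (ball_measure e) (\<lambda>u. \<integral>x. norm (case (u, x) of (u, x) \<Rightarrow> p x * q (x + u)) \<partial>lborel)"
        by (rule U.integrable_const_bound[where B = B]) (use prod_bound in auto)
    qed (use prod_int0 in auto)
    from P.Fubini_integral[OF this] show ?thesis
      by (simp add: smoothing_eq_ball_average C_def)
  qed
  define q0 where "q0 = (\<integral>x. p x * q x \<partial>lborel)"
  have symmetrised: "\<bar>2 * q0 - C u - C (- u)\<bar> \<le> (K * e powr \<alpha>)\<^sup>2" if "norm u \<le> e" for u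
  proof -
    define dp where "dp x = p (x - u) - p x" for x
    define dq where "dq x = q (x - u) - q x" for x
    have [measurable]: "dp \<in> borel_measurable borel" "dq \<in> borel_measurable borel"
      unfolding dp_def dq_def by measurable
    have expand: "dp x * dq x = p (x - u) * q (x - u) - p (x - u) * q x - p x * q (x - u) + p x * q x" for x
      by (simp add: dp_def dq_def algebra_simps)
    have ints: "integrable lborel (\<lambda>x. p (x - u) * q (x - u))" "integrable lborel (\<lambda>x. p (x - u) * q x)"
      "integrable lborel (\<lambda>x. p x * q (x - u))"
      using prod_int[of "- u" "- u"] prod_int0(3)[of "- u"] prod_int0(1)[of "- u"] by simp_all
    have vals: "(\<integral>x. p (x - u) * q (x - u) \<partial>lborel) = q0" "(\<integral>x. p (x - u) * q x \<partial>lborel) = C u"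
      "(\<integral>x. p x * q (x - u) \<partial>lborel) = C (- u)"
      using integral_lborel_shift[of "\<lambda>x. p x * q x" "- u"] integral_lborel_shift[of "\<lambda>x. p x * q (x + u)" "- u"]
      by (simp_all add: q0_def C_def)
    have dd_int: "integrable lborel (\<lambda>x. dp x * dq x)"
      unfolding expand using ints prod_int0(2) by simp
    have "(\<integral>x. dp x * dq x \<partial>lborel) = 2 * q0 - C u - C (- u)"
      unfolding expand using ints prod_int0(2) vals by (simp add: q0_def)
    moreover have "\<bar>\<integral>x. dp x * dq x \<partial>lborel\<bar> \<le> (K * e powr \<alpha>)\<^sup>2"
    proof -
      have sq_sub: "integrable lborel (\<lambda>x. (dp x)\<^sup>2)" "integrable lborel (\<lambda>x. (dq x)\<^sup>2)"
        unfolding dp_def dq_def using sq_shift[of "- u"] H2_D(2)[OF p] H2_D(2)[OF q]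
        by (auto intro!: integrable_square_diff)
      have "\<bar>\<integral>x. dp x * dq x \<partial>lborel\<bar> \<le> (\<integral>x. \<bar>dp x * dq x\<bar> \<partial>lborel)" by (rule integral_abs_bound)
      also have "\<dots> \<le> (\<integral>x. ((dp x)\<^sup>2 + (dq x)\<^sup>2) / 2 \<partial>lborel)"
      proof (rule integral_mono)
        show "\<bar>dp x * dq x\<bar> \<le> ((dp x)\<^sup>2 + (dq x)\<^sup>2) / 2" for x
          using sum_squares_bound[of "\<bar>dp x\<bar>" "\<bar>dq x\<bar>"] by (simp add: abs_mult)
      qed (use dd_int sq_sub in auto)
      also have "\<dots> = ((\<integral>x. (dp x)\<^sup>2 \<partial>lborel) + (\<integral>x. (dq x)\<^sup>2 \<partial>lborel)) / 2"
        using sq_sub by simp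
      also have "\<dots> \<le> (K * norm u powr \<alpha>)\<^sup>2"
        using H2_D(3)[OF p, of u] H2_D(3)[OF q, of u] that e(2) unfolding dp_def dq_def by simp
      also have "\<dots> \<le> (K * e powr \<alpha>)\<^sup>2"
        using that K \<alpha> by (intro power_mono mult_left_mono powr_mono2) auto
      finally show ?thesis .
    qed
    ultimately show ?thesis by simp
  qed
  have "2 * q0 - 2 * (\<integral>u. C u \<partial>ball_measure e) = (\<integral>u. 2 * q0 - C u - C (- u) \<partial>ball_measure e)"
    using C_int integral_ball_measure_uminus[OF C_meas, of e] U.prob_space by simp
  also have "\<bar>\<dots>\<bar> \<le> (\<integral>u. \<bar>2 * q0 - C u - C (- u)\<bar> \<partial>ball_measure e)"
    by (rule integral_abs_bound)
  also have "\<dots> \<le> (\<integral>u. (K * e powr \<alpha>)\<^sup>2 \<partial>(ball_measure e :: 'a measure))"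
  proof (rule integral_mono_AE)
    show "AE u in ball_measure e. \<bar>2 * q0 - C u - C (- u)\<bar> \<le> (K * e powr \<alpha>)\<^sup>2"
      using AE_ball_measure by eventually_elim (rule symmetrised)
  qed (use C_int in auto)
  finally have "\<bar>2 * q0 - 2 * (\<integral>u. C u \<partial>ball_measure e)\<bar> \<le> (K * e powr \<alpha>)\<^sup>2"
    using U.prob_space by simp
  thus ?thesis unfolding smooth q0_def[symmetric] using zero_le_power2[of "K * e powr \<alpha>"] by linarith
qed

section \<open>Independence in stationary m-dependent sequences\<close>

lemma (in prob_space) indep_var_commute:
  "indep_var S U T V \<Longrightarrow> indep_var T V S U"
  unfolding indep_var_eq indep_sets2_eq
proof (elim conjE, intro conjI ballI)
  fix a b
  assume "\<forall>a\<in>sigma_sets (space M) {U -` A \<inter> space M | A. A \<in> sets S}.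
      \<forall>b\<in>sigma_sets (space M) {V -` A \<inter> space M | A. A \<in> sets T}. prob (a \<inter> b) = prob a * prob b"
    "a \<in> sigma_sets (space M) {V -` A \<inter> space M | A. A \<in> sets T}"
    "b \<in> sigma_sets (space M) {U -` A \<inter> space M | A. A \<in> sets S}"
  hence "prob (b \<inter> a) = prob b * prob a" by blast
  thus "prob (a \<inter> b) = prob a * prob b" by (simp add: Int_commute mult.commute)
qed

lemma (in prob_space) expectation_indep_var_iterated:
  fixes f :: "'b \<times> 'b \<Rightarrow> real"
  assumes indep: "indep_var S U T V" and f: "f \<in> borel_measurable (S \<Otimes>\<^sub>M T)" and bound: "\<And>x. \<bar>f x\<bar> \<le> B"
  shows "expectation (\<lambda>\<omega>. f (U \<omega>, V \<omega>)) = (\<integral>x. (\<integral>y. f (x, y) \<partial>distr M T V) \<partial>distr M S U)"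
proof -
  have U [measurable]: "U \<in> M \<rightarrow>\<^sub>M S" and V [measurable]: "V \<in> M \<rightarrow>\<^sub>M T"
    using indep indep_var_rv1 indep_var_rv2 by blast+
  interpret U: prob_space "distr M S U" by (rule prob_space_distr) fact
  interpret V: prob_space "distr M T V" by (rule prob_space_distr) fact
  interpret UV: pair_prob_space "distr M S U" "distr M T V" ..
  note f [measurable]
  have "expectation (\<lambda>\<omega>. f (U \<omega>, V \<omega>)) = (\<integral>x. f x \<partial>distr M (S \<Otimes>\<^sub>M T) (\<lambda>\<omega>. (U \<omega>, V \<omega>)))"
    by (simp add: integral_distr)
  also have "\<dots> = (\<integral>x. f x \<partial>(distr M S U \<Otimes>\<^sub>M distr M T V))"
    using indep by (simp add: indep_var_distribution_eq)
  also have "\<dots> = (\<integral>x. (\<integral>y. f (x, y) \<partial>distr M T V) \<partial>distr M S U)"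
    by (rule UV.integral_fst'[symmetric])
       (auto intro!: UV.P.integrable_const_bound[where B=B] simp: bound)
  finally show ?thesis .
qed

text \<open>
  Covers an empty block of observations, for which m-dependence makes no statement.
\<close>
lemma (in prob_space) indep_var_constant:
  assumes "V \<in> M \<rightarrow>\<^sub>M T" "\<And>\<omega>. U \<omega> = c" "c \<in> space S"
  shows "indep_var S U T V"
proof -
  have U: "U \<in> M \<rightarrow>\<^sub>M S" using assms(2,3) by (simp cong: measurable_cong)
  have "{U -` A \<inter> space M | A. A \<in> sets S} \<subseteq> {{}, space M}"
    using assms(2) by auto
  hence "sigma_sets (space M) {U -` A \<inter> space M | A. A \<in> sets S} \<subseteq> sigma_sets (space M) {{}, space M}"
    by (rule sigma_sets_mono')
  also have "\<dots> = {{}, space M}"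
    by (subst sigma_algebra.sigma_sets_eq) (simp_all add: sigma_algebra_trivial)
  finally have U_trivial: "sigma_sets (space M) {U -` A \<inter> space M | A. A \<in> sets S} \<subseteq> {{}, space M}" .
  have V_events: "sigma_sets (space M) {V -` A \<inter> space M | A. A \<in> sets T} \<subseteq> events"
    using assms(1) by (auto intro!: sets.sigma_sets_subset measurable_sets)
  show ?thesis
    unfolding indep_var_eq indep_sets2_eq
  proof (intro conjI ballI)
    fix a b assume "a \<in> sigma_sets (space M) {U -` A \<inter> space M | A. A \<in> sets S}"
      and b: "b \<in> sigma_sets (space M) {V -` A \<inter> space M | A. A \<in> sets T}"
    with U_trivial consider "a = {}" | "a = space M" by blast
    thus "prob (a \<inter> b) = prob a * prob b"
      using b V_events sets.sets_into_space[of b M] by cases (auto simp: prob_space Int_absorb1)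
  qed (use U assms(1) U_trivial V_events in auto)
qed

locale stationary_m_dependent = prob_space M for M :: "'w measure" +
  fixes m :: nat and Z :: "nat \<Rightarrow> 'w \<Rightarrow> 'b::topological_space"
  assumes random_sequence: "random_sequence M Z"
    and strictly_stationary: "strictly_stationary M Z"
    and m_dependent: "m_dependent M m Z"
begin

definition law :: "'b measure" where "law = distr M borel (Z 1)"

lemma measurable_Z [measurable]: "1 \<le> i \<Longrightarrow> Z i \<in> borel_measurable M"
  using random_sequence by (auto simp: random_sequence_def)

lemma sets_law [simp, measurable_cong]: "sets law = sets borel"
  and space_law [simp]: "space law = UNIV"
  by (simp_all add: law_def)

lemma prob_space_law: "prob_space law"
  unfolding law_def by (rule prob_space_distr) simp

sublocale law: prob_space law by (rule prob_space_law)

lemma distr_shift: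
  assumes J: "finite J" "J \<subseteq> {1..}" and f: "f \<in> PiM J (\<lambda>_. borel) \<rightarrow>\<^sub>M N"
  shows "distr M N (\<lambda>\<omega>. f (\<lambda>j\<in>J. Z (j + h) \<omega>)) = distr M N (\<lambda>\<omega>. f (\<lambda>j\<in>J. Z j \<omega>))"
proof -
  have meas: "(\<lambda>\<omega>. \<lambda>j\<in>J. Z (j + k) \<omega>) \<in> M \<rightarrow>\<^sub>M PiM J (\<lambda>_. borel)" for k
    using J by (intro measurable_restrict measurable_Z) auto
  have *: "distr M N (\<lambda>\<omega>. f (\<lambda>j\<in>J. Z (j + k) \<omega>))
      = distr (distr M (PiM J (\<lambda>_. borel)) (\<lambda>\<omega>. \<lambda>j\<in>J. Z (j + k) \<omega>)) N f" for k
    using f meas by (subst distr_distr) (simp_all add: comp_def)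
  show ?thesis
    using *[of h] *[of 0] strictly_stationary J by (simp add: strictly_stationary_def)
qed

lemma distr_Z: "1 \<le> i \<Longrightarrow> distr M borel (Z i) = law"
  using distr_shift[of "{1}" "\<lambda>f. f 1" borel "i - 1"] by (simp add: law_def measurable_component_singleton)

lemma distr_pair:
  "1 \<le> i \<Longrightarrow> distr M (borel \<Otimes>\<^sub>M borel) (\<lambda>\<omega>. (Z i \<omega>, Z (i + h) \<omega>)) =
    distr M (borel \<Otimes>\<^sub>M borel) (\<lambda>\<omega>. (Z 1 \<omega>, Z (1 + h) \<omega>))"
  using distr_shift[of "{1, 1 + h}" "\<lambda>f. (f 1, f (1 + h))" "borel \<Otimes>\<^sub>M borel" "i - 1"]
  by (simp add: measurable_component_singleton) (simp add: add.commute)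

lemma indep_var_blocks:
  assumes "1 \<le> b" "1 \<le> l"
  shows "indep_var (PiM {1..b} (\<lambda>_. borel)) (\<lambda>\<omega>. \<lambda>i\<in>{1..b}. Z i \<omega>)
    (PiM {b + m + 1..b + m + 1 + l} (\<lambda>_. borel)) (\<lambda>\<omega>. \<lambda>i\<in>{b + m + 1..b + m + 1 + l}. Z i \<omega>)"
  using m_dependent[unfolded m_dependent_def, rule_format, of b "m + 1" l] assms
  by (simp add: add.assoc)

lemma indep_var_gap:
  assumes "1 \<le> i" "1 \<le> j" "i + m < j \<or> j + m < i"
  shows "indep_var borel (Z i) borel (Z j)"
proof -
  have less: "indep_var borel (Z i) borel (Z j)" if "1 \<le> i" "i + m < j" for i j
  proof -
    have "indep_var borel ((\<lambda>f. f i) \<circ> (\<lambda>\<omega>. \<lambda>i\<in>{1..i}. Z i \<omega>))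
        borel ((\<lambda>f. f j) \<circ> (\<lambda>\<omega>. \<lambda>i\<in>{i + m + 1..i + m + 1 + j}. Z i \<omega>))"
      by (rule indep_var_compose[OF indep_var_blocks]) (use that in auto)
    thus ?thesis using that by (simp add: comp_def)
  qed
  show ?thesis using assms less indep_var_commute by blast
qed

text \<open>
  An index at distance more than \<open>m\<close> from all others is independent of them jointly, although
  m-dependence only speaks about a past and a future block. With \<open>L\<close> the block before the gap
  on the left of \<open>i\<close> and \<open>R\<close> the block after the gap on the right, \<open>R\<close> is independent of
  everything up to \<open>i\<close>, and \<open>L\<close> is independent of \<open>Z\<^sub>i\<close>. Integrating over \<open>R\<close>, then \<open>L\<close>, leaves the
  inner integral over \<open>Z\<^sub>i\<close>, which vanishes.
\<close>
lemma expectation_isolated_eq_0: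
  fixes F :: "'b \<times> (nat \<Rightarrow> 'b) \<Rightarrow> real"
  assumes i: "1 \<le> i" and S: "finite S" "\<And>s. s \<in> S \<Longrightarrow> 1 \<le> s \<and> (s + m < i \<or> i + m < s)"
    and F: "F \<in> borel_measurable (borel \<Otimes>\<^sub>M PiM S (\<lambda>_. borel))" and bound: "\<And>x. \<bar>F x\<bar> \<le> B"
    and zero: "\<And>w. (\<integral>z. F (z, w) \<partial>law) = 0"
  shows "expectation (\<lambda>\<omega>. F (Z i \<omega>, \<lambda>s\<in>S. Z s \<omega>)) = 0"
proof -
  note One_nat_def [simp del]
  \<comment> \<open>The left block \<open>{1..l}\<close> is empty if \<open>i \<le> m + 1\<close>. The sum of \<open>S\<close> is an upper bound for its
    elements, so the right block is long enough.\<close>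
  define l where "l = i - (m + 1)"
  define N where "N = Suc (\<Sum>S)"
  define R where "R = {i + m + 1..i + m + 1 + N}"
  define WL where "WL = (\<lambda>\<omega>. \<lambda>j\<in>{1..l}. Z j \<omega>)"
  define WR where "WR = (\<lambda>\<omega>. \<lambda>j\<in>R. Z j \<omega>)"
  define join where "join = (\<lambda>(wR::nat \<Rightarrow> 'b, wL::nat \<Rightarrow> 'b). \<lambda>s\<in>S. if s \<le> l then wL s else wR s)"
  have SLR: "s \<in> {1..l} \<or> (\<not> s \<le> l \<and> s \<in> R)" if "s \<in> S" for s
  proof -
    have "s \<le> \<Sum>S" using member_le_sum[of s S "\<lambda>x. x"] that S(1) by simp
    thus ?thesis using S(2)[OF that] i unfolding l_def R_def N_def by simp linarith
  qed
  have WL [measurable]: "WL \<in> M \<rightarrow>\<^sub>M PiM {1..l} (\<lambda>_. borel)"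
    unfolding WL_def by (intro measurable_restrict measurable_Z) auto
  have WR [measurable]: "WR \<in> M \<rightarrow>\<^sub>M PiM R (\<lambda>_. borel)"
    unfolding WR_def R_def using i by (intro measurable_restrict measurable_Z) auto
  have Zi [measurable]: "Z i \<in> borel_measurable M" by (rule measurable_Z) fact
  have join [measurable]: "join \<in> PiM R (\<lambda>_. borel) \<Otimes>\<^sub>M PiM {1..l} (\<lambda>_. borel) \<rightarrow>\<^sub>M PiM S (\<lambda>_. borel)"
    unfolding join_def split_beta
  proof (rule measurable_restrict)
    fix s assume "s \<in> S"
    show "(\<lambda>x. if s \<le> l then snd x s else fst x s)
        \<in> PiM R (\<lambda>_. borel :: 'b measure) \<Otimes>\<^sub>M PiM {1..l} (\<lambda>_. borel :: 'b measure) \<rightarrow>\<^sub>M borel"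
    proof (cases "s \<le> l")
      case True
      have "(\<lambda>x. snd x s) \<in> PiM R (\<lambda>_. borel :: 'b measure) \<Otimes>\<^sub>M PiM {1..l} (\<lambda>_. borel :: 'b measure) \<rightarrow>\<^sub>M borel"
        by (rule measurable_compose[OF measurable_snd measurable_component_singleton])
           (use SLR[OF \<open>s \<in> S\<close>] True in blast)
      thus ?thesis using True by simp
    next
      case False
      have "(\<lambda>x. fst x s) \<in> PiM R (\<lambda>_. borel :: 'b measure) \<Otimes>\<^sub>M PiM {1..l} (\<lambda>_. borel :: 'b measure) \<rightarrow>\<^sub>M borel"
        by (rule measurable_compose[OF measurable_fst measurable_component_singleton])
           (use SLR[OF \<open>s \<in> S\<close>] False in auto)
      thus ?thesis using False by simp
    qed
  qed
  have joined: "join (WR \<omega>, WL \<omega>) = (\<lambda>s\<in>S. Z s \<omega>)" for \<omega>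
    unfolding join_def WL_def WR_def prod.case
  proof (rule restrict_ext)
    fix s assume "s \<in> S"
    from SLR[OF this] show "(if s \<le> l then (\<lambda>j\<in>{1..l}. Z j \<omega>) s else (\<lambda>j\<in>R. Z j \<omega>) s) = Z s \<omega>"
      by auto
  qed
  define Wi where "Wi = (\<lambda>\<omega>. \<lambda>j\<in>{i}. Z j \<omega>)"
  define WLi where "WLi = (\<lambda>\<omega>. \<lambda>j\<in>{1..i}. Z j \<omega>)"
  have Wi [measurable]: "Wi \<in> M \<rightarrow>\<^sub>M PiM {i} (\<lambda>_. borel)"
    unfolding Wi_def using i by (intro measurable_restrict measurable_Z) auto
  have WLi [measurable]: "WLi \<in> M \<rightarrow>\<^sub>M PiM {1..i} (\<lambda>_. borel)"
    unfolding WLi_def by (intro measurable_restrict measurable_Z) auto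
  have L_indep: "indep_var (PiM {1..l} (\<lambda>_. borel)) WL (PiM {i} (\<lambda>_. borel)) Wi"
  proof (cases "l = 0")
    case True
    thus ?thesis by (intro indep_var_constant[where c = "\<lambda>_. undefined"]) (auto simp: WL_def space_PiM)
  next
    case False
    have "indep_var (PiM {1..l} (\<lambda>_. borel)) ((\<lambda>f. f) \<circ> (\<lambda>\<omega>. \<lambda>i\<in>{1..l}. Z i \<omega>))
        (PiM {i} (\<lambda>_. borel)) ((\<lambda>f. restrict f {i}) \<circ> (\<lambda>\<omega>. \<lambda>i\<in>{l + m + 1..l + m + 1 + i}. Z i \<omega>))"
      by (rule indep_var_compose[OF indep_var_blocks])
         (use False i in \<open>auto simp: l_def intro!: measurable_restrict_subset\<close>)
    moreover have "{l + m + 1..l + m + 1 + i} \<inter> {i} = {i}" using False by (auto simp: l_def)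
    ultimately show ?thesis by (simp add: comp_def WL_def Wi_def)
  qed
  have "indep_var (PiM {1..i} (\<lambda>_. borel)) ((\<lambda>f. f) \<circ> (\<lambda>\<omega>. \<lambda>j\<in>{1..i}. Z j \<omega>))
      (PiM R (\<lambda>_. borel)) ((\<lambda>f. f) \<circ> (\<lambda>\<omega>. \<lambda>j\<in>R. Z j \<omega>))"
    unfolding R_def
    by (rule indep_var_compose[OF indep_var_blocks]) (use i in \<open>auto simp: N_def\<close>)
  hence R_indep: "indep_var (PiM R (\<lambda>_. borel)) WR (PiM {1..i} (\<lambda>_. borel)) WLi"
    by (subst indep_var_commute) (simp_all add: comp_def WR_def WLi_def)
  have WL_WLi: "restrict (WLi \<omega>) {1..l} = WL \<omega>" "WLi \<omega> i = Z i \<omega>" for \<omega>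
    using i by (auto simp: WL_def WLi_def l_def Int_absorb1)
  have restr [measurable]: "(\<lambda>f. restrict f {1..l}) \<in> PiM {1..i} (\<lambda>_. borel) \<rightarrow>\<^sub>M PiM {1..l} (\<lambda>_. borel :: 'b measure)"
    by (intro measurable_restrict_subset) (auto simp: l_def)
  have i_mem [measurable]: "i \<in> {1..i}" "i \<in> {i}" using i by auto
  note F [measurable]
  have inner: "(\<integral>y. F (y i, join (wR, restrict y {1..l})) \<partial>distr M (PiM {1..i} (\<lambda>_. borel)) WLi) = 0"
    if wR: "wR \<in> space (PiM R (\<lambda>_. borel))" for wR
  proof -
    have joinR [measurable]: "(\<lambda>w. join (wR, w)) \<in> PiM {1..l} (\<lambda>_. borel) \<rightarrow>\<^sub>M PiM S (\<lambda>_. borel)"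
      using join measurable_Pair1' [OF wR] measurable_compose by blast
    have "(\<integral>y. F (y i, join (wR, restrict y {1..l})) \<partial>distr M (PiM {1..i} (\<lambda>_. borel)) WLi)
        = expectation (\<lambda>\<omega>. F (Z i \<omega>, join (wR, WL \<omega>)))"
      by (subst integral_distr) (auto simp: WL_WLi)
    also have "\<dots> = expectation (\<lambda>\<omega>. F (Wi \<omega> i, join (wR, WL \<omega>)))"
      by (simp add: Wi_def)
    also have "\<dots> = (\<integral>x. (\<integral>y. F (y i, join (wR, x)) \<partial>distr M (PiM {i} (\<lambda>_. borel)) Wi) \<partial>distr M (PiM {1..l} (\<lambda>_. borel)) WL)"
      using expectation_indep_var_iterated[OF L_indep, of "\<lambda>x. F (snd x i, join (wR, fst x))" B] bound by simp
    also have "\<dots> = (\<integral>x. 0 \<partial>distr M (PiM {1..l} (\<lambda>_. borel)) WL)"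
    proof (rule Bochner_Integration.integral_cong)
      fix x assume "x \<in> space (distr M (PiM {1..l} (\<lambda>_. borel)) WL)"
      hence [measurable]: "join (wR, x) \<in> space (PiM S (\<lambda>_. borel))"
        using measurable_space[OF joinR] by simp
      have "(\<integral>y. F (y i, join (wR, x)) \<partial>distr M (PiM {i} (\<lambda>_. borel)) Wi) = (\<integral>z. F (z, join (wR, x)) \<partial>distr M borel (Z i))"
        by (simp add: integral_distr) (simp add: Wi_def)
      thus "(\<integral>y. F (y i, join (wR, x)) \<partial>distr M (PiM {i} (\<lambda>_. borel)) Wi) = 0"
        by (simp add: distr_Z[OF i] zero)
    qed simp
    finally show ?thesis by simp
  qed
  have "expectation (\<lambda>\<omega>. F (Z i \<omega>, join (WR \<omega>, WL \<omega>)))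
      = (\<integral>wR. (\<integral>y. F (y i, join (wR, restrict y {1..l})) \<partial>distr M (PiM {1..i} (\<lambda>_. borel)) WLi) \<partial>distr M (PiM R (\<lambda>_. borel)) WR)"
    using expectation_indep_var_iterated[OF R_indep, of "\<lambda>x. F (snd x i, join (fst x, restrict (snd x) {1..l}))" B] bound
    by (simp add: WL_WLi)
  also have "\<dots> = (\<integral>wR. 0 \<partial>distr M (PiM R (\<lambda>_. borel)) WR)"
    by (rule Bochner_Integration.integral_cong) (use inner in auto)
  finally show ?thesis by (simp add: joined)
qed

end

section \<open>Second moments of degenerate sums\<close>

context stationary_m_dependent
begin

abbreviation gap :: "nat \<Rightarrow> nat \<Rightarrow> bool" where
  "gap i j \<equiv> i + m < j \<or> j + m < i"

lemma expectation_gap_pair: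
  fixes f :: "'b \<times> 'b \<Rightarrow> real"
  assumes "1 \<le> i" "1 \<le> j" "gap i j" "f \<in> borel_measurable (borel \<Otimes>\<^sub>M borel)" "\<And>x. \<bar>f x\<bar> \<le> B"
  shows "expectation (\<lambda>\<omega>. f (Z i \<omega>, Z j \<omega>)) = (\<integral>x. (\<integral>y. f (x, y) \<partial>law) \<partial>law)"
  using expectation_indep_var_iterated[OF indep_var_gap[OF assms(1-3)] assms(4,5)]
  by (simp add: distr_Z[OF assms(1)] distr_Z[OF assms(2)])

text \<open>
  Only the argument of \<open>r\<close> that carries the isolated index has to integrate to zero; exchanging
  the arguments of a degenerate kernel covers the other position.
\<close>
lemma expectation_degenerate_isolated:
  fixes r h :: "'b \<times> 'b \<Rightarrow> real"
  assumes r [measurable]: "r \<in> borel_measurable (borel \<Otimes>\<^sub>M borel)" and r_bound: "\<And>x. \<bar>r x\<bar> \<le> B"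
    and h [measurable]: "h \<in> borel_measurable (borel \<Otimes>\<^sub>M borel)" and h_bound: "\<And>x. \<bar>h x\<bar> \<le> B"
    and zero: "\<And>y. (\<integral>x. r (x, y) \<partial>law) = 0"
    and pos: "1 \<le> i" "1 \<le> j" "1 \<le> i'" "1 \<le> j'"
    and isolated: "gap i j" "gap i i'" "gap i j'"
  shows "expectation (\<lambda>\<omega>. r (Z i \<omega>, Z j \<omega>) * h (Z i' \<omega>, Z j' \<omega>)) = 0"
proof -
  let ?S = "{j, i', j'}"
  define F where "F = (\<lambda>(z, w). r (z, w j) * h (w i', w j'))"
  have [simp]: "j \<in> ?S" "i' \<in> ?S" "j' \<in> ?S" by auto
  have [measurable]: "(\<lambda>x. snd x k) \<in> borel \<Otimes>\<^sub>M PiM ?S (\<lambda>_. borel :: 'b measure) \<rightarrow>\<^sub>M borel" if "k \<in> ?S" for k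
    by (rule measurable_compose[OF measurable_snd measurable_component_singleton]) (rule that)
  have F: "F \<in> borel_measurable (borel \<Otimes>\<^sub>M PiM ?S (\<lambda>_. borel))"
    unfolding F_def split_beta by measurable
  have F_bound: "\<bar>F x\<bar> \<le> B * B" for x
    unfolding F_def split_beta abs_mult
    by (intro mult_mono r_bound h_bound) (use r_bound[of undefined] in auto)
  have F_zero: "(\<integral>z. F (z, w) \<partial>law) = 0" for w
    by (simp add: F_def zero)
  show ?thesis
    using expectation_isolated_eq_0[OF pos(1) _ _ F F_bound F_zero] pos isolated by (auto simp: F_def)
qed

lemma card_not_gap: "finite {j. \<not> gap i j}" "card {j. \<not> gap i j} \<le> 2 * m + 1"
proof -
  have "{j. \<not> gap i j} \<subseteq> {i - m..i + m}" by auto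
  moreover from this show "finite {j. \<not> gap i j}" by (rule finite_subset) simp
  ultimately have "card {j. \<not> gap i j} \<le> card {i - m..i + m}" by (intro card_mono) auto
  thus "card {j. \<not> gap i j} \<le> 2 * m + 1" by simp
qed

text \<open>
  The set \<open>near p\<close> collects the pairs that match \<open>p\<close> up to distance \<open>m\<close>, in the given or in the
  swapped order. If \<open>q\<close> is not in \<open>near p\<close>, one of the four indices is isolated: each index of \<open>p\<close>
  is far from its own partner, so without an isolated index every index of one pair has a
  close index in the other pair, and conversely, which forces such a matching. There are
  at most \<open>2 (2m + 1)\<^sup>2\<close> matching pairs for each \<open>p\<close>.
\<close>
lemma second_moment_degenerate_sum:
  fixes r :: "'b \<times> 'b \<Rightarrow> real"
  assumes r [measurable]: "r \<in> borel_measurable (borel \<Otimes>\<^sub>M borel)" and bound: "\<And>x. \<bar>r x\<bar> \<le> B"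
    and zero: "\<And>y. (\<integral>x. r (x, y) \<partial>law) = 0" "\<And>x. (\<integral>y. r (x, y) \<partial>law) = 0"
    and I: "I \<subseteq> {1..n} \<times> {1..n}" "\<And>i j. (i, j) \<in> I \<Longrightarrow> gap i j"
  shows "expectation (\<lambda>\<omega>. (\<Sum>(i, j)\<in>I. r (Z i \<omega>, Z j \<omega>))\<^sup>2)
    \<le> 2 * real ((2 * m + 1)\<^sup>2) * (real n)\<^sup>2 * (\<integral>x. (\<integral>y. (r (x, y))\<^sup>2 \<partial>law) \<partial>law)"
proof -
  define \<rho> where "\<rho> = (\<integral>x. (\<integral>y. (r (x, y))\<^sup>2 \<partial>law) \<partial>law)"
  define R where "R p \<omega> = r (Z (fst p) \<omega>, Z (snd p) \<omega>)" for p \<omega>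
  define near where "near p = {q. \<not> gap (fst p) (fst q)} \<inter> {q. \<not> gap (snd p) (snd q)}
      \<union> {q. \<not> gap (fst p) (snd q)} \<inter> {q. \<not> gap (snd p) (fst q)}" for p
  have fin: "finite I" using I(1) by (rule finite_subset) simp
  have B: "0 \<le> B" using bound[of undefined] by simp
  have memD: "1 \<le> fst p" "1 \<le> snd p" "gap (fst p) (snd p)" if "p \<in> I" for p
    using I that by (auto simp: subset_eq)
  have R [measurable]: "R p \<in> borel_measurable M" if "p \<in> I" for p
    using memD[OF that] unfolding R_def by measurable
  have prod_int: "integrable M (\<lambda>\<omega>. R p \<omega> * R q \<omega>)" if "p \<in> I" "q \<in> I" for p q
  proof (rule integrable_const_bound)
    have "\<bar>R p \<omega> * R q \<omega>\<bar> \<le> B * B" for \<omega>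
      unfolding R_def abs_mult by (intro mult_mono bound) (use B in auto)
    thus "AE \<omega> in M. norm (R p \<omega> * R q \<omega>) \<le> B * B" by simp
  qed (intro borel_measurable_times R that)
  have sq: "expectation (\<lambda>\<omega>. (R p \<omega>)\<^sup>2) = \<rho>" if "p \<in> I" for p
    unfolding R_def \<rho>_def
  proof (rule expectation_gap_pair[OF memD[OF that], of "\<lambda>x. (r x)\<^sup>2" "B\<^sup>2"])
    show "\<bar>(r x)\<^sup>2\<bar> \<le> B\<^sup>2" for x
      using power_mono[OF bound[of x], of 2] by simp
  qed measurable
  have le: "expectation (\<lambda>\<omega>. R p \<omega> * R q \<omega>) \<le> \<rho>" if "p \<in> I" "q \<in> I" for p q
  proof -
    have "expectation (\<lambda>\<omega>. R p \<omega> * R q \<omega>) \<le> expectation (\<lambda>\<omega>. ((R p \<omega>)\<^sup>2 + (R q \<omega>)\<^sup>2) / 2)"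
    proof (rule integral_mono)
      show "R p \<omega> * R q \<omega> \<le> ((R p \<omega>)\<^sup>2 + (R q \<omega>)\<^sup>2) / 2" for \<omega>
        using sum_squares_bound[of "R p \<omega>" "R q \<omega>"] by simp
    qed (use prod_int that in \<open>simp_all add: power2_eq_square\<close>)
    also have "\<dots> = \<rho>"
      using sq that prod_int[OF that(1,1)] prod_int[OF that(2,2)] by (simp add: power2_eq_square)
    finally show ?thesis .
  qed
  have zero_isolated: "expectation (\<lambda>\<omega>. R p \<omega> * R q \<omega>) = 0"
    if pq: "p \<in> I" "q \<in> I"
      and iso: "gap (fst p) (fst q) \<and> gap (fst p) (snd q) \<or> gap (snd p) (fst q) \<and> gap (snd p) (snd q)" for p q
    using iso
  proof
    assume "gap (fst p) (fst q) \<and> gap (fst p) (snd q)"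
    with expectation_degenerate_isolated[OF r bound r bound zero(1) memD(1,2)[OF pq(1)] memD(1,2)[OF pq(2)] memD(3)[OF pq(1)]]
    show ?thesis by (simp add: R_def)
  next
    assume "gap (snd p) (fst q) \<and> gap (snd p) (snd q)"
    moreover have "gap (snd p) (fst p)" using memD(3)[OF pq(1)] by auto
    ultimately show ?thesis
      using expectation_degenerate_isolated[of "\<lambda>x. r (snd x, fst x)" B r "snd p" "fst p" "fst q" "snd q"]
        memD(1,2)[OF pq(1)] memD(1,2)[OF pq(2)] zero(2) bound by (simp add: R_def)
  qed
  have zero_far: "expectation (\<lambda>\<omega>. R p \<omega> * R q \<omega>) = 0" if pq: "p \<in> I" "q \<in> I" "q \<notin> near p" for p q
  proof -
    let ?far = "\<lambda>p q. gap (fst p) (fst q) \<and> gap (fst p) (snd q) \<or> gap (snd p) (fst q) \<and> gap (snd p) (snd q)"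
    \<comment> \<open>Some index of one pair is far from both indices of the other.\<close>
    have "?far p q \<or> ?far q p"
      using pq(3) unfolding near_def Un_iff Int_iff mem_Collect_eq by linarith
    thus ?thesis
    proof
      assume "?far p q"
      thus ?thesis by (rule zero_isolated[OF pq(1,2)])
    next
      assume "?far q p"
      from zero_isolated[OF pq(2,1) this] show ?thesis by (simp only: mult.commute)
    qed
  qed
  have \<rho>_nonneg: "0 \<le> \<rho>" unfolding \<rho>_def by simp
  have near_card: "finite (near p)" "card (near p) \<le> 2 * (2 * m + 1)\<^sup>2" for p
  proof -
    have eq: "near p = {i. \<not> gap (fst p) i} \<times> {j. \<not> gap (snd p) j} \<union> {j. \<not> gap (snd p) j} \<times> {i. \<not> gap (fst p) i}"
      unfolding near_def by auto
    show "finite (near p)" unfolding eq using card_not_gap(1) by blast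
    have "card (near p) \<le> card {i. \<not> gap (fst p) i} * card {j. \<not> gap (snd p) j} + card {j. \<not> gap (snd p) j} * card {i. \<not> gap (fst p) i}"
      unfolding eq card_cartesian_product[symmetric] by (rule card_Un_le)
    also have "\<dots> \<le> (2 * m + 1) * (2 * m + 1) + (2 * m + 1) * (2 * m + 1)"
      by (intro add_mono mult_mono card_not_gap) auto
    finally show "card (near p) \<le> 2 * (2 * m + 1)\<^sup>2" by (simp add: power2_eq_square)
  qed
  have "expectation (\<lambda>\<omega>. (\<Sum>p\<in>I. R p \<omega>)\<^sup>2) = expectation (\<lambda>\<omega>. \<Sum>p\<in>I. \<Sum>q\<in>I. R p \<omega> * R q \<omega>)"
    by (simp only: power2_eq_square sum_product)
  also have "\<dots> = (\<Sum>p\<in>I. expectation (\<lambda>\<omega>. \<Sum>q\<in>I. R p \<omega> * R q \<omega>))"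
    by (intro Bochner_Integration.integral_sum Bochner_Integration.integrable_sum prod_int)
  also have "\<dots> = (\<Sum>p\<in>I. \<Sum>q\<in>I. expectation (\<lambda>\<omega>. R p \<omega> * R q \<omega>))"
    by (intro sum.cong refl Bochner_Integration.integral_sum prod_int)
  also have "\<dots> \<le> (\<Sum>p\<in>I. \<Sum>q\<in>I. if q \<in> near p then \<rho> else 0)"
    by (intro sum_mono) (use le zero_far in auto)
  also have "\<dots> = (\<Sum>p\<in>I. real (card (I \<inter> near p)) * \<rho>)"
    using fin by (intro sum.cong refl) (simp add: sum.If_cases Int_def)
  also have "\<dots> \<le> (\<Sum>p\<in>I. real (2 * (2 * m + 1)\<^sup>2) * \<rho>)"
  proof (intro sum_mono mult_right_mono \<rho>_nonneg)
    fix p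
    have "card (I \<inter> near p) \<le> card (near p)" using near_card(1) by (intro card_mono) auto
    thus "real (card (I \<inter> near p)) \<le> real (2 * (2 * m + 1)\<^sup>2)" using near_card(2)[of p] by linarith
  qed
  also have "\<dots> = real (card I) * (real (2 * (2 * m + 1)\<^sup>2) * \<rho>)" by simp
  also have "\<dots> \<le> real (n * n) * (real (2 * (2 * m + 1)\<^sup>2) * \<rho>)"
  proof (intro mult_right_mono mult_nonneg_nonneg \<rho>_nonneg)
    have "card I \<le> card ({1..n} \<times> {1..n})" using I(1) by (intro card_mono) auto
    thus "real (card I) \<le> real (n * n)" by (simp del: of_nat_mult add: of_nat_le_iff)
  qed auto
  finally show ?thesis
    by (simp add: \<rho>_def R_def split_beta power2_eq_square algebra_simps)
qed

text \<open>
  Subtracting both projections and adding the mean makes a kernel degenerate. The remainder is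
  orthogonal to functions of a single argument, so its second moment does not exceed that of
  \<open>H\<close>.
\<close>
lemma second_moment_hoeffding_remainder:
  fixes H :: "'b \<times> 'b \<Rightarrow> real"
  assumes H [measurable]: "H \<in> borel_measurable (borel \<Otimes>\<^sub>M borel)" and bound: "\<And>x. \<bar>H x\<bar> \<le> B"
    and I: "I \<subseteq> {1..n} \<times> {1..n}" "\<And>i j. (i, j) \<in> I \<Longrightarrow> gap i j"
  defines "a \<equiv> \<lambda>x. \<integral>y. H (x, y) \<partial>law" and "b \<equiv> \<lambda>y. \<integral>x. H (x, y) \<partial>law"
    and "\<theta> \<equiv> \<integral>x. (\<integral>y. H (x, y) \<partial>law) \<partial>law"
  shows "expectation (\<lambda>\<omega>. (\<Sum>(i, j)\<in>I. H (Z i \<omega>, Z j \<omega>) - a (Z i \<omega>) - b (Z j \<omega>) + \<theta>)\<^sup>2)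
    \<le> 2 * real ((2 * m + 1)\<^sup>2) * (real n)\<^sup>2 * (\<integral>x. (\<integral>y. (H (x, y))\<^sup>2 \<partial>law) \<partial>law)"
proof -
  interpret P: pair_prob_space law law ..
  have B: "0 \<le> B" using bound[of undefined] by simp
  have [measurable]: "H \<in> borel_measurable (law \<Otimes>\<^sub>M law)"
    using H by (simp cong: measurable_cong_sets)
  have a [measurable]: "a \<in> borel_measurable borel" and b [measurable]: "b \<in> borel_measurable borel"
    unfolding a_def b_def by measurable
  have int_P: "integrable (law \<Otimes>\<^sub>M law) f" if "f \<in> borel_measurable (borel \<Otimes>\<^sub>M borel)" "\<And>x. \<bar>f x\<bar> \<le> C" for f :: "'b \<times> 'b \<Rightarrow> real" and C
    using that by (intro P.P.integrable_const_bound[where B = C]) (auto cong: measurable_cong_sets)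
  have int_law: "integrable law f" if "f \<in> borel_measurable borel" "\<And>x. \<bar>f x\<bar> \<le> C" for f :: "'b \<Rightarrow> real" and C
    using that by (intro law.integrable_const_bound[where B = C]) auto
  have avg_bound: "\<bar>\<integral>x. f x \<partial>law\<bar> \<le> C" if "f \<in> borel_measurable borel" "\<And>x. \<bar>f x\<bar> \<le> C" for f :: "'b \<Rightarrow> real" and C
  proof -
    have "\<bar>\<integral>x. f x \<partial>law\<bar> \<le> (\<integral>x. \<bar>f x\<bar> \<partial>law)" by (rule integral_abs_bound)
    also have "\<dots> \<le> (\<integral>x. C \<partial>law)" using int_law[OF that] that(2) by (intro integral_mono) auto
    finally show ?thesis using law.prob_space by simp
  qed
  have a_bound: "\<bar>a x\<bar> \<le> B" and b_bound: "\<bar>b x\<bar> \<le> B" for x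
    unfolding a_def b_def by (rule avg_bound[OF _ bound], measurable)+
  have \<theta>_bound: "\<bar>\<theta>\<bar> \<le> B" unfolding \<theta>_def a_def[symmetric] using a_bound by (intro avg_bound) auto
  have \<theta>_b: "\<theta> = (\<integral>y. b y \<partial>law)"
    unfolding \<theta>_def b_def by (rule P.Fubini_integral[symmetric]) (simp add: int_P[OF H bound])
  have H1: "integrable law (\<lambda>y. H (x, y))" "integrable law (\<lambda>y. H (y, x))" for x
    by (rule int_law[OF _ bound], measurable)+
  have ab1: "integrable law a" "integrable law b"
    by (rule int_law[OF a a_bound], rule int_law[OF b b_bound])
  define r where "r = (\<lambda>(x, y). H (x, y) - a x - b y + \<theta>)"
  have r [measurable]: "r \<in> borel_measurable (borel \<Otimes>\<^sub>M borel)"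
    unfolding r_def by measurable
  have r_bound: "\<bar>r x\<bar> \<le> 4 * B" for x
    using bound[of x] a_bound[of "fst x"] b_bound[of "snd x"] \<theta>_bound
    unfolding r_def split_beta prod.collapse by linarith
  have law1: "law.prob UNIV = 1" using law.prob_space by simp
  have zero1: "(\<integral>x. r (x, y) \<partial>law) = 0" for y
    using H1 ab1 by (simp add: r_def law1) (simp add: \<theta>_def a_def b_def)
  have zero2: "(\<integral>y. r (x, y) \<partial>law) = 0" for x
    using H1 ab1 by (simp add: r_def law1) (simp add: \<theta>_b a_def)
  define s where "s = (\<lambda>(x, y). a x + b y - \<theta>)"
  have s [measurable]: "s \<in> borel_measurable (borel \<Otimes>\<^sub>M borel)"
    unfolding s_def by measurable
  have ra_bound: "\<bar>r z * (a (fst z) - \<theta>)\<bar> \<le> 4 * B * (2 * B)" for z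
    unfolding abs_mult using B r_bound[of z] a_bound[of "fst z"] \<theta>_bound by (intro mult_mono) auto
  have rb_bound: "\<bar>r z * b (snd z)\<bar> \<le> 4 * B * B" for z
    unfolding abs_mult using B r_bound[of z] b_bound[of "snd z"] by (intro mult_mono) auto
  have ra_int: "integrable (law \<Otimes>\<^sub>M law) (\<lambda>z. r z * (a (fst z) - \<theta>))"
    by (rule int_P[OF _ ra_bound]) measurable
  have rb_int: "integrable (law \<Otimes>\<^sub>M law) (\<lambda>z. r z * b (snd z))"
    by (rule int_P[OF _ rb_bound]) measurable
  have orth_a: "(\<integral>z. r z * (a (fst z) - \<theta>) \<partial>(law \<Otimes>\<^sub>M law)) = 0"
    using P.integral_fst'[OF ra_int] by (simp add: zero2)
  have orth_b: "(\<integral>z. r z * b (snd z) \<partial>(law \<Otimes>\<^sub>M law)) = 0"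
  proof -
    have eq: "(\<lambda>(x, y). r (x, y) * b y) = (\<lambda>z. r z * b (snd z))" by (simp add: fun_eq_iff)
    show ?thesis using P.integral_snd[of "\<lambda>x y. r (x, y) * b y"] rb_int unfolding eq by (simp add: zero1)
  qed
  have sq_int: "integrable (law \<Otimes>\<^sub>M law) (\<lambda>z. (r z)\<^sup>2)" "integrable (law \<Otimes>\<^sub>M law) (\<lambda>z. (H z)\<^sup>2)"
  proof -
    have sq_bound: "\<bar>(r z)\<^sup>2\<bar> \<le> (4 * B)\<^sup>2" "\<bar>(H z)\<^sup>2\<bar> \<le> B\<^sup>2" for z
      using power_mono[OF r_bound[of z], of 2] power_mono[OF bound[of z], of 2] by simp_all
    show "integrable (law \<Otimes>\<^sub>M law) (\<lambda>z. (r z)\<^sup>2)" by (rule int_P[OF _ sq_bound(1)]) measurable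
    show "integrable (law \<Otimes>\<^sub>M law) (\<lambda>z. (H z)\<^sup>2)" by (rule int_P[OF _ sq_bound(2)]) measurable
  qed
  have "(\<integral>z. (r z)\<^sup>2 \<partial>(law \<Otimes>\<^sub>M law)) = (\<integral>z. (r z)\<^sup>2 + 2 * (r z * (a (fst z) - \<theta>) + r z * b (snd z)) \<partial>(law \<Otimes>\<^sub>M law))"
    using sq_int ra_int rb_int orth_a orth_b by simp
  also have "\<dots> \<le> (\<integral>z. (H z)\<^sup>2 \<partial>(law \<Otimes>\<^sub>M law))"
  proof (rule integral_mono)
    fix z
    have "H z = r z + s z" by (simp add: r_def s_def split_beta)
    hence "(H z)\<^sup>2 = (r z)\<^sup>2 + 2 * (r z * s z) + (s z)\<^sup>2" by (simp add: power2_eq_square algebra_simps)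
    moreover have "s z = (a (fst z) - \<theta>) + b (snd z)" by (simp add: s_def split_beta)
    ultimately show "(r z)\<^sup>2 + 2 * (r z * (a (fst z) - \<theta>) + r z * b (snd z)) \<le> (H z)\<^sup>2"
      by (simp add: distrib_left)
  qed (use sq_int ra_int rb_int in auto)
  finally have "(\<integral>x. (\<integral>y. (r (x, y))\<^sup>2 \<partial>law) \<partial>law) \<le> (\<integral>x. (\<integral>y. (H (x, y))\<^sup>2 \<partial>law) \<partial>law)"
    using P.integral_fst'[OF sq_int(1)] P.integral_fst'[OF sq_int(2)] by simp
  moreover have "expectation (\<lambda>\<omega>. (\<Sum>(i, j)\<in>I. r (Z i \<omega>, Z j \<omega>))\<^sup>2)
    \<le> 2 * real ((2 * m + 1)\<^sup>2) * (real n)\<^sup>2 * (\<integral>x. (\<integral>y. (r (x, y))\<^sup>2 \<partial>law) \<partial>law)"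
    by (rule second_moment_degenerate_sum[OF r r_bound zero1 zero2 I])
  ultimately have "expectation (\<lambda>\<omega>. (\<Sum>(i, j)\<in>I. r (Z i \<omega>, Z j \<omega>))\<^sup>2)
    \<le> 2 * real ((2 * m + 1)\<^sup>2) * (real n)\<^sup>2 * (\<integral>x. (\<integral>y. (H (x, y))\<^sup>2 \<partial>law) \<partial>law)"
    by (elim order.trans) (rule mult_left_mono, auto)
  thus ?thesis by (simp add: r_def)
qed

end

section \<open>Second moments of linear sums\<close>

context stationary_m_dependent
begin

lemma expectation_Z:
  fixes f :: "'b \<Rightarrow> real"
  assumes "1 \<le> i" "f \<in> borel_measurable borel"
  shows "expectation (\<lambda>\<omega>. f (Z i \<omega>)) = (\<integral>z. f z \<partial>law)"
  using assms by (simp add: distr_Z[OF assms(1), symmetric] integral_distr)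

lemma integrable_Z:
  fixes f :: "'b \<Rightarrow> real"
  assumes "1 \<le> i" "f \<in> borel_measurable borel" "integrable law f"
  shows "integrable M (\<lambda>\<omega>. f (Z i \<omega>))"
proof -
  have "integrable (distr M borel (Z i)) f" using assms(3) by (simp only: distr_Z[OF assms(1)])
  thus ?thesis by (rule integrable_distr[OF measurable_Z[OF assms(1)]])
qed

definition autocov :: "('b \<Rightarrow> real) \<Rightarrow> nat \<Rightarrow> real" where
  "autocov G h = expectation (\<lambda>\<omega>. G (Z 1 \<omega>) * G (Z (1 + h) \<omega>))"

lemma expectation_autocov:
  assumes "1 \<le> i" and [measurable]: "G \<in> borel_measurable borel"
  shows "expectation (\<lambda>\<omega>. G (Z i \<omega>) * G (Z (i + h) \<omega>)) = autocov G h"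
proof -
  have "expectation (\<lambda>\<omega>. G (Z k \<omega>) * G (Z (k + h) \<omega>))
      = (\<integral>z. G (fst z) * G (snd z) \<partial>distr M (borel \<Otimes>\<^sub>M borel) (\<lambda>\<omega>. (Z k \<omega>, Z (k + h) \<omega>)))"
    if [arith]: "1 \<le> k" for k
    by (subst integral_distr) auto
  from this[OF assms(1)] this[of 1] show ?thesis
    unfolding autocov_def distr_pair[OF assms(1)] by simp
qed

end

text \<open>
  Densities evaluated at the observations may be unbounded, so the summands are only assumed
  square integrable; all computations involve products of two summands.
\<close>
locale centred_linear_sum = stationary_m_dependent M m Z
  for M :: "'w measure" and m and Z :: "nat \<Rightarrow> 'w \<Rightarrow> 'b::topological_space" +
  fixes G :: "'b \<Rightarrow> real"
  assumes G [measurable]: "G \<in> borel_measurable borel"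
    and square_integrable: "integrable law (\<lambda>z. (G z)\<^sup>2)"
    and centred: "(\<integral>z. G z \<partial>law) = 0"
begin

abbreviation moment :: "nat \<Rightarrow> nat \<Rightarrow> real" where
  "moment i j \<equiv> expectation (\<lambda>\<omega>. G (Z i \<omega>) * G (Z j \<omega>))"

lemma G_prod_integrable:
  assumes "1 \<le> i" "1 \<le> j"
  shows "integrable M (\<lambda>\<omega>. G (Z i \<omega>) * G (Z j \<omega>))"
  using assms square_integrable
  by (intro integrable_mult_of_square_integrable integrable_Z[of _ "\<lambda>z. (G z)\<^sup>2"]) auto

lemma G_integrable: "1 \<le> i \<Longrightarrow> integrable M (\<lambda>\<omega>. G (Z i \<omega>))"
  by (rule square_integrable_imp_integrable) (use G_prod_integrable[of i i] in \<open>auto simp: power2_eq_square\<close>)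

lemma expectation_prod_gap:
  assumes "1 \<le> i" "1 \<le> j" "gap i j"
  shows "moment i j = 0"
proof -
  have "indep_var borel (G \<circ> Z i) borel (G \<circ> Z j)"
    by (rule indep_var_compose[OF indep_var_gap[OF assms]]) (rule G)+
  hence "moment i j = expectation (\<lambda>\<omega>. G (Z i \<omega>)) * expectation (\<lambda>\<omega>. G (Z j \<omega>))"
    using indep_var_lebesgue_integral[of "G \<circ> Z i" "G \<circ> Z j"] G_integrable assms(1,2) by (simp add: comp_def)
  thus ?thesis using expectation_Z[OF assms(1) G] by (simp add: centred)
qed

lemma expectation_prod_le:
  assumes "1 \<le> i" "1 \<le> j"
  shows "\<bar>moment i j\<bar> \<le> (\<integral>z. (G z)\<^sup>2 \<partial>law)"
proof -
  have sq: "integrable M (\<lambda>\<omega>. (G (Z k \<omega>))\<^sup>2)" "expectation (\<lambda>\<omega>. (G (Z k \<omega>))\<^sup>2) = (\<integral>z. (G z)\<^sup>2 \<partial>law)"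
    if "1 \<le> k" for k
    using that square_integrable integrable_Z[of k "\<lambda>z. (G z)\<^sup>2"] expectation_Z[of k "\<lambda>z. (G z)\<^sup>2"] by simp_all
  have "\<bar>moment i j\<bar> \<le> expectation (\<lambda>\<omega>. \<bar>G (Z i \<omega>) * G (Z j \<omega>)\<bar>)"
    by (rule integral_abs_bound)
  also have "\<dots> \<le> expectation (\<lambda>\<omega>. ((G (Z i \<omega>))\<^sup>2 + (G (Z j \<omega>))\<^sup>2) / 2)"
  proof (rule integral_mono)
    show "\<bar>G (Z i \<omega>) * G (Z j \<omega>)\<bar> \<le> ((G (Z i \<omega>))\<^sup>2 + (G (Z j \<omega>))\<^sup>2) / 2" for \<omega>
      using sum_squares_bound[of "\<bar>G (Z i \<omega>)\<bar>" "\<bar>G (Z j \<omega>)\<bar>"] by (simp add: abs_mult)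
  qed (use G_prod_integrable[OF assms] sq assms in auto)
  also have "\<dots> = (\<integral>z. (G z)\<^sup>2 \<partial>law)"
    using sq assms by simp
  finally show ?thesis .
qed

lemma weighted_sum_integrable:
  "integrable M (\<lambda>\<omega>. (\<Sum>i=1..n. c i * G (Z i \<omega>))\<^sup>2)" (is ?int)
  and weighted_sum_expand:
  "expectation (\<lambda>\<omega>. (\<Sum>i=1..n. c i * G (Z i \<omega>))\<^sup>2) =
    (\<Sum>i=1..n. \<Sum>j=1..n. c i * c j * moment i j)" (is ?eq)
proof -
  have eq: "(\<Sum>i=1..n. c i * G (Z i \<omega>))\<^sup>2 = (\<Sum>i=1..n. \<Sum>j=1..n. (c i * c j) * (G (Z i \<omega>) * G (Z j \<omega>)))" for \<omega>
    by (simp only: power2_eq_square sum_product) (simp only: ac_simps)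
  have int: "integrable M (\<lambda>\<omega>. (c i * c j) * (G (Z i \<omega>) * G (Z j \<omega>)))" if "i \<in> {1..n}" "j \<in> {1..n}" for i j
    using that by (intro integrable_mult_right G_prod_integrable) auto
  show ?int unfolding eq by (intro Bochner_Integration.integrable_sum int)
  have "expectation (\<lambda>\<omega>. (\<Sum>i=1..n. c i * G (Z i \<omega>))\<^sup>2) =
      (\<Sum>i=1..n. expectation (\<lambda>\<omega>. \<Sum>j=1..n. (c i * c j) * (G (Z i \<omega>) * G (Z j \<omega>))))"
    unfolding eq by (intro Bochner_Integration.integral_sum Bochner_Integration.integrable_sum int)
  also have "\<dots> = (\<Sum>i=1..n. \<Sum>j=1..n. expectation (\<lambda>\<omega>. (c i * c j) * (G (Z i \<omega>) * G (Z j \<omega>))))"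
    by (intro sum.cong refl Bochner_Integration.integral_sum int)
  finally show ?eq by simp
qed

text \<open>
  Each index has at most \<open>2m + 1\<close> correlated partners, itself included, and \<open>|c\<^sub>i c\<^sub>j| \<le> (c\<^sub>i\<^sup>2 + c\<^sub>j\<^sup>2) / 2\<close>.
\<close>
lemma second_moment_weighted_sum:
  "expectation (\<lambda>\<omega>. (\<Sum>i=1..n. c i * G (Z i \<omega>))\<^sup>2) \<le> real (2 * m + 1) * (\<Sum>i=1..n. (c i)\<^sup>2) * (\<integral>z. (G z)\<^sup>2 \<partial>law)"
proof -
  define s where "s = (\<integral>z. (G z)\<^sup>2 \<partial>law)"
  have s: "0 \<le> s" by (simp add: s_def)
  define near where "near i j = (if gap i j then 0 else s :: real)" for i j
  have near_sum: "(\<Sum>j=1..n. near i j) \<le> real (2 * m + 1) * s" for i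
  proof -
    have "(\<Sum>j=1..n. near i j) = real (card ({1..n} \<inter> {j. \<not> gap i j})) * s"
      unfolding near_def by (simp add: sum.If_cases Collect_neg_eq[symmetric])
    also have "\<dots> \<le> real (2 * m + 1) * s"
    proof (rule mult_right_mono[OF _ s])
      have "card ({1..n} \<inter> {j. \<not> gap i j}) \<le> card {j. \<not> gap i j}"
        by (intro card_mono card_not_gap) auto
      thus "real (card ({1..n} \<inter> {j. \<not> gap i j})) \<le> real (2 * m + 1)"
        using card_not_gap(2)[of i] by linarith
    qed
    finally show ?thesis .
  qed
  have near_sym: "near i j = near j i" for i j by (auto simp: near_def)
  have "expectation (\<lambda>\<omega>. (\<Sum>i=1..n. c i * G (Z i \<omega>))\<^sup>2) =
    (\<Sum>i=1..n. \<Sum>j=1..n. c i * c j * moment i j)"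
    by (rule weighted_sum_expand)
  also have "\<dots> \<le> (\<Sum>i=1..n. \<Sum>j=1..n. ((c i)\<^sup>2 + (c j)\<^sup>2) / 2 * near i j)"
  proof (intro sum_mono)
    fix i j assume ij: "i \<in> {1..n}" "j \<in> {1..n}"
    let ?e = "moment i j"
    have "\<bar>?e\<bar> \<le> near i j"
      using expectation_prod_gap[of i j] expectation_prod_le[of i j] ij by (auto simp: near_def s_def)
    moreover have "\<bar>c i * c j\<bar> \<le> ((c i)\<^sup>2 + (c j)\<^sup>2) / 2"
      using sum_squares_bound[of "\<bar>c i\<bar>" "\<bar>c j\<bar>"] by (simp add: abs_mult)
    ultimately have "\<bar>c i * c j\<bar> * \<bar>?e\<bar> \<le> ((c i)\<^sup>2 + (c j)\<^sup>2) / 2 * near i j"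
      by (intro mult_mono) auto
    thus "c i * c j * ?e \<le> ((c i)\<^sup>2 + (c j)\<^sup>2) / 2 * near i j"
      using abs_ge_self[of "c i * c j * ?e"] by (simp add: abs_mult)
  qed
  also have "\<dots> = (\<Sum>i=1..n. \<Sum>j=1..n. (c i)\<^sup>2 / 2 * near i j) + (\<Sum>i=1..n. \<Sum>j=1..n. (c j)\<^sup>2 / 2 * near i j)"
    by (simp add: sum.distrib[symmetric] add_divide_distrib distrib_right)
  also have "(\<Sum>i=1..n. \<Sum>j=1..n. (c j)\<^sup>2 / 2 * near i j) = (\<Sum>i=1..n. \<Sum>j=1..n. (c i)\<^sup>2 / 2 * near i j)"
    by (subst sum.swap) (simp add: near_sym)
  also have "(\<Sum>i=1..n. \<Sum>j=1..n. (c i)\<^sup>2 / 2 * near i j) + (\<Sum>i=1..n. \<Sum>j=1..n. (c i)\<^sup>2 / 2 * near i j)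
      = (\<Sum>i=1..n. (c i)\<^sup>2 * (\<Sum>j=1..n. near i j))"
    by (simp add: sum_distrib_left sum.distrib[symmetric] mult.commute)
  also have "\<dots> \<le> (\<Sum>i=1..n. (c i)\<^sup>2 * (real (2 * m + 1) * s))"
    by (intro sum_mono mult_left_mono near_sum) auto
  also have "\<dots> = real (2 * m + 1) * (\<Sum>i=1..n. (c i)\<^sup>2) * s"
    unfolding sum_distrib_right[symmetric] by (simp only: mult.commute mult.left_commute)
  finally show ?thesis unfolding s_def .
qed

definition long_run_variance :: real where
  "long_run_variance = autocov G 0 + 2 * (\<Sum>h=1..m. autocov G h)"

text \<open>
  The new summand can be correlated only with the \<open>m\<close> preceding ones, so from \<open>n = m\<close> on the
  second moment grows by a constant.
\<close>
lemma second_moment_sum_Suc: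
  assumes "m \<le> n"
  shows "expectation (\<lambda>\<omega>. (\<Sum>i=1..Suc n. G (Z i \<omega>))\<^sup>2) =
    expectation (\<lambda>\<omega>. (\<Sum>i=1..n. G (Z i \<omega>))\<^sup>2) + long_run_variance"
proof -
  have "(\<Sum>i=1..n. moment i (Suc n))
      = (\<Sum>i=n+1-m..n. moment i (Suc n))"
    by (rule sum.mono_neutral_right) (use assms in \<open>auto intro!: expectation_prod_gap\<close>)
  also have "\<dots> = (\<Sum>h=1..m. autocov G h)"
  proof (rule sum.reindex_bij_witness[of _ "\<lambda>h. Suc n - h" "\<lambda>i. Suc n - i"])
    fix i assume i: "i \<in> {n + 1 - m..n}"
    hence "1 \<le> i" "i + (Suc n - i) = Suc n" using assms by auto
    thus "autocov G (Suc n - i) = moment i (Suc n)"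
      using expectation_autocov[OF _ G, of i "Suc n - i"] by simp
  qed (use assms in auto)
  finally have cross: "(\<Sum>i=1..n. moment i (Suc n)) = (\<Sum>h=1..m. autocov G h)" .
  have last: "moment (Suc n) (Suc n) = autocov G 0"
    using expectation_autocov[OF _ G, of "Suc n" 0] by simp
  have expand: "expectation (\<lambda>\<omega>. (\<Sum>i=1..k. G (Z i \<omega>))\<^sup>2) =
    (\<Sum>i=1..k. \<Sum>j=1..k. moment i j)" for k
    using weighted_sum_expand[of "\<lambda>_. 1" k] by simp
  have sym: "(\<Sum>i=1..n. moment (Suc n) i) =
      (\<Sum>i=1..n. moment i (Suc n))"
    by (simp only: mult.commute)
  have "expectation (\<lambda>\<omega>. (\<Sum>i=1..Suc n. G (Z i \<omega>))\<^sup>2) =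
    expectation (\<lambda>\<omega>. (\<Sum>i=1..n. G (Z i \<omega>))\<^sup>2)
      + (\<Sum>i=1..n. moment i (Suc n))
      + (\<Sum>i=1..n. moment (Suc n) i)
      + moment (Suc n) (Suc n)"
    unfolding expand by (simp add: sum.distrib)
  thus ?thesis
    unfolding sym cross last long_run_variance_def by linarith
qed

lemma second_moment_sum_asymp:
  "(\<lambda>n. expectation (\<lambda>\<omega>. (\<Sum>i=1..n. G (Z i \<omega>))\<^sup>2) / real n) \<longlonglongrightarrow> long_run_variance"
proof -
  define v where "v n = expectation (\<lambda>\<omega>. (\<Sum>i=1..n. G (Z i \<omega>))\<^sup>2)" for n
  have v: "v (m + n) = v m + real n * long_run_variance" for n
  proof (induction n)
    case (Suc n)
    show ?case using second_moment_sum_Suc[of "m + n"] Suc.IH by (simp add: v_def algebra_simps)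
  qed simp
  have "v n / real n = v m / real n + (1 - real m / real n) * long_run_variance" if "m < n" for n
    using v[of "n - m"] that by (simp add: field_simps of_nat_diff)
  hence "\<forall>\<^sub>F n in sequentially. v m / real n + (1 - real m / real n) * long_run_variance = v n / real n"
    by (intro eventually_mono[OF eventually_gt_at_top[of m]]) simp
  moreover have "(\<lambda>n. v m / real n + (1 - real m / real n) * long_run_variance) \<longlonglongrightarrow> 0 + (1 - 0) * long_run_variance"
    by (intro tendsto_intros lim_const_over_n)
  ultimately have "(\<lambda>n. v n / real n) \<longlonglongrightarrow> 0 + (1 - 0) * long_run_variance"
    by (rule Lim_transform_eventually[rotated])
  thus ?thesis unfolding v_def by simp
qed

end

section \<open>The ball kernel and its projections\<close>

lemma (in stationary_m_dependent)
  fixes w :: "'b \<Rightarrow> 'a::euclidean_space" and f :: "'a \<Rightarrow> real"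
  assumes [measurable]: "w \<in> borel_measurable borel" "f \<in> borel_measurable borel"
    and density: "is_density M (\<lambda>\<omega>. w (Z 1 \<omega>)) p"
  shows integral_law_density: "(\<integral>z. f (w z) \<partial>law) = (\<integral>x. p x * f x \<partial>lborel)"
    and integrable_law_density: "integrable law (\<lambda>z. f (w z)) \<longleftrightarrow> integrable lborel (\<lambda>x. p x * f x)"
proof -
  have d: "distributed M lborel (\<lambda>\<omega>. w (Z 1 \<omega>)) p" and p: "\<And>x. 0 \<le> p x"
    using density by (auto simp: is_density_def)
  have "(\<integral>z. f (w z) \<partial>law) = expectation (\<lambda>\<omega>. f (w (Z 1 \<omega>)))"
    by (rule expectation_Z[symmetric]) auto
  also have "\<dots> = (\<integral>x. p x * f x \<partial>lborel)"
    by (rule distributed_integral[OF d, symmetric]) (auto simp: p)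
  finally show "(\<integral>z. f (w z) \<partial>law) = (\<integral>x. p x * f x \<partial>lborel)" .
  have "integrable law (\<lambda>z. f (w z)) \<longleftrightarrow> integrable M (\<lambda>\<omega>. f (w (Z 1 \<omega>)))"
    unfolding law_def by (rule integrable_distr_eq) auto
  also have "\<dots> \<longleftrightarrow> integrable lborel (\<lambda>x. p x * f x)"
    by (rule distributed_integrable[OF d, symmetric]) (auto simp: p)
  finally show "integrable law (\<lambda>z. f (w z)) \<longleftrightarrow> integrable lborel (\<lambda>x. p x * f x)" .
qed

text \<open>
  The estimate on \<open>\<real>\<^sup>d\<close>, transferred to the distribution of the observations.
\<close>
lemma (in stationary_m_dependent) law_smoothing_error_tendsto_0:
  fixes w :: "'b \<Rightarrow> 'a::euclidean_space" and p r :: "'a \<Rightarrow> real"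
  assumes w [measurable]: "w \<in> borel_measurable borel" and density: "is_density M (\<lambda>\<omega>. w (Z 1 \<omega>)) p"
    and p: "p \<in> Lp_fun 3" and r: "r \<in> Lp_fun 3" and a: "0 < a"
    and int: "\<And>e. integrable law (\<lambda>z. (smoothing e r (w z) - r (w z))\<^sup>2)"
  shows "\<exists>\<delta>>0. \<forall>e. 0 < e \<and> e < \<delta> \<longrightarrow> (\<integral>z. (smoothing e r (w z) - r (w z))\<^sup>2 \<partial>law) \<le> a"
proof -
  note [measurable] = Lp_fun_3_D(1)[OF r]
  have d: "distributed M lborel (\<lambda>\<omega>. w (Z 1 \<omega>)) p" and p_nonneg: "\<And>x. 0 \<le> p x"
    using density by (auto simp: is_density_def)
  obtain \<delta> where \<delta>: "0 < \<delta>" "\<And>e. 0 < e \<Longrightarrow> e < \<delta> \<Longrightarrow>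
      (\<integral>\<^sup>+x. ennreal (p x) * ennreal ((smoothing e r x - r x)\<^sup>2) \<partial>lborel) \<le> ennreal a"
    using smoothing_error_tendsto_0[OF p p_nonneg r a] by auto
  have "(\<integral>z. (smoothing e r (w z) - r (w z))\<^sup>2 \<partial>law) \<le> a" if e: "0 < e" "e < \<delta>" for e
  proof -
    have "ennreal (\<integral>z. (smoothing e r (w z) - r (w z))\<^sup>2 \<partial>law) =
        (\<integral>\<^sup>+z. ennreal ((smoothing e r (w z) - r (w z))\<^sup>2) \<partial>law)"
      using int by (intro nn_integral_eq_integral[symmetric]) auto
    also have "\<dots> = (\<integral>\<^sup>+\<omega>. ennreal ((smoothing e r (w (Z 1 \<omega>)) - r (w (Z 1 \<omega>)))\<^sup>2) \<partial>M)"
      unfolding law_def by (intro nn_integral_distr) auto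
    also have "\<dots> = (\<integral>\<^sup>+x. ennreal (p x) * ennreal ((smoothing e r x - r x)\<^sup>2) \<partial>lborel)"
      by (rule distributed_nn_integral[OF d, symmetric]) measurable
    also note \<delta>(2)[OF e]
    finally show ?thesis by (rule iffD1[OF ennreal_le_iff, rotated]) (use a in simp)
  qed
  thus ?thesis using \<delta>(1) by blast
qed

text \<open>
  One sequence \<open>Z\<close> carries both samples, \<open>X\<^sub>i = u (Z\<^sub>i)\<close> and \<open>Y\<^sub>i = v (Z\<^sub>i)\<close>. The two-sample
  estimator arises from pairs \<open>Z\<^sub>i = (X\<^sub>i, Y\<^sub>i)\<close> with the two projections, the one-sample
  estimator from \<open>u\<close> and \<open>v\<close> both the identity.
\<close>
locale density_pair = stationary_m_dependent M m Z
  for M :: "'w measure" and m and Z :: "nat \<Rightarrow> 'w \<Rightarrow> 'b::topological_space" +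
  fixes u v :: "'b \<Rightarrow> 'a::euclidean_space" and pX pY :: "'a \<Rightarrow> real"
  assumes u [measurable]: "u \<in> borel_measurable borel" and v [measurable]: "v \<in> borel_measurable borel"
    and density_u: "is_density M (\<lambda>\<omega>. u (Z 1 \<omega>)) pX" and density_v: "is_density M (\<lambda>\<omega>. v (Z 1 \<omega>)) pY"
    and pX_L3: "pX \<in> Lp_fun 3" and pY_L3: "pY \<in> Lp_fun 3"
begin

lemma pX [measurable]: "pX \<in> borel_measurable borel" and pY [measurable]: "pY \<in> borel_measurable borel"
  using pX_L3 pY_L3 by (simp_all add: Lp_fun_3_D)

lemmas integral_law_u = integral_law_density[OF u _ density_u]
  and integrable_law_u = integrable_law_density[OF u _ density_u]
  and integral_law_v = integral_law_density[OF v _ density_v]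
  and integrable_law_v = integrable_law_density[OF v _ density_v]

definition kernel :: "real \<Rightarrow> 'b \<times> 'b \<Rightarrow> real" where
  "kernel e z = of_bool (dist (u (fst z)) (v (snd z)) \<le> e) / ball_volume TYPE('a) e"

definition q :: real where "q = (\<integral>x. pX x * pY x \<partial>lborel)"

definition g :: "'b \<Rightarrow> real" where "g z = (pY (u z) + pX (v z)) / 2"

definition g_smooth :: "real \<Rightarrow> 'b \<Rightarrow> real" where
  "g_smooth e z = (smoothing e pY (u z) + smoothing e pX (v z)) / 2"

text \<open>
  The mean of the kernel under independent arguments, hence the mean of the estimator as
  soon as the index set omits all pairs at distance at most \<open>m\<close>.
\<close>
definition \<theta> :: "real \<Rightarrow> real" where "\<theta> e = (\<integral>z. smoothing e pY (u z) \<partial>law)"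

definition smoothing_mse :: "real \<Rightarrow> real" where
  "smoothing_mse e = (\<integral>z. (g_smooth e z - g z)\<^sup>2 \<partial>law)"

lemma kernel_measurable [measurable]: "kernel e \<in> borel_measurable (borel \<Otimes>\<^sub>M borel)"
  unfolding kernel_def by measurable

lemma g_measurable [measurable]: "g \<in> borel_measurable borel"
  and g_smooth_measurable [measurable]: "g_smooth e \<in> borel_measurable borel"
  unfolding g_def g_smooth_def by measurable

lemma ball_volume_nonneg: "0 \<le> ball_volume TYPE('a) e" by (simp add: ball_volume_def)

lemma kernel_bound: "\<bar>kernel e z\<bar> \<le> 1 / ball_volume TYPE('a) e"
  using ball_volume_nonneg[of e] by (simp add: kernel_def)

lemma kernel_square: "(kernel e z)\<^sup>2 = kernel e z / ball_volume TYPE('a) e"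
  by (simp add: kernel_def power2_eq_square)

lemma kernel_section_u: "(\<integral>y. kernel e (x, y) \<partial>law) = smoothing e pY (u x)"
  unfolding kernel_def fst_conv snd_conv smoothing_def
  by (rule integral_law_v[of "\<lambda>y. of_bool (dist (u x) y \<le> e) / ball_volume TYPE('a) e"]) measurable

lemma kernel_section_v: "(\<integral>x. kernel e (x, y) \<partial>law) = smoothing e pX (v y)"
  unfolding kernel_def fst_conv snd_conv smoothing_def
  using integral_law_u[of "\<lambda>x. of_bool (dist x (v y) \<le> e) / ball_volume TYPE('a) e"] by (simp add: dist_commute)

lemma kernel_integral: "(\<integral>x. (\<integral>y. kernel e (x, y) \<partial>law) \<partial>law) = \<theta> e"
  by (simp add: kernel_section_u \<theta>_def)

lemma kernel_square_integral: "(\<integral>x. (\<integral>y. (kernel e (x, y))\<^sup>2 \<partial>law) \<partial>law) = \<theta> e / ball_volume TYPE('a) e"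
  by (simp add: kernel_square kernel_integral)

lemma kernel_section_integrable: "integrable law (\<lambda>y. kernel e (x, y))" "integrable law (\<lambda>x. kernel e (x, y))"
  by (rule law.integrable_const_bound[where B = "1 / ball_volume TYPE('a) e"]; use kernel_bound in simp)+

lemma smoothing_bounds:
  "0 \<le> smoothing e pY (u z)" "smoothing e pY (u z) \<le> 1 / ball_volume TYPE('a) e"
  "0 \<le> smoothing e pX (v z)" "smoothing e pX (v z) \<le> 1 / ball_volume TYPE('a) e"
proof -
  have nonneg: "0 \<le> kernel e y" for y by (simp add: kernel_def ball_volume_nonneg)
  have le: "kernel e y \<le> 1 / ball_volume TYPE('a) e" for y using kernel_bound[of e y] by linarith
  have law1: "law.prob UNIV = 1" using law.prob_space by simp
  show "0 \<le> smoothing e pY (u z)" "0 \<le> smoothing e pX (v z)"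
    unfolding kernel_section_u[symmetric] kernel_section_v[symmetric] by (simp_all add: nonneg)
  have "(\<integral>y. kernel e (z, y) \<partial>law) \<le> (\<integral>y. 1 / ball_volume TYPE('a) e \<partial>law)" "(\<integral>x. kernel e (x, z) \<partial>law) \<le> (\<integral>y. 1 / ball_volume TYPE('a) e \<partial>law)"
    by (rule integral_mono; use kernel_section_integrable le in simp)+
  thus "smoothing e pY (u z) \<le> 1 / ball_volume TYPE('a) e" "smoothing e pX (v z) \<le> 1 / ball_volume TYPE('a) e"
    unfolding kernel_section_u kernel_section_v by (simp_all add: law1)
qed

lemma \<theta>_v: "(\<integral>z. smoothing e pX (v z) \<partial>law) = \<theta> e"
proof -
  interpret P: pair_prob_space law law ..
  have "integrable (law \<Otimes>\<^sub>M law) (kernel e)"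
    using kernel_bound[of e] kernel_measurable[of e]
    by (intro P.P.integrable_const_bound[where B = "1 / ball_volume TYPE('a) e"]) (auto cong: measurable_cong_sets)
  from P.Fubini_integral[of "\<lambda>x y. kernel e (x, y)"] this
  show ?thesis by (simp add: kernel_section_u kernel_section_v \<theta>_def)
qed

lemma \<theta>_lborel: "\<theta> e = (\<integral>x. pX x * smoothing e pY x \<partial>lborel)"
  unfolding \<theta>_def by (rule integral_law_u) measurable

lemma density_square_integrable:
  "integrable law (\<lambda>z. (pY (u z))\<^sup>2)" "integrable law (\<lambda>z. (pX (v z))\<^sup>2)"
  using integrable_law_u[of "\<lambda>x. (pY x)\<^sup>2"] integrable_law_v[of "\<lambda>x. (pX x)\<^sup>2"]
    integrable_mult_square[of pX lborel pY] integrable_mult_square[of pY lborel pX]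
    Lp_fun_3_D[OF pX_L3] Lp_fun_3_D[OF pY_L3] by simp_all

lemma density_integrable:
  "integrable law (\<lambda>z. pY (u z))" "integrable law (\<lambda>z. pX (v z))"
  by (rule law.square_integrable_imp_integrable[rotated], rule density_square_integrable, measurable)+

lemma smoothing_integrable:
  "integrable law (\<lambda>z. smoothing e pY (u z))" "integrable law (\<lambda>z. smoothing e pX (v z))"
  by (rule law.integrable_const_bound[where B = "1 / ball_volume TYPE('a) e"]; use smoothing_bounds in simp)+

lemma smoothing_square_integrable:
  "integrable law (\<lambda>z. (smoothing e pY (u z))\<^sup>2)" "integrable law (\<lambda>z. (smoothing e pX (v z))\<^sup>2)"
  by (rule law.integrable_const_bound[where B = "(1 / ball_volume TYPE('a) e)\<^sup>2"]; use smoothing_bounds in \<open>simp add: power_mono\<close>)+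

lemma error_square_integrable:
  "integrable law (\<lambda>z. (smoothing e pY (u z) - pY (u z))\<^sup>2)" "integrable law (\<lambda>z. (smoothing e pX (v z) - pX (v z))\<^sup>2)"
  by (intro integrable_square_diff smoothing_square_integrable density_square_integrable; measurable)+

lemma integral_q: "(\<integral>z. pY (u z) \<partial>law) = q" "(\<integral>z. pX (v z) \<partial>law) = q"
  using integral_law_u[OF pY] integral_law_v[OF pX] by (simp_all add: q_def mult.commute)

lemma integral_g: "(\<integral>z. g z \<partial>law) = q" and integrable_g: "integrable law g"
  using density_integrable integral_q unfolding g_def by simp_all

lemma integral_g_smooth: "(\<integral>z. g_smooth e z \<partial>law) = \<theta> e" and integrable_g_smooth: "integrable law (g_smooth e)"
  using smoothing_integrable[of e] \<theta>_v[of e] unfolding g_smooth_def by (simp_all add: \<theta>_def[symmetric])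

lemma square_mean_le: "((a + b) / 2)\<^sup>2 \<le> (a\<^sup>2 + b\<^sup>2) / (2::real)"
  using sum_squares_bound[of a b] by (simp add: power2_sum power_divide field_simps)

lemma integrable_square_mean:
  fixes f h :: "'b \<Rightarrow> real"
  assumes [measurable]: "f \<in> borel_measurable borel" "h \<in> borel_measurable borel"
    and "integrable law (\<lambda>z. (f z)\<^sup>2)" "integrable law (\<lambda>z. (h z)\<^sup>2)"
  shows "integrable law (\<lambda>z. ((f z + h z) / 2)\<^sup>2)"
proof (rule Bochner_Integration.integrable_bound)
  show "integrable law (\<lambda>z. ((f z)\<^sup>2 + (h z)\<^sup>2) / 2)" using assms by simp
  show "AE z in law. norm (((f z + h z) / 2)\<^sup>2) \<le> norm (((f z)\<^sup>2 + (h z)\<^sup>2) / 2)"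
    using square_mean_le by (intro AE_I2) (simp add: abs_of_nonneg)
qed measurable

lemma g_square_integrable: "integrable law (\<lambda>z. (g z)\<^sup>2)"
  and g_smooth_square_integrable: "integrable law (\<lambda>z. (g_smooth e z)\<^sup>2)"
  unfolding g_def g_smooth_def
  by (intro integrable_square_mean density_square_integrable smoothing_square_integrable; measurable)+

lemma g_error_square_integrable: "integrable law (\<lambda>z. (g_smooth e z - g z)\<^sup>2)"
  by (intro integrable_square_diff g_smooth_square_integrable g_square_integrable) measurable

text \<open>
  The bias is the mean of the smoothing error, so Jensen's inequality applies.
\<close>
lemma bias_square_le: "(\<theta> e - q)\<^sup>2 \<le> smoothing_mse e"
proof -
  have "integrable law (\<lambda>z. g_smooth e z - g z)" using integrable_g_smooth integrable_g by simp
  from law.variance_eq[OF this g_error_square_integrable] law.variance_positive[of "\<lambda>z. g_smooth e z - g z"]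
  show ?thesis
    using integrable_g_smooth integrable_g by (simp add: smoothing_mse_def integral_g integral_g_smooth)
qed

lemma smoothing_mse_le:
  "smoothing_mse e \<le> ((\<integral>z. (smoothing e pY (u z) - pY (u z))\<^sup>2 \<partial>law) + (\<integral>z. (smoothing e pX (v z) - pX (v z))\<^sup>2 \<partial>law)) / 2"
proof -
  have "smoothing_mse e \<le> (\<integral>z. ((smoothing e pY (u z) - pY (u z))\<^sup>2 + (smoothing e pX (v z) - pX (v z))\<^sup>2) / 2 \<partial>law)"
    unfolding smoothing_mse_def
  proof (rule integral_mono[OF g_error_square_integrable])
    show "(g_smooth e z - g z)\<^sup>2 \<le> ((smoothing e pY (u z) - pY (u z))\<^sup>2 + (smoothing e pX (v z) - pX (v z))\<^sup>2) / 2" for z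
      using square_mean_le[of "smoothing e pY (u z) - pY (u z)" "smoothing e pX (v z) - pX (v z)"]
      by (simp add: g_def g_smooth_def add_diff_add diff_divide_distrib[symmetric])
  qed (use error_square_integrable[of e] in simp)
  also have "\<dots> = ((\<integral>z. (smoothing e pY (u z) - pY (u z))\<^sup>2 \<partial>law) + (\<integral>z. (smoothing e pX (v z) - pX (v z))\<^sup>2 \<partial>law)) / 2"
    using error_square_integrable[of e] by simp
  finally show ?thesis .
qed

lemma smoothing_mse_tendsto_0: "(smoothing_mse \<longlongrightarrow> 0) (at_right 0)"
proof (rule order_tendstoI)
  fix a :: real assume "a < 0"
  moreover have "0 \<le> smoothing_mse e" for e by (simp add: smoothing_mse_def)
  ultimately show "\<forall>\<^sub>F e in at_right 0. a < smoothing_mse e"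
    by (intro always_eventually allI) (rule less_le_trans)
next
  fix a :: real assume a: "0 < a"
  hence a2: "0 < a / 2" by simp
  obtain d1 where d1: "0 < d1" "\<And>e. 0 < e \<Longrightarrow> e < d1 \<Longrightarrow> (\<integral>z. (smoothing e pY (u z) - pY (u z))\<^sup>2 \<partial>law) \<le> a / 2"
    using law_smoothing_error_tendsto_0[OF u density_u pX_L3 pY_L3 a2 error_square_integrable(1)] by blast
  obtain d2 where d2: "0 < d2" "\<And>e. 0 < e \<Longrightarrow> e < d2 \<Longrightarrow> (\<integral>z. (smoothing e pX (v z) - pX (v z))\<^sup>2 \<partial>law) \<le> a / 2"
    using law_smoothing_error_tendsto_0[OF v density_v pY_L3 pX_L3 a2 error_square_integrable(2)] by blast
  have "smoothing_mse e < a" if e: "0 < e" "e < min d1 d2" for e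
  proof -
    have "smoothing_mse e \<le> (a / 2 + a / 2) / 2"
      by (rule order.trans[OF smoothing_mse_le]) (intro divide_right_mono add_mono d1(2) d2(2); use e in simp)
    thus ?thesis using a by simp
  qed
  thus "\<forall>\<^sub>F e in at_right 0. smoothing_mse e < a"
    unfolding eventually_at_right_field using d1(1) d2(1) by (intro exI[of _ "min d1 d2"]) auto
qed

lemma bias_H2:
  assumes "pX \<in> H2 \<alpha> K" "pY \<in> H2 \<alpha> K" "0 < K" "0 < \<alpha>" "0 < e" "e \<le> 1"
  shows "\<bar>\<theta> e - q\<bar> \<le> (K * e powr \<alpha>)\<^sup>2"
  unfolding \<theta>_lborel q_def by (rule smoothing_bias_H2[OF assms])

end

section \<open>Decomposition of the estimation error\<close>

lemma square_sum4_le: "(a + b + c + d)\<^sup>2 \<le> 4 * (a\<^sup>2 + b\<^sup>2 + c\<^sup>2 + d\<^sup>2)" for a b c d :: real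
proof -
  have "4 * (a\<^sup>2 + b\<^sup>2 + c\<^sup>2 + d\<^sup>2) - (a + b + c + d)\<^sup>2 =
      (a - b)\<^sup>2 + (a - c)\<^sup>2 + (a - d)\<^sup>2 + (b - c)\<^sup>2 + (b - d)\<^sup>2 + (c - d)\<^sup>2"
    by (simp add: power2_eq_square algebra_simps)
  moreover have "0 \<le> \<dots>" by simp
  ultimately show ?thesis by linarith
qed

text \<open>
  The free parameter \<open>s\<close> does the work of the Cauchy-Schwarz inequality: \<open>s = 1\<close> compares orders
  of magnitude, and letting \<open>s\<close> tend to \<open>0\<close> gives the exact constant of the leading term.
\<close>
lemma (in prob_space) expectation_square_perturbation:
  fixes U V :: "'a \<Rightarrow> real"
  assumes [measurable]: "U \<in> borel_measurable M" "V \<in> borel_measurable M"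
    and U: "integrable M (\<lambda>\<omega>. (U \<omega>)\<^sup>2)" and V: "integrable M (\<lambda>\<omega>. (V \<omega>)\<^sup>2)" and s: "0 < s"
  shows "\<bar>expectation (\<lambda>\<omega>. (U \<omega> + V \<omega>)\<^sup>2) - expectation (\<lambda>\<omega>. (U \<omega>)\<^sup>2)\<bar>
    \<le> s * expectation (\<lambda>\<omega>. (U \<omega>)\<^sup>2) + (1 + 1 / s) * expectation (\<lambda>\<omega>. (V \<omega>)\<^sup>2)"
proof -
  have UV: "integrable M (\<lambda>\<omega>. U \<omega> * V \<omega>)" using U V by (intro integrable_mult_of_square_integrable) auto
  have eq: "(U \<omega> + V \<omega>)\<^sup>2 = (U \<omega>)\<^sup>2 + (2 * (U \<omega> * V \<omega>) + (V \<omega>)\<^sup>2)" for \<omega>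
    by (simp add: power2_sum)
  have "expectation (\<lambda>\<omega>. (U \<omega> + V \<omega>)\<^sup>2) - expectation (\<lambda>\<omega>. (U \<omega>)\<^sup>2)
      = expectation (\<lambda>\<omega>. 2 * (U \<omega> * V \<omega>) + (V \<omega>)\<^sup>2)"
    unfolding eq using U V UV by simp
  also have "\<bar>\<dots>\<bar> \<le> expectation (\<lambda>\<omega>. \<bar>2 * (U \<omega> * V \<omega>) + (V \<omega>)\<^sup>2\<bar>)"
    by (rule integral_abs_bound)
  also have "\<dots> \<le> expectation (\<lambda>\<omega>. s * (U \<omega>)\<^sup>2 + (1 + 1 / s) * (V \<omega>)\<^sup>2)"
  proof (rule integral_mono)
    fix \<omega>
    have "2 * (sqrt s * \<bar>U \<omega>\<bar>) * (\<bar>V \<omega>\<bar> / sqrt s) \<le> (sqrt s * \<bar>U \<omega>\<bar>)\<^sup>2 + (\<bar>V \<omega>\<bar> / sqrt s)\<^sup>2"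
      by (rule sum_squares_bound)
    hence "\<bar>2 * (U \<omega> * V \<omega>)\<bar> \<le> s * (U \<omega>)\<^sup>2 + (V \<omega>)\<^sup>2 / s"
      using s by (simp add: power_mult_distrib power_divide abs_mult)
    moreover have "\<bar>2 * (U \<omega> * V \<omega>) + (V \<omega>)\<^sup>2\<bar> \<le> \<bar>2 * (U \<omega> * V \<omega>)\<bar> + (V \<omega>)\<^sup>2"
      using abs_triangle_ineq[of "2 * (U \<omega> * V \<omega>)" "(V \<omega>)\<^sup>2"] by simp
    ultimately show "\<bar>2 * (U \<omega> * V \<omega>) + (V \<omega>)\<^sup>2\<bar> \<le> s * (U \<omega>)\<^sup>2 + (1 + 1 / s) * (V \<omega>)\<^sup>2"
      by (simp add: distrib_right)
  qed (use U V UV in auto)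
  also have "\<dots> = s * expectation (\<lambda>\<omega>. (U \<omega>)\<^sup>2) + (1 + 1 / s) * expectation (\<lambda>\<omega>. (V \<omega>)\<^sup>2)"
    using U V by simp
  finally show ?thesis .
qed

context density_pair
begin

definition estimator :: "nat \<Rightarrow> real \<Rightarrow> nat \<Rightarrow> 'w \<Rightarrow> real" where
  "estimator mn e n \<omega> = (\<Sum>(i, j)\<in>idx11 mn n. kernel e (Z i \<omega>, Z j \<omega>)) / real (card (idx11 mn n))"

lemma estimator_eq_Q11:
  "Q11 (\<lambda>i \<omega>. u (Z i \<omega>)) (\<lambda>i \<omega>. v (Z i \<omega>)) mn e n \<omega> / ball_volume TYPE('a) e = estimator mn e n \<omega>"
proof -
  have "(\<Sum>(i, j)\<in>idx11 mn n. kernel e (Z i \<omega>, Z j \<omega>)) =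
      (\<Sum>(i, j)\<in>idx11 mn n. of_bool (dist (u (Z i \<omega>)) (v (Z j \<omega>)) \<le> e)) / ball_volume TYPE('a) e"
    unfolding kernel_def split_beta fst_conv snd_conv sum_divide_distrib ..
  thus ?thesis unfolding Q11_def estimator_def card_idx11 by simp
qed

definition linear_part :: "nat \<Rightarrow> 'w \<Rightarrow> real" where
  "linear_part n \<omega> = 2 / real n * (\<Sum>i=1..n. g (Z i \<omega>) - q)"

definition remainder :: "nat \<Rightarrow> real \<Rightarrow> nat \<Rightarrow> 'w \<Rightarrow> real" where
  "remainder mn e n \<omega> = estimator mn e n \<omega> - q - linear_part n \<omega>"

lemma centred_g: "centred_linear_sum M m Z (\<lambda>z. g z - q)"
proof
  show "integrable law (\<lambda>z. (g z - q)\<^sup>2)"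
    by (rule integrable_square_diff) (use g_square_integrable in auto)
  show "(\<integral>z. g z - q \<partial>law) = 0"
    using integrable_g law.prob_space by (simp add: integral_g)
qed measurable

lemma centred_g_error: "centred_linear_sum M m Z (\<lambda>z. g_smooth e z - \<theta> e - (g z - q))"
proof
  show "integrable law (\<lambda>z. (g_smooth e z - \<theta> e - (g z - q))\<^sup>2)"
    by (intro integrable_square_diff g_square_integrable g_smooth_square_integrable) auto
  show "(\<integral>z. g_smooth e z - \<theta> e - (g z - q) \<partial>law) = 0"
    using integrable_g integrable_g_smooth[of e] law.prob_space by (simp add: integral_g integral_g_smooth)
qed measurable

sublocale g_sum: centred_linear_sum M m Z "\<lambda>z. g z - q" by (rule centred_g)

lemma centred_g_error_le: "(\<integral>z. (g_smooth e z - \<theta> e - (g z - q))\<^sup>2 \<partial>law) \<le> smoothing_mse e"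
proof -
  have int: "integrable law (\<lambda>z. g_smooth e z - g z)" using integrable_g_smooth integrable_g by simp
  have "(\<integral>z. (g_smooth e z - \<theta> e - (g z - q))\<^sup>2 \<partial>law) = law.variance (\<lambda>z. g_smooth e z - g z)"
    using integrable_g_smooth[of e] integrable_g by (simp add: integral_g integral_g_smooth algebra_simps)
  also have "\<dots> \<le> smoothing_mse e"
    using law.variance_eq[OF int g_error_square_integrable] by (simp add: smoothing_mse_def)
  finally show ?thesis .
qed

text \<open>
  The sum of the Hoeffding remainders of the kernel over the index set.
\<close>
definition degenerate_part :: "nat \<Rightarrow> real \<Rightarrow> nat \<Rightarrow> 'w \<Rightarrow> real" where
  "degenerate_part mn e n \<omega> = (\<Sum>(i, j)\<in>idx11 mn n.
     kernel e (Z i \<omega>, Z j \<omega>) - smoothing e pY (u (Z i \<omega>)) - smoothing e pX (v (Z j \<omega>)) + \<theta> e)"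

text \<open>
  The cardinality \<open>N\<close> is the sum of the row counts \<open>w\<^sub>i\<close>, which makes the constant term exactly
  \<open>\<theta>\<close>. The linear term with weights \<open>2 w\<^sub>i / N\<close> is compared with the linear part in two steps:
  first the smoothed densities are replaced, then the weights.
\<close>
lemma remainder_decomposition:
  fixes mn n :: nat
  defines "N \<equiv> real (card (idx11 mn n))"
  assumes N: "0 < N"
  shows "remainder mn e n \<omega> = (\<theta> e - q)
    + (\<Sum>i=1..n. 2 * real (row_count mn n i) / N * (g_smooth e (Z i \<omega>) - \<theta> e - (g (Z i \<omega>) - q)))
    + (\<Sum>i=1..n. (2 * real (row_count mn n i) / N - 2 / real n) * (g (Z i \<omega>) - q))
    + degenerate_part mn e n \<omega> / N"
proof -
  let ?A = "\<lambda>i. smoothing e pY (u (Z i \<omega>))" and ?B = "\<lambda>i. smoothing e pX (v (Z i \<omega>))"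
  let ?w = "\<lambda>i. real (row_count mn n i)"
  have "(\<Sum>(i, j)\<in>idx11 mn n. kernel e (Z i \<omega>, Z j \<omega>))
      = degenerate_part mn e n \<omega> + (\<Sum>(i, j)\<in>idx11 mn n. ?A i + ?B j) - N * \<theta> e"
    unfolding degenerate_part_def N_def by (simp add: split_beta sum.distrib sum_subtractf)
  also have "(\<Sum>(i, j)\<in>idx11 mn n. ?A i + ?B j) = (\<Sum>i=1..n. ?w i * (2 * (g_smooth e (Z i \<omega>) - \<theta> e))) + 2 * N * \<theta> e"
  proof -
    have "2 * N * \<theta> e = (\<Sum>i=1..n. ?w i * (2 * \<theta> e))"
      unfolding N_def row_count_sum[symmetric] sum_distrib_right[symmetric] by simp
    moreover have "?w i * (?A i + ?B i) = ?w i * (2 * (g_smooth e (Z i \<omega>) - \<theta> e)) + ?w i * (2 * \<theta> e)" for i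
      by (simp add: g_smooth_def algebra_simps)
    ultimately show ?thesis
      unfolding sum_idx11_additive by (simp only: sum.distrib)
  qed
  finally have "estimator mn e n \<omega> = (degenerate_part mn e n \<omega> + (\<Sum>i=1..n. ?w i * (2 * (g_smooth e (Z i \<omega>) - \<theta> e))) + N * \<theta> e) / N"
    unfolding estimator_def N_def[symmetric] by simp
  hence "estimator mn e n \<omega> = degenerate_part mn e n \<omega> / N + (\<Sum>i=1..n. ?w i * (2 * (g_smooth e (Z i \<omega>) - \<theta> e))) / N + \<theta> e"
    using N by (simp add: add_divide_distrib)
  moreover have "(\<Sum>i=1..n. ?w i * (2 * (g_smooth e (Z i \<omega>) - \<theta> e))) / N - linear_part n \<omega> =
      (\<Sum>i=1..n. 2 * ?w i / N * (g_smooth e (Z i \<omega>) - \<theta> e - (g (Z i \<omega>) - q)))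
      + (\<Sum>i=1..n. (2 * ?w i / N - 2 / real n) * (g (Z i \<omega>) - q))"
    unfolding linear_part_def sum_divide_distrib sum_distrib_left sum_subtractf[symmetric] sum.distrib[symmetric]
    by (rule sum.cong) (auto simp: algebra_simps diff_divide_distrib add_divide_distrib)
  ultimately show ?thesis unfolding remainder_def by simp
qed

lemma linear_part_measurable [measurable]: "linear_part n \<in> borel_measurable M"
  unfolding linear_part_def by (intro borel_measurable_times borel_measurable_sum borel_measurable_diff) auto

lemma linear_part_square_integrable: "integrable M (\<lambda>\<omega>. (linear_part n \<omega>)\<^sup>2)"
  using g_sum.weighted_sum_integrable[of "\<lambda>_. 1" n] unfolding linear_part_def power_mult_distrib by simp

lemma linear_part_asymp:
  "(\<lambda>n. real n * expectation (\<lambda>\<omega>. (linear_part n \<omega>)\<^sup>2)) \<longlonglongrightarrow> 4 * g_sum.long_run_variance"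
proof -
  have "real n * expectation (\<lambda>\<omega>. (linear_part n \<omega>)\<^sup>2) =
      4 * (expectation (\<lambda>\<omega>. (\<Sum>i=1..n. g (Z i \<omega>) - q)\<^sup>2) / real n)" for n
    unfolding linear_part_def power_mult_distrib by (simp add: power2_eq_square)
  thus ?thesis using tendsto_mult_left[OF g_sum.second_moment_sum_asymp, of 4] by simp
qed

lemma degenerate_part_square:
  assumes "m \<le> mn"
  shows "integrable M (\<lambda>\<omega>. (degenerate_part mn e n \<omega>)\<^sup>2)" (is ?int)
    and "expectation (\<lambda>\<omega>. (degenerate_part mn e n \<omega>)\<^sup>2)
      \<le> 2 * real ((2 * m + 1)\<^sup>2) * (real n)\<^sup>2 * (\<theta> e / ball_volume TYPE('a) e)" (is ?le)
    and degenerate_part_measurable: "degenerate_part mn e n \<in> borel_measurable M" (is ?meas)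
proof -
  have idx: "idx11 mn n \<subseteq> {1..n} \<times> {1..n}" "\<And>i j. (i, j) \<in> idx11 mn n \<Longrightarrow> gap i j"
    using assms by (auto simp: idx11_altdef)
  show ?le
    using second_moment_hoeffding_remainder[OF kernel_measurable kernel_bound idx, of e]
    unfolding kernel_section_u kernel_section_v kernel_square_integral \<theta>_def[symmetric] degenerate_part_def .
  have term_meas: "(\<lambda>\<omega>. kernel e (Z (fst p) \<omega>, Z (snd p) \<omega>) - smoothing e pY (u (Z (fst p) \<omega>))
      - smoothing e pX (v (Z (snd p) \<omega>)) + \<theta> e) \<in> borel_measurable M" if "p \<in> idx11 mn n" for p
  proof -
    have [measurable]: "Z (fst p) \<in> borel_measurable M" "Z (snd p) \<in> borel_measurable M"
      using idx(1) that by (auto intro!: measurable_Z)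
    show ?thesis by measurable
  qed
  show meas: ?meas
    unfolding degenerate_part_def split_beta by (intro borel_measurable_sum term_meas)
  show ?int
  proof (rule integrable_const_bound)
    let ?b = "1 / ball_volume TYPE('a) e"
    let ?C = "real (card (idx11 mn n)) * (3 * ?b + \<bar>\<theta> e\<bar>)"
    have "\<bar>degenerate_part mn e n \<omega>\<bar> \<le> ?C" for \<omega>
      unfolding degenerate_part_def split_beta
    proof (rule order.trans[OF sum_abs sum_bounded_above])
      fix p
      show "\<bar>kernel e (Z (fst p) \<omega>, Z (snd p) \<omega>) - smoothing e pY (u (Z (fst p) \<omega>))
          - smoothing e pX (v (Z (snd p) \<omega>)) + \<theta> e\<bar> \<le> 3 * ?b + \<bar>\<theta> e\<bar>"
        using kernel_bound[of e "(Z (fst p) \<omega>, Z (snd p) \<omega>)"] smoothing_bounds[of e "Z (fst p) \<omega>"] smoothing_bounds[of e "Z (snd p) \<omega>"]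
        by linarith
    qed
    hence "(degenerate_part mn e n \<omega>)\<^sup>2 \<le> ?C\<^sup>2" for \<omega>
      using power_mono[of "\<bar>degenerate_part mn e n \<omega>\<bar>" ?C 2] by simp
    thus "AE \<omega> in M. norm ((degenerate_part mn e n \<omega>)\<^sup>2) \<le> ?C\<^sup>2" by simp
  qed (use meas in measurable)
qed

lemma remainder_second_moment:
  fixes mn n :: nat
  defines "N \<equiv> real (card (idx11 mn n))"
  assumes N: "0 < N" and n: "0 < n" and mn: "m \<le> mn"
  shows "remainder mn e n \<in> borel_measurable M" (is ?meas)
    and "integrable M (\<lambda>\<omega>. (remainder mn e n \<omega>)\<^sup>2)" (is ?int)
    and "expectation (\<lambda>\<omega>. (remainder mn e n \<omega>)\<^sup>2) \<le> 4 * ((\<theta> e - q)\<^sup>2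
      + real (2 * m + 1) * (real n * (2 * real n / N)\<^sup>2) * smoothing_mse e
      + real (2 * m + 1) * (real n * (2 / real n * (\<bar>(real n)\<^sup>2 / N - 1\<bar> + real n * real (2 * mn + 1) / N))\<^sup>2)
          * (\<integral>z. (g z - q)\<^sup>2 \<partial>law)
      + 2 * real ((2 * m + 1)\<^sup>2) * ((real n)\<^sup>2 / N\<^sup>2) * (\<theta> e / ball_volume TYPE('a) e))" (is ?bound)
proof -
  interpret g_error: centred_linear_sum M m Z "\<lambda>z. g_smooth e z - \<theta> e - (g z - q)"
    by (rule centred_g_error)
  define c1 where "c1 i = 2 * real (row_count mn n i) / N" for i
  define c2 where "c2 i = 2 * real (row_count mn n i) / N - 2 / real n" for i
  define S1 where "S1 \<omega> = (\<Sum>i=1..n. c1 i * (g_smooth e (Z i \<omega>) - \<theta> e - (g (Z i \<omega>) - q)))" for \<omega>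
  define S2 where "S2 \<omega> = (\<Sum>i=1..n. c2 i * (g (Z i \<omega>) - q))" for \<omega>
  define R where "R \<omega> = degenerate_part mn e n \<omega> / N" for \<omega>
  define \<kappa> where "\<kappa> = 2 / real n * (\<bar>(real n)\<^sup>2 / N - 1\<bar> + real n * real (2 * mn + 1) / N)"
  have decomp: "remainder mn e n \<omega> = (\<theta> e - q) + S1 \<omega> + S2 \<omega> + R \<omega>" for \<omega>
    using remainder_decomposition[of mn n e \<omega>] N unfolding N_def S1_def S2_def R_def c1_def c2_def by simp
  have Z_meas: "(\<lambda>\<omega>. f (Z i \<omega>)) \<in> borel_measurable M" if "i \<in> {1..n}" "f \<in> borel_measurable borel" for i and f :: "'b \<Rightarrow> real"
    using that by (intro measurable_compose[OF measurable_Z]) auto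
  have S_meas [measurable]: "S1 \<in> borel_measurable M" "S2 \<in> borel_measurable M" "R \<in> borel_measurable M"
    unfolding S1_def S2_def R_def
    using degenerate_part_measurable[OF mn, of e n]
    by (intro borel_measurable_sum borel_measurable_times borel_measurable_const borel_measurable_divide Z_meas; simp)+
  show meas: ?meas
    unfolding decomp[abs_def] by measurable
  have ints: "integrable M (\<lambda>\<omega>. (S1 \<omega>)\<^sup>2)" "integrable M (\<lambda>\<omega>. (S2 \<omega>)\<^sup>2)" "integrable M (\<lambda>\<omega>. (R \<omega>)\<^sup>2)"
  proof -
    show "integrable M (\<lambda>\<omega>. (S1 \<omega>)\<^sup>2)" unfolding S1_def by (rule g_error.weighted_sum_integrable)
    show "integrable M (\<lambda>\<omega>. (S2 \<omega>)\<^sup>2)" unfolding S2_def by (rule g_sum.weighted_sum_integrable)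
    show "integrable M (\<lambda>\<omega>. (R \<omega>)\<^sup>2)"
      unfolding R_def power_divide using degenerate_part_square(1)[OF mn, of e n] by simp
  qed
  have bound_int: "integrable M (\<lambda>\<omega>. 4 * ((\<theta> e - q)\<^sup>2 + (S1 \<omega>)\<^sup>2 + (S2 \<omega>)\<^sup>2 + (R \<omega>)\<^sup>2))"
    using ints by simp
  have le: "(remainder mn e n \<omega>)\<^sup>2 \<le> 4 * ((\<theta> e - q)\<^sup>2 + (S1 \<omega>)\<^sup>2 + (S2 \<omega>)\<^sup>2 + (R \<omega>)\<^sup>2)" for \<omega>
    unfolding decomp by (rule square_sum4_le)
  show int: ?int
    by (rule Bochner_Integration.integrable_bound[OF bound_int])
       (use le meas in \<open>auto intro: order.trans[OF _ abs_ge_self]\<close>)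
  have "(\<Sum>i=1..n. (c1 i)\<^sup>2) \<le> (\<Sum>i=1..n. (2 * real n / N)\<^sup>2)"
    using row_count_bounds(1)[of mn n] N unfolding c1_def
    by (intro sum_mono power_mono divide_right_mono) auto
  hence c1: "(\<Sum>i=1..n. (c1 i)\<^sup>2) \<le> real n * (2 * real n / N)\<^sup>2" by simp
  have "(\<Sum>i=1..n. (c2 i)\<^sup>2) \<le> (\<Sum>i=1..n. \<kappa>\<^sup>2)"
  proof (rule sum_mono)
    fix i
    have "\<bar>c2 i\<bar> \<le> \<kappa>" unfolding c2_def \<kappa>_def by (rule row_count_deviation[OF N n])
    from power_mono[OF this abs_ge_zero, of 2] show "(c2 i)\<^sup>2 \<le> \<kappa>\<^sup>2" by simp
  qed
  hence c2: "(\<Sum>i=1..n. (c2 i)\<^sup>2) \<le> real n * \<kappa>\<^sup>2" by simp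
  have E1: "expectation (\<lambda>\<omega>. (S1 \<omega>)\<^sup>2) \<le> real (2 * m + 1) * (real n * (2 * real n / N)\<^sup>2) * smoothing_mse e"
    unfolding S1_def
    by (rule order.trans[OF g_error.second_moment_weighted_sum])
       (intro mult_mono mult_left_mono c1 centred_g_error_le; simp)
  have E2: "expectation (\<lambda>\<omega>. (S2 \<omega>)\<^sup>2) \<le> real (2 * m + 1) * (real n * \<kappa>\<^sup>2) * (\<integral>z. (g z - q)\<^sup>2 \<partial>law)"
    unfolding S2_def
    by (rule order.trans[OF g_sum.second_moment_weighted_sum])
       (intro mult_right_mono mult_left_mono c2; simp)
  have "expectation (\<lambda>\<omega>. (R \<omega>)\<^sup>2) = expectation (\<lambda>\<omega>. (degenerate_part mn e n \<omega>)\<^sup>2) / N\<^sup>2"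
    unfolding R_def power_divide by simp
  also have "\<dots> \<le> 2 * real ((2 * m + 1)\<^sup>2) * (real n)\<^sup>2 * (\<theta> e / ball_volume TYPE('a) e) / N\<^sup>2"
    by (intro divide_right_mono degenerate_part_square(2) mn) simp
  finally have E3: "expectation (\<lambda>\<omega>. (R \<omega>)\<^sup>2) \<le> 2 * real ((2 * m + 1)\<^sup>2) * ((real n)\<^sup>2 / N\<^sup>2) * (\<theta> e / ball_volume TYPE('a) e)"
    by (simp add: mult.commute)
  have "expectation (\<lambda>\<omega>. (remainder mn e n \<omega>)\<^sup>2) \<le> expectation (\<lambda>\<omega>. 4 * ((\<theta> e - q)\<^sup>2 + (S1 \<omega>)\<^sup>2 + (S2 \<omega>)\<^sup>2 + (R \<omega>)\<^sup>2))"
    by (rule integral_mono[OF int bound_int le])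
  also have "\<dots> = 4 * ((\<theta> e - q)\<^sup>2 + expectation (\<lambda>\<omega>. (S1 \<omega>)\<^sup>2) + expectation (\<lambda>\<omega>. (S2 \<omega>)\<^sup>2) + expectation (\<lambda>\<omega>. (R \<omega>)\<^sup>2))"
    using ints prob_space by simp
  finally show ?bound
    unfolding \<kappa>_def[symmetric]
    by (rule order.trans) (intro mult_left_mono add_mono E1 E2 E3; simp)
qed

lemma estimator_mse_perturbation:
  assumes "0 < card (idx11 mn n)" "0 < n" "m \<le> mn" "0 < s"
  shows "\<bar>mean_square_error M (estimator mn e n) q - expectation (\<lambda>\<omega>. (linear_part n \<omega>)\<^sup>2)\<bar>
    \<le> s * expectation (\<lambda>\<omega>. (linear_part n \<omega>)\<^sup>2) + (1 + 1 / s) * expectation (\<lambda>\<omega>. (remainder mn e n \<omega>)\<^sup>2)"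
proof -
  have "mean_square_error M (estimator mn e n) q = expectation (\<lambda>\<omega>. (linear_part n \<omega> + remainder mn e n \<omega>)\<^sup>2)"
    unfolding mean_square_error_def remainder_def by simp
  thus ?thesis
    using expectation_square_perturbation[OF linear_part_measurable _ linear_part_square_integrable _ assms(4)]
      remainder_second_moment(1,2)[of mn n e] assms by simp
qed

end

section \<open>From error bounds to rates of convergence\<close>

lemma asymp_equiv_sandwich_const:
  fixes f h :: "nat \<Rightarrow> real"
  assumes "f \<sim>[sequentially] h" "\<forall>\<^sub>F n in sequentially. 0 < h n"
  shows "\<forall>\<^sub>F n in sequentially. h n / 2 \<le> f n \<and> f n \<le> 2 * h n"
proof -
  have lim: "((\<lambda>n. if f n = 0 \<and> h n = 0 then 1 else f n / h n) \<longlongrightarrow> 1) sequentially"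
    using assms(1) by (simp add: asymp_equiv_def)
  have "\<forall>\<^sub>F n in sequentially. 1 / 2 < (if f n = 0 \<and> h n = 0 then 1 else f n / h n)"
    "\<forall>\<^sub>F n in sequentially. (if f n = 0 \<and> h n = 0 then 1 else f n / h n) < 2"
    by (rule order_tendstoD[OF lim]; simp)+
  thus ?thesis using assms(2)
    by eventually_elim (auto simp: field_simps)
qed

lemma square_le_powr:
  fixes e :: real
  assumes "\<bar>x\<bar> \<le> (K * e powr \<alpha>)\<^sup>2" "0 < e"
  shows "x\<^sup>2 \<le> K ^ 4 * e powr (4 * \<alpha>)"
proof -
  have "x\<^sup>2 \<le> ((K * e powr \<alpha>)\<^sup>2)\<^sup>2"
    using power_mono[OF assms(1), of 2] by simp
  also have "\<dots> = K ^ 4 * (e powr \<alpha>) ^ 4"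
    by (simp add: power_mult_distrib flip: power_mult)
  also have "(e powr \<alpha>) ^ 4 = e powr (4 * \<alpha>)"
    using assms(2) powr_power[of e \<alpha> 4] by simp
  finally show ?thesis .
qed

lemma tendsto_0_of_scaled:
  fixes f :: "nat \<Rightarrow> real"
  assumes "(\<lambda>n. real n * f n) \<longlonglongrightarrow> c"
  shows "f \<longlonglongrightarrow> 0"
proof -
  have "(\<lambda>n. real n * f n * (1 / real n)) \<longlonglongrightarrow> c * 0"
    by (intro tendsto_intros assms lim_1_over_n)
  moreover have "\<forall>\<^sub>F n in sequentially. real n * f n * (1 / real n) = f n"
    using eventually_gt_at_top[of 0] by eventually_elim simp
  ultimately show ?thesis using Lim_transform_eventually by fastforce
qed

text \<open>
  The analytic information about the mean square error that determines its rate. \<open>A\<close> is the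
  second moment of the linear part and \<open>D\<close> that of the remainder; the latter splits into the
  squared bias \<open>b\<close>, a negligible term \<open>V\<close>, and a degenerate term with coefficient \<open>W\<close>.
\<close>
locale mse_expansion =
  fixes mse A D b V W eps :: "nat \<Rightarrow> real" and \<tau> w :: real and d :: nat
  assumes mse_nonneg: "\<And>n. 0 \<le> mse n" and A_nonneg: "\<And>n. 0 \<le> A n" and D_nonneg: "\<And>n. 0 \<le> D n"
    and perturbation: "\<forall>\<^sub>F n in sequentially. \<forall>s>0. \<bar>mse n - A n\<bar> \<le> s * A n + (1 + 1 / s) * D n"
    and main_term: "(\<lambda>n. real n * A n) \<longlonglongrightarrow> \<tau>"
    and D_le: "\<forall>\<^sub>F n in sequentially. D n \<le> 4 * ((b n)\<^sup>2 + V n + W n / ((real n)\<^sup>2 * eps n ^ d))"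
    and bias: "b \<longlonglongrightarrow> 0" and V_small: "(\<lambda>n. real n * V n) \<longlonglongrightarrow> 0" and W_lim: "W \<longlonglongrightarrow> w"
    and eps_pos: "\<forall>\<^sub>F n in sequentially. 0 < eps n"
    and d: "0 < d"
begin

lemma mse_le: "\<forall>\<^sub>F n in sequentially. mse n \<le> 2 * A n + 2 * D n"
  using perturbation
proof eventually_elim
  case (elim n)
  hence "\<bar>mse n - A n\<bar> \<le> 1 * A n + (1 + 1 / 1) * D n" using zero_less_one by blast
  thus ?case by simp
qed

lemma A_tendsto_0: "A \<longlonglongrightarrow> 0" and V_tendsto_0: "V \<longlonglongrightarrow> 0"
  using main_term V_small by (auto intro: tendsto_0_of_scaled)

lemma consistency:
  assumes "filterlim (\<lambda>n. (real n)\<^sup>2 * eps n ^ d) at_top sequentially"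
  shows "mse \<longlonglongrightarrow> 0"
proof -
  have "(\<lambda>n. W n / ((real n)\<^sup>2 * eps n ^ d)) \<longlonglongrightarrow> 0"
    using W_lim assms by (rule real_tendsto_divide_at_top)
  hence "(\<lambda>n. 4 * ((b n)\<^sup>2 + V n + W n / ((real n)\<^sup>2 * eps n ^ d))) \<longlonglongrightarrow> 4 * (0\<^sup>2 + 0 + 0)"
    by (intro tendsto_intros bias V_tendsto_0)
  hence lim: "(\<lambda>n. 4 * ((b n)\<^sup>2 + V n + W n / ((real n)\<^sup>2 * eps n ^ d))) \<longlonglongrightarrow> 0" by simp
  have D_lim: "D \<longlonglongrightarrow> 0"
    by (rule tendsto_sandwich[OF _ D_le tendsto_const lim]) (simp add: D_nonneg)
  have "(\<lambda>n. 2 * A n + 2 * D n) \<longlonglongrightarrow> 2 * 0 + 2 * 0"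
    by (intro tendsto_intros A_tendsto_0 D_lim)
  hence lim2: "(\<lambda>n. 2 * A n + 2 * D n) \<longlonglongrightarrow> 0" by simp
  show ?thesis
    by (rule tendsto_sandwich[OF _ mse_le tendsto_const lim2]) (simp add: mse_nonneg)
qed

text \<open>
  The bandwidth balances the two terms: \<open>\<epsilon>\<^sup>4\<^sup>\<alpha>\<close> and \<open>1 / (n\<^sup>2 \<epsilon>\<^sup>d)\<close> are both of the order
  \<open>n\<^sup>-\<^sup>\<rho>\<close> with \<open>\<rho> = 8\<alpha> / (4\<alpha> + d)\<close>. The condition \<open>\<alpha> \<le> d/4\<close> says \<open>\<rho> \<le> 1\<close>, so the terms of
  order \<open>1/n\<close> do not exceed this rate.
\<close>
lemma rate_below_root_n:
  assumes \<alpha>: "0 < \<alpha>" "\<alpha> \<le> real d / 4" and c: "0 < c" and K: "0 < K"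
    and bias_le: "\<forall>\<^sub>F n in sequentially. \<bar>b n\<bar> \<le> (K * eps n powr \<alpha>)\<^sup>2"
    and eps: "eps \<sim>[sequentially] (\<lambda>n. c * real n powr (- 2 / (4 * \<alpha> + real d)))"
  shows "mse \<in> O(\<lambda>n. real n powr (- 8 * \<alpha> / (4 * \<alpha> + real d)))"
proof -
  define \<beta> where "\<beta> = 2 / (4 * \<alpha> + real d)"
  define \<rho> where "\<rho> = 8 * \<alpha> / (4 * \<alpha> + real d)"
  have \<beta>: "0 < \<beta>" using \<alpha> d by (simp add: \<beta>_def)
  have \<rho>_le: "\<rho> \<le> 1" using \<alpha> d by (simp add: \<rho>_def field_simps)
  have \<rho>1: "\<beta> * (4 * \<alpha>) = \<rho>" by (simp add: \<beta>_def \<rho>_def)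
  have \<rho>2: "\<beta> * real d = 2 - \<rho>" using \<alpha> d by (simp add: \<beta>_def \<rho>_def field_simps)
  have eps_bounds: "\<forall>\<^sub>F n in sequentially. c * real n powr (- \<beta>) / 2 \<le> eps n \<and> eps n \<le> 2 * (c * real n powr (- \<beta>))"
  proof (rule asymp_equiv_sandwich_const)
    show "eps \<sim>[sequentially] (\<lambda>n. c * real n powr (- \<beta>))" using eps by (simp add: \<beta>_def)
    show "\<forall>\<^sub>F n in sequentially. 0 < c * real n powr (- \<beta>)"
      using eventually_gt_at_top[of 0] by eventually_elim (simp add: c)
  qed
  have A_le: "\<forall>\<^sub>F n in sequentially. real n * A n < \<bar>\<tau>\<bar> + 1"
    using main_term by (rule order_tendstoD) linarith
  have V_le: "\<forall>\<^sub>F n in sequentially. real n * V n < 1"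
    using V_small by (rule order_tendstoD) simp
  have W_le: "\<forall>\<^sub>F n in sequentially. W n < \<bar>w\<bar> + 1"
    using W_lim by (rule order_tendstoD) linarith
  define C where "C = 2 * (\<bar>\<tau>\<bar> + 1) + 8 * (K ^ 4 * (2 * c) powr (4 * \<alpha>) + 1 + (\<bar>w\<bar> + 1) * (2 / c) ^ d)"
  have "\<forall>\<^sub>F n in sequentially. norm (mse n) \<le> C * norm (real n powr (- \<rho>))"
    using eventually_gt_at_top[of 0] eps_bounds A_le V_le W_le D_le mse_le bias_le eps_pos
  proof eventually_elim
    case (elim n)
    define r where "r = real n powr (- \<rho>)"
    have n: "1 \<le> real n" and r: "0 < r" using elim(1) by (auto simp: r_def)
    have inv_n: "1 / real n \<le> r"
      using n powr_mono[of "- 1" "- \<rho>" "real n"] \<rho>_le by (simp add: r_def powr_minus_divide)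
    have "A n \<le> (\<bar>\<tau>\<bar> + 1) * (1 / real n)" using elim(3) n by (simp add: field_simps)
    also have "\<dots> \<le> (\<bar>\<tau>\<bar> + 1) * r" using inv_n by (intro mult_left_mono) auto
    finally have A: "A n \<le> (\<bar>\<tau>\<bar> + 1) * r" .
    have "V n \<le> 1 / real n" using elim(4) n by (simp add: field_simps)
    with inv_n have V: "V n \<le> r" by linarith
    have "(b n)\<^sup>2 \<le> K ^ 4 * eps n powr (4 * \<alpha>)"
      by (rule square_le_powr[OF elim(8,9)])
    also have "\<dots> \<le> K ^ 4 * (2 * (c * real n powr (- \<beta>))) powr (4 * \<alpha>)"
      using elim(2,9) \<alpha> K by (intro mult_left_mono powr_mono2) auto
    also have "\<dots> = K ^ 4 * (2 * c) powr (4 * \<alpha>) * r"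
      using c n by (simp add: powr_mult powr_powr r_def \<rho>1[symmetric])
    finally have b: "(b n)\<^sup>2 \<le> K ^ 4 * (2 * c) powr (4 * \<alpha>) * r" .
    have "(c * real n powr (- \<beta>) / 2) ^ d \<le> eps n ^ d"
      using elim(2) c by (intro power_mono) auto
    hence "(real n)\<^sup>2 * (c * real n powr (- \<beta>) / 2) ^ d \<le> (real n)\<^sup>2 * eps n ^ d"
      by (intro mult_left_mono) auto
    moreover have "(real n)\<^sup>2 * (c * real n powr (- \<beta>) / 2) ^ d = (c / 2) ^ d * (1 / r)"
    proof -
      have "(real n powr (- \<beta>)) ^ d = real n powr (- (2 - \<rho>))"
        using n powr_power[of "real n" "- \<beta>" d] by (simp add: \<rho>2[symmetric] mult.commute)
      moreover have "(real n)\<^sup>2 * real n powr (- (2 - \<rho>)) = 1 / r"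
      proof -
        have n2: "(real n)\<^sup>2 = real n powr 2" using n powr_realpow[of "real n" 2] by simp
        have "real n powr 2 * real n powr (- (2 - \<rho>)) = real n powr \<rho>"
          unfolding powr_add[symmetric] by simp
        moreover have "real n powr \<rho> = 1 / r" by (simp add: r_def powr_minus_divide)
        ultimately show ?thesis by (simp only: n2)
      qed
      moreover have "(real n)\<^sup>2 * (c * real n powr (- \<beta>) / 2) ^ d = (c / 2) ^ d * ((real n)\<^sup>2 * (real n powr (- \<beta>)) ^ d)"
        by (simp add: power_mult_distrib power_divide)
      ultimately show ?thesis by (simp only:)
    qed
    ultimately have low: "(c / 2) ^ d * (1 / r) \<le> (real n)\<^sup>2 * eps n ^ d" by simp
    have pos: "0 < (c / 2) ^ d * (1 / r)" using c r by simp
    have "W n / ((real n)\<^sup>2 * eps n ^ d) \<le> (\<bar>w\<bar> + 1) / ((real n)\<^sup>2 * eps n ^ d)"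
      using elim(5) less_le_trans[OF pos low] by (intro divide_right_mono) auto
    also have "\<dots> \<le> (\<bar>w\<bar> + 1) / ((c / 2) ^ d * (1 / r))"
      by (rule divide_left_mono[OF low _ mult_pos_pos[OF less_le_trans[OF pos low] pos]]) simp
    also have "\<dots> = (\<bar>w\<bar> + 1) * (2 / c) ^ d * r"
      using c by (simp add: power_divide)
    finally have W: "W n / ((real n)\<^sup>2 * eps n ^ d) \<le> (\<bar>w\<bar> + 1) * (2 / c) ^ d * r" .
    have "mse n \<le> 2 * ((\<bar>\<tau>\<bar> + 1) * r) + 2 * (4 * (K ^ 4 * (2 * c) powr (4 * \<alpha>) * r + r + (\<bar>w\<bar> + 1) * (2 / c) ^ d * r))"
    proof (rule order.trans[OF elim(7)], intro add_mono mult_left_mono A)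
      show "D n \<le> 4 * (K ^ 4 * (2 * c) powr (4 * \<alpha>) * r + r + (\<bar>w\<bar> + 1) * (2 / c) ^ d * r)"
        by (rule order.trans[OF elim(6)]) (intro mult_left_mono add_mono b V W; simp)
    qed auto
    also have "\<dots> = C * r" by (simp add: C_def algebra_simps)
    finally show ?case using mse_nonneg[of n] r by (simp add: r_def)
  qed
  hence "mse \<in> O(\<lambda>n. real n powr (- \<rho>))" by (rule bigoI)
  thus ?thesis by (simp add: \<rho>_def)
qed

text \<open>
  If the remainder is \<open>o(1/n)\<close>, so is its covariance with the linear part.
\<close>
lemma root_n_expansion:
  assumes nD: "(\<lambda>n. real n * D n) \<longlonglongrightarrow> 0"
  shows "(\<lambda>n. real n * (mse n - A n)) \<longlonglongrightarrow> 0"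
proof (rule LIMSEQ_I)
  fix r :: real assume r: "0 < r"
  \<comment> \<open>Then the first term of the perturbation bound tends to a limit of at most \<open>r / 2\<close>.\<close>
  define s where "s = r / (2 * (\<bar>\<tau>\<bar> + 1))"
  have s: "0 < s" using r by (simp add: s_def)
  have "(\<lambda>n. s * (real n * A n) + (1 + 1 / s) * (real n * D n)) \<longlonglongrightarrow> s * \<tau> + (1 + 1 / s) * 0"
    by (intro tendsto_intros main_term nD)
  moreover have "s * \<tau> < r"
  proof -
    have "s * \<tau> \<le> s * (\<bar>\<tau>\<bar> + 1)" using s by (intro mult_left_mono) auto
    also have "\<dots> = r / 2" by (simp add: s_def field_simps)
    finally show ?thesis using r by linarith
  qed
  ultimately have "\<forall>\<^sub>F n in sequentially. s * (real n * A n) + (1 + 1 / s) * (real n * D n) < r"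
    by (intro order_tendstoD(2)) auto
  hence "\<forall>\<^sub>F n in sequentially. norm (real n * (mse n - A n) - 0) < r"
    using perturbation
  proof eventually_elim
    case (elim n)
    have "\<bar>real n * (mse n - A n)\<bar> = real n * \<bar>mse n - A n\<bar>" by (simp add: abs_mult)
    also have "\<dots> \<le> real n * (s * A n + (1 + 1 / s) * D n)"
      using elim(2) s by (intro mult_left_mono) auto
    also have "\<dots> = s * (real n * A n) + (1 + 1 / s) * (real n * D n)"
      by (simp add: algebra_simps)
    finally show ?case using elim(1) by simp
  qed
  thus "\<exists>no. \<forall>n\<ge>no. norm (real n * (mse n - A n) - 0) < r"
    by (simp add: eventually_sequentially)
qed

text \<open>
  Since \<open>\<alpha> > d/4\<close>, \<open>n \<epsilon>\<^sup>4\<^sup>\<alpha>\<close> is a negative power of \<open>n\<close> times a power of \<open>L(n)\<close>, and slow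
  variation makes the second factor harmless. The degenerate term is \<open>o(1/n)\<close> because
  \<open>n \<epsilon>\<^sup>d\<close> is of the order \<open>L(n)\<^sup>d\<close>.
\<close>
lemma root_n_rate:
  assumes \<alpha>: "real d / 4 < \<alpha>" and K: "0 < K"
    and bias_le: "\<forall>\<^sub>F n in sequentially. \<bar>b n\<bar> \<le> (K * eps n powr \<alpha>)\<^sup>2"
    and L: "slowly_varying L" "filterlim (\<lambda>n. L (real n)) at_top sequentially"
    and eps: "eps \<sim>[sequentially] (\<lambda>n. L (real n) * real n powr (- 1 / real d))"
  shows "(\<lambda>n. mse n - \<tau> / real n) \<in> o(\<lambda>n. 1 / real n)"
proof -
  have \<alpha>0: "0 < \<alpha>" using \<alpha> d by (simp add: order_le_less_trans[of 0 "real d / 4"])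
  \<comment> \<open>With this exponent, \<open>n \<epsilon>\<^sup>4\<^sup>\<alpha>\<close> is at most a constant times \<open>n\<^sup>\<gamma>\<close> with
    \<open>\<gamma> = 1/2 - 2 \<alpha> / d < 0\<close>.\<close>
  define \<delta> where "\<delta> = (1 / real d - 1 / (4 * \<alpha>)) / 2"
  have \<delta>: "0 < \<delta>" using \<alpha> \<alpha>0 d by (simp add: \<delta>_def field_simps)
  define \<gamma> where "\<gamma> = 1 + 4 * \<alpha> * (\<delta> - 1 / real d)"
  have \<gamma>: "\<gamma> < 0" using \<alpha> \<alpha>0 d by (simp add: \<gamma>_def \<delta>_def field_simps)
  obtain C where C: "0 < C" "\<forall>\<^sub>F n in sequentially. \<bar>L (real n)\<bar> \<le> C * real n powr \<delta>"
    using slowly_varying_powr_bound[OF L(1) \<delta>] by blast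
  have L_pos: "\<forall>\<^sub>F n in sequentially. 0 < L (real n)"
    using L(2) by (simp add: filterlim_at_top_dense)
  have eps_bounds: "\<forall>\<^sub>F n in sequentially. L (real n) * real n powr (- 1 / real d) / 2 \<le> eps n
      \<and> eps n \<le> 2 * (L (real n) * real n powr (- 1 / real d))"
  proof (rule asymp_equiv_sandwich_const[OF eps])
    show "\<forall>\<^sub>F n in sequentially. 0 < L (real n) * real n powr (- 1 / real d)"
      using L_pos eventually_gt_at_top[of 0] by eventually_elim simp
  qed
  have nb_lim: "(\<lambda>n. real n * (b n)\<^sup>2) \<longlonglongrightarrow> 0"
  proof (rule tendsto_sandwich[OF _ _ tendsto_const])
    show "\<forall>\<^sub>F n in sequentially. 0 \<le> real n * (b n)\<^sup>2" by simp
    show "\<forall>\<^sub>F n in sequentially. real n * (b n)\<^sup>2 \<le> K ^ 4 * (2 * C) powr (4 * \<alpha>) * real n powr \<gamma>"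
      using eventually_gt_at_top[of 0] eps_bounds bias_le eps_pos C(2)
    proof eventually_elim
      case (elim n)
      have n: "0 < real n" using elim(1) by simp
      have "(b n)\<^sup>2 \<le> K ^ 4 * eps n powr (4 * \<alpha>)"
        by (rule square_le_powr[OF elim(3,4)])
      also have "\<dots> \<le> K ^ 4 * (2 * C * real n powr (\<delta> - 1 / real d)) powr (4 * \<alpha>)"
      proof (intro mult_left_mono powr_mono2)
        have "L (real n) * real n powr (- 1 / real d) \<le> C * real n powr \<delta> * real n powr (- 1 / real d)"
          using elim(5) by (intro mult_right_mono) auto
        also have "\<dots> = C * real n powr (\<delta> - 1 / real d)"
          by (simp add: powr_add[symmetric])
        finally show "eps n \<le> 2 * C * real n powr (\<delta> - 1 / real d)" using elim(2) by simp
      qed (use elim(4) \<alpha>0 in auto)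
      also have "\<dots> = K ^ 4 * (2 * C) powr (4 * \<alpha>) * real n powr (4 * \<alpha> * (\<delta> - 1 / real d))"
        using C(1) by (simp add: powr_mult powr_powr mult.commute)
      finally have "real n * (b n)\<^sup>2 \<le> real n * (K ^ 4 * (2 * C) powr (4 * \<alpha>) * real n powr (4 * \<alpha> * (\<delta> - 1 / real d)))"
        by (intro mult_left_mono) auto
      also have "\<dots> = K ^ 4 * (2 * C) powr (4 * \<alpha>) * (real n powr 1 * real n powr (4 * \<alpha> * (\<delta> - 1 / real d)))"
        using n by simp
      also have "\<dots> = K ^ 4 * (2 * C) powr (4 * \<alpha>) * real n powr \<gamma>"
        unfolding powr_add[symmetric] \<gamma>_def ..
      finally show ?case .
    qed
    have "(\<lambda>n. real n powr \<gamma>) \<longlonglongrightarrow> 0"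
      using \<gamma> filterlim_real_sequentially by (rule tendsto_neg_powr)
    from tendsto_mult_left[OF this, of "K ^ 4 * (2 * C) powr (4 * \<alpha>)"]
    show "(\<lambda>n. K ^ 4 * (2 * C) powr (4 * \<alpha>) * real n powr \<gamma>) \<longlonglongrightarrow> 0" by simp
  qed
  have "filterlim (\<lambda>n. real n * eps n ^ d) at_top sequentially"
  proof (rule filterlim_at_top_mono)
    have "filterlim (\<lambda>n. L (real n) * (1 / 2)) at_top sequentially"
      by (rule filterlim_at_top_mult_tendsto_pos[OF tendsto_const _ L(2)]) simp
    thus "filterlim (\<lambda>n. (L (real n) / 2) ^ d) at_top sequentially"
      using filterlim_pow_at_top[OF d] by simp
    show "\<forall>\<^sub>F n in sequentially. (L (real n) / 2) ^ d \<le> real n * eps n ^ d"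
      using eventually_gt_at_top[of 0] eps_bounds L_pos
    proof eventually_elim
      case (elim n)
      have "(L (real n) / 2) ^ d = real n * (L (real n) * real n powr (- 1 / real d) / 2) ^ d"
      proof -
        have "(real n powr (- 1 / real d)) ^ d = 1 / real n"
          using elim(1) d powr_power[of "real n" "- 1 / real d" d] by (simp add: powr_minus_divide)
        thus ?thesis using elim(1) by (simp add: power_mult_distrib power_divide)
      qed
      also have "\<dots> \<le> real n * eps n ^ d"
        using elim by (intro mult_left_mono power_mono) auto
      finally show ?case .
    qed
  qed
  hence W0: "(\<lambda>n. W n / (real n * eps n ^ d)) \<longlonglongrightarrow> 0"
    using W_lim by (intro real_tendsto_divide_at_top)
  have nD: "(\<lambda>n. real n * D n) \<longlonglongrightarrow> 0"
  proof (rule tendsto_sandwich[OF _ _ tendsto_const])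
    show "\<forall>\<^sub>F n in sequentially. 0 \<le> real n * D n" by (simp add: D_nonneg)
    show "\<forall>\<^sub>F n in sequentially. real n * D n \<le> 4 * (real n * (b n)\<^sup>2 + real n * V n + W n / (real n * eps n ^ d))"
      using D_le eventually_gt_at_top[of 0]
    proof eventually_elim
      case (elim n)
      have "real n * D n \<le> real n * (4 * ((b n)\<^sup>2 + V n + W n / ((real n)\<^sup>2 * eps n ^ d)))"
        by (intro mult_left_mono elim(1)) simp
      also have "\<dots> = 4 * (real n * (b n)\<^sup>2 + real n * V n + W n / (real n * eps n ^ d))"
        using elim(2) by (simp add: distrib_left power2_eq_square)
      finally show ?case .
    qed
    have "(\<lambda>n. 4 * (real n * (b n)\<^sup>2 + real n * V n + W n / (real n * eps n ^ d))) \<longlonglongrightarrow> 4 * (0 + 0 + 0)"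
      by (intro tendsto_intros nb_lim V_small W0)
    thus "(\<lambda>n. 4 * (real n * (b n)\<^sup>2 + real n * V n + W n / (real n * eps n ^ d))) \<longlonglongrightarrow> 0" by simp
  qed
  have "(\<lambda>n. real n * (mse n - A n) + (real n * A n - \<tau>)) \<longlonglongrightarrow> 0 + (\<tau> - \<tau>)"
    by (intro tendsto_intros root_n_expansion[OF nD] main_term)
  moreover have "\<forall>\<^sub>F n in sequentially. real n * (mse n - A n) + (real n * A n - \<tau>) = (mse n - \<tau> / real n) / (1 / real n)"
    using eventually_gt_at_top[of 0] by eventually_elim (simp add: field_simps)
  ultimately have "(\<lambda>n. (mse n - \<tau> / real n) / (1 / real n)) \<longlonglongrightarrow> 0"
    using Lim_transform_eventually by fastforce
  thus ?thesis
    by (rule smalloI_tendsto) (use eventually_gt_at_top[of 0] in \<open>auto elim: eventually_mono\<close>)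
qed

end

section \<open>The three regimes of the bandwidth\<close>

context density_pair
begin

definition estimator_mse :: "(nat \<Rightarrow> nat) \<Rightarrow> (nat \<Rightarrow> real) \<Rightarrow> nat \<Rightarrow> real" where
  "estimator_mse mn eps n = mean_square_error M (estimator (mn n) (eps n) n) q"

text \<open>
  After multiplication by \<open>n\<close>, the variance terms of the remainder depend on \<open>n\<close> only through
  \<open>n\<^sup>2 / N\<close>, which tends to \<open>1\<close>, the deviation \<open>\<kappa>\<close> of the weights, and the smoothing error.
\<close>
lemma estimator_mse_expansion:
  assumes mn: "\<forall>\<^sub>F n in sequentially. m \<le> mn n" "(\<lambda>n. real (mn n) / real n) \<longlonglongrightarrow> 0"
    and eps: "\<forall>n\<ge>1. 0 < eps n" "eps \<longlonglongrightarrow> 0"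
  shows "\<exists>A D V W w. mse_expansion (estimator_mse mn eps) A D (\<lambda>n. \<theta> (eps n) - q) V W eps
    (4 * g_sum.long_run_variance) w DIM('a)"
proof -
  define N where "N n = real (card (idx11 (mn n) n))" for n
  define A where "A n = expectation (\<lambda>\<omega>. (linear_part n \<omega>)\<^sup>2)" for n
  define D where "D n = expectation (\<lambda>\<omega>. (remainder (mn n) (eps n) n \<omega>)\<^sup>2)" for n
  define G2 where "G2 = (\<integral>z. (g z - q)\<^sup>2 \<partial>law)"
  define \<kappa> where "\<kappa> n = \<bar>(real n)\<^sup>2 / N n - 1\<bar> + real n * real (2 * mn n + 1) / N n" for n
  define V where "V n = real (2 * m + 1) * (real n * (2 * real n / N n)\<^sup>2) * smoothing_mse (eps n)
      + real (2 * m + 1) * (real n * (2 / real n * \<kappa> n)\<^sup>2) * G2" for n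
  define W where "W n = 2 * real ((2 * m + 1)\<^sup>2) * ((real n)\<^sup>2 / N n)\<^sup>2 * \<theta> (eps n) / ball_volume TYPE('a) 1" for n
  define w where "w = 2 * real ((2 * m + 1)\<^sup>2) * 1\<^sup>2 * q / ball_volume TYPE('a) 1"
  note N_lims = card_idx11_asymp[OF mn(2), folded N_def]
  have eps_pos: "\<forall>\<^sub>F n in sequentially. 0 < eps n"
    using eps(1) by (auto simp: eventually_sequentially)
  have eps_right: "filterlim eps (at_right 0) sequentially"
    using eps(2) eps_pos by (auto simp: filterlim_at elim: eventually_mono)
  have smse: "(\<lambda>n. smoothing_mse (eps n)) \<longlonglongrightarrow> 0"
    by (rule filterlim_compose[OF smoothing_mse_tendsto_0 eps_right])
  have bias: "(\<lambda>n. \<theta> (eps n) - q) \<longlonglongrightarrow> 0"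
  proof -
    have "(\<lambda>n. (\<theta> (eps n) - q)\<^sup>2) \<longlonglongrightarrow> 0"
      by (rule tendsto_sandwich[OF _ _ tendsto_const smse]) (simp_all add: bias_square_le)
    from tendsto_real_sqrt[OF this] show ?thesis by (simp add: tendsto_rabs_zero_iff)
  qed
  have \<theta>_lim: "(\<lambda>n. \<theta> (eps n)) \<longlonglongrightarrow> q" using bias by (rule LIM_zero_cancel)
  have \<kappa>_lim: "\<kappa> \<longlonglongrightarrow> 0"
  proof -
    have "(\<lambda>n. \<bar>(real n)\<^sup>2 / N n - 1\<bar> + real n * real (2 * mn n + 1) / N n) \<longlonglongrightarrow> \<bar>1 - 1\<bar> + 0"
      by (intro tendsto_intros N_lims)
    thus ?thesis by (simp add: \<kappa>_def[abs_def])
  qed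
  have V_lim: "(\<lambda>n. real n * V n) \<longlonglongrightarrow> 0"
  proof -
    have "(\<lambda>n. real (2 * m + 1) * (4 * ((real n)\<^sup>2 / N n)\<^sup>2) * smoothing_mse (eps n)
        + real (2 * m + 1) * (4 * (\<kappa> n)\<^sup>2) * G2) \<longlonglongrightarrow> real (2 * m + 1) * (4 * 1\<^sup>2) * 0 + real (2 * m + 1) * (4 * 0\<^sup>2) * G2"
      by (intro tendsto_intros N_lims smse \<kappa>_lim)
    moreover have "\<forall>\<^sub>F n in sequentially. real (2 * m + 1) * (4 * ((real n)\<^sup>2 / N n)\<^sup>2) * smoothing_mse (eps n)
        + real (2 * m + 1) * (4 * (\<kappa> n)\<^sup>2) * G2 = real n * V n"
      using eventually_gt_at_top[of 0]
    proof eventually_elim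
      case (elim n)
      have f1: "real n * (real n * (2 * real n / N n)\<^sup>2) = 4 * ((real n)\<^sup>2 / N n)\<^sup>2"
        by (simp add: power2_eq_square)
      have f2: "real n * (real n * (2 / real n * \<kappa> n)\<^sup>2) = 4 * (\<kappa> n)\<^sup>2"
        using elim by (simp add: power2_eq_square)
      have "real n * V n = real (2 * m + 1) * (real n * (real n * (2 * real n / N n)\<^sup>2)) * smoothing_mse (eps n)
          + real (2 * m + 1) * (real n * (real n * (2 / real n * \<kappa> n)\<^sup>2)) * G2"
        unfolding V_def by (simp only: distrib_left mult.left_commute mult.assoc)
      thus ?case by (simp only: f1 f2)
    qed
    ultimately show ?thesis using Lim_transform_eventually by fastforce
  qed
  have vol: "ball_volume TYPE('a) 1 \<noteq> 0" using ball_volume_pos[of 1, where 'a='a] by simp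
  have W_lim: "W \<longlonglongrightarrow> w"
    unfolding W_def w_def by (intro tendsto_intros N_lims \<theta>_lim vol)
  have good: "\<forall>\<^sub>F n in sequentially. 0 < n \<and> 0 < card (idx11 (mn n) n) \<and> m \<le> mn n \<and> 0 < eps n"
    using eventually_gt_at_top[of 0] card_idx11_asymp(3)[OF mn(2)] mn(1) eps_pos by eventually_elim simp
  have "mse_expansion (estimator_mse mn eps) A D (\<lambda>n. \<theta> (eps n) - q) V W eps (4 * g_sum.long_run_variance) w DIM('a)"
  proof
    show "0 \<le> estimator_mse mn eps n" "0 \<le> A n" "0 \<le> D n" for n
      by (simp_all add: estimator_mse_def mean_square_error_def A_def D_def)
    show "\<forall>\<^sub>F n in sequentially. \<forall>s>0. \<bar>estimator_mse mn eps n - A n\<bar> \<le> s * A n + (1 + 1 / s) * D n"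
      using good
    proof eventually_elim
      case (elim n)
      thus ?case unfolding estimator_mse_def A_def D_def by (intro allI impI estimator_mse_perturbation) auto
    qed
    show "(\<lambda>n. real n * A n) \<longlonglongrightarrow> 4 * g_sum.long_run_variance"
      unfolding A_def by (rule linear_part_asymp)
    show "\<forall>\<^sub>F n in sequentially. D n \<le> 4 * ((\<theta> (eps n) - q)\<^sup>2 + V n + W n / ((real n)\<^sup>2 * eps n ^ DIM('a)))"
      using good
    proof eventually_elim
      case (elim n)
      hence N_pos: "0 < N n" by (simp add: N_def)
      have W_eq: "2 * real ((2 * m + 1)\<^sup>2) * ((real n)\<^sup>2 / (N n)\<^sup>2) * (\<theta> (eps n) / ball_volume TYPE('a) (eps n))
          = W n / ((real n)\<^sup>2 * eps n ^ DIM('a))"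
      proof -
        have "ball_volume TYPE('a) (eps n) = ball_volume TYPE('a) 1 * eps n ^ DIM('a)"
          using elim by (intro ball_volume_eq) simp
        thus ?thesis using elim N_pos vol unfolding W_def by (simp add: power_divide power2_eq_square)
      qed
      show ?case
        unfolding W_eq[symmetric] V_def \<kappa>_def G2_def D_def
        using remainder_second_moment(3)[of "mn n" n "eps n"] elim N_pos unfolding N_def by (simp add: add.assoc)
    qed
    show "(\<lambda>n. \<theta> (eps n) - q) \<longlonglongrightarrow> 0" by (rule bias)
    show "(\<lambda>n. real n * V n) \<longlonglongrightarrow> 0" by (rule V_lim)
    show "W \<longlonglongrightarrow> w" by (rule W_lim)
    show "\<forall>\<^sub>F n in sequentially. 0 < eps n" by (rule eps_pos)
    show "0 < DIM('a)" by simp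
  qed
  thus ?thesis by blast
qed

lemma bias_H2_eventually:
  assumes "\<forall>n\<ge>1. 0 < eps n" "eps \<longlonglongrightarrow> 0" "pX \<in> H2 \<alpha> K" "pY \<in> H2 \<alpha> K" "0 < K" "0 < \<alpha>"
  shows "\<forall>\<^sub>F n in sequentially. \<bar>\<theta> (eps n) - q\<bar> \<le> (K * eps n powr \<alpha>)\<^sup>2"
proof -
  have "\<forall>\<^sub>F n in sequentially. eps n < 1" using assms(2) by (rule order_tendstoD) simp
  with eventually_ge_at_top[of 1] show ?thesis
    by eventually_elim (use assms in \<open>auto intro!: bias_H2\<close>)
qed

lemma long_run_variance_eq:
  "g_sum.long_run_variance = sigma11_sq M m (\<lambda>i \<omega>. u (Z i \<omega>)) (\<lambda>i \<omega>. v (Z i \<omega>)) pX pY"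
proof -
  have g: "g_fun pX pY (u z) (v z) = g z" for z by (simp add: g_fun_def g_def)
  have mean: "expectation (\<lambda>\<omega>. g (Z i \<omega>)) = q" if "1 \<le> i" for i
    using expectation_Z[OF that g_measurable] by (simp add: integral_g)
  show ?thesis
    unfolding g_sum.long_run_variance_def sigma11_sq_def g autocov_def covariance_def
    using mean by (simp add: power2_eq_square)
qed

end

theorem theorem3:
  fixes M :: "'w measure"
    and X Y :: "nat \<Rightarrow> 'w \<Rightarrow> 'a::euclidean_space"
    and pX pY :: "'a \<Rightarrow> real"
    and m k l :: nat
    and mn :: "nat \<Rightarrow> nat"
    and eps :: "nat \<Rightarrow> real"
  defines "mse \<equiv> \<lambda>n. mean_square_error M (Q_tilde k l X Y (mn n) (eps n) n) (q_functional k l pX pY)"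
    and "d \<equiv> real DIM('a)"
  assumes "prob_space M"
    and "random_sequence M X" and "strictly_stationary M X" and "m_dependent M m X"
    and "random_sequence M Y" and "strictly_stationary M Y" and "m_dependent M m Y"
    and "is_density M (X 1) pX" and "is_density M (Y 1) pY"
    and "(k, l) \<in> {(2, 0), (1, 1)}"
    and "pX \<in> Lp_fun 3" and "pY \<in> Lp_fun 3"
    and "strictly_stationary M (\<lambda>i \<omega>. (X i \<omega>, Y i \<omega>))"
    and "m_dependent M m (\<lambda>i \<omega>. (X i \<omega>, Y i \<omega>))"
    and "\<forall>n\<ge>1. mn n > 0"
    and "\<forall>\<^sub>F n in sequentially. m \<le> mn n"
    and "(\<lambda>n. real (mn n) / real n) \<longlonglongrightarrow> 0"
    and "\<forall>n\<ge>1. eps n > 0"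
    and "eps \<longlonglongrightarrow> 0"
  shows
    "(filterlim (\<lambda>n. (real n)\<^sup>2 * eps n ^ DIM('a)) at_top sequentially \<longrightarrow> mse \<longlonglongrightarrow> 0) \<and>
     (\<forall>\<alpha> K c. 0 < \<alpha> \<and> \<alpha> \<le> 1 \<and> 0 < K \<and> pX \<in> H2 \<alpha> K \<and> pY \<in> H2 \<alpha> K \<and> \<alpha> \<le> d / 4 \<and>
        0 < c \<and> eps \<sim>[sequentially] (\<lambda>n. c * real n powr (- 2 / (4 * \<alpha> + d))) \<longrightarrow>
        mse \<in> O(\<lambda>n. real n powr (- 8 * \<alpha> / (4 * \<alpha> + d)))) \<and>
     (\<forall>\<alpha> K L. 0 < \<alpha> \<and> \<alpha> \<le> 1 \<and> 0 < K \<and> pX \<in> H2 \<alpha> K \<and> pY \<in> H2 \<alpha> K \<and> d / 4 < \<alpha> \<and>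
        slowly_varying L \<and> filterlim (\<lambda>n. L (real n)) at_top sequentially \<and>
        eps \<sim>[sequentially] (\<lambda>n. L (real n) * real n powr (- 1 / d)) \<longrightarrow>
        (\<lambda>n. mse n - 4 * sigma_sq k l M m X Y pX pY / real n) \<in> o(\<lambda>n. 1 / real n))"
proof -
  have "\<exists>A D b V W w. mse_expansion mse A D b V W eps (4 * sigma_sq k l M m X Y pX pY) w DIM('a) \<and>
    (\<forall>\<alpha> K. pX \<in> H2 \<alpha> K \<and> pY \<in> H2 \<alpha> K \<and> 0 < K \<and> 0 < \<alpha> \<longrightarrow>
      (\<forall>\<^sub>F n in sequentially. \<bar>b n\<bar> \<le> (K * eps n powr \<alpha>)\<^sup>2))"
    using assms(12)
  proof (elim insertE emptyE)
    assume kl: "(k, l) = (2, 0)"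
    interpret prob_space M by fact
    interpret density_pair M m X "\<lambda>x. x" "\<lambda>x. x" pX pX
      by unfold_locales (use assms in auto)
    have mse: "mse = estimator_mse mn eps"
      unfolding mse_def estimator_mse_def estimator_eq_Q11[symmetric]
      using kl by (simp add: mean_square_error_def Q_tilde_def q_functional_def q20_def q_def Q20_eq_Q11 power2_eq_square)
    have sigma: "sigma_sq k l M m X Y pX pY = g_sum.long_run_variance"
      using kl by (simp add: long_run_variance_eq sigma_sq_def sigma20_sq_def sigma11_sq_def g_fun_def)
    show ?thesis
      unfolding mse sigma
      using estimator_mse_expansion[OF assms(18-21)] bias_H2_eventually[OF assms(20,21)] by blast
  next
    assume kl: "(k, l) = (1, 1)"
    interpret prob_space M by fact
    have "random_sequence M (\<lambda>i \<omega>. (X i \<omega>, Y i \<omega>))"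
      using assms(4,7) by (auto simp: random_sequence_def intro!: borel_measurable_Pair)
    then interpret density_pair M m "\<lambda>i \<omega>. (X i \<omega>, Y i \<omega>)" fst snd pX pY
      by unfold_locales (use assms in \<open>auto simp: borel_prod[symmetric]\<close>)
    have mse: "mse = estimator_mse mn eps"
      unfolding mse_def estimator_mse_def estimator_eq_Q11[symmetric]
      using kl by (simp add: mean_square_error_def Q_tilde_def q_functional_def q11_def q_def)
    have sigma: "sigma_sq k l M m X Y pX pY = g_sum.long_run_variance"
      using kl by (simp add: long_run_variance_eq sigma_sq_def)
    show ?thesis
      unfolding mse sigma
      using estimator_mse_expansion[OF assms(18-21)] bias_H2_eventually[OF assms(20,21)] by blast
  qed
  then obtain A D b V W w
    where E: "mse_expansion mse A D b V W eps (4 * sigma_sq k l M m X Y pX pY) w DIM('a)"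
      and bias: "\<And>\<alpha> K. pX \<in> H2 \<alpha> K \<Longrightarrow> pY \<in> H2 \<alpha> K \<Longrightarrow> 0 < K \<Longrightarrow> 0 < \<alpha> \<Longrightarrow>
        \<forall>\<^sub>F n in sequentially. \<bar>b n\<bar> \<le> (K * eps n powr \<alpha>)\<^sup>2" by blast
  interpret E: mse_expansion mse A D b V W eps "4 * sigma_sq k l M m X Y pX pY" w "DIM('a)" by (rule E)
  show ?thesis
    unfolding d_def
  proof (intro conjI allI impI; (elim conjE)?)
    assume "filterlim (\<lambda>n. (real n)\<^sup>2 * eps n ^ DIM('a)) at_top sequentially"
    thus "mse \<longlonglongrightarrow> 0" by (rule E.consistency)
  next
    fix \<alpha> K c :: real
    assume "0 < \<alpha>" "0 < K" "pX \<in> H2 \<alpha> K" "pY \<in> H2 \<alpha> K" "\<alpha> \<le> real DIM('a) / 4" "0 < c"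
      and "eps \<sim>[sequentially] (\<lambda>n. c * real n powr (- 2 / (4 * \<alpha> + real DIM('a))))"
    thus "mse \<in> O(\<lambda>n. real n powr (- 8 * \<alpha> / (4 * \<alpha> + real DIM('a))))"
      by (intro E.rate_below_root_n bias)
  next
    fix \<alpha> K :: real and L :: "real \<Rightarrow> real"
    assume "0 < \<alpha>" "0 < K" "pX \<in> H2 \<alpha> K" "pY \<in> H2 \<alpha> K" "real DIM('a) / 4 < \<alpha>" "slowly_varying L"
      and "filterlim (\<lambda>n. L (real n)) at_top sequentially"
      and "eps \<sim>[sequentially] (\<lambda>n. L (real n) * real n powr (- 1 / real DIM('a)))"
    thus "(\<lambda>n. mse n - 4 * sigma_sq k l M m X Y pX pY / real n) \<in> o(\<lambda>n. 1 / real n)"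
      by (intro E.root_n_rate bias)
  qed
qed

end
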